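(* Let $I=[0,1]$ and let $f\colon I\to I$ be a piecewise $C^1$ uniformly expanding Markov map with a periodic singularity $p^+$ of period $n$, and suppose that $f$ has no other singularities. Define $$L(x)=\frac{\log\big((f^n)'(x)\big)}{-\log(x-p)},\qquad \overline\beta=\limsup_{x\to p^+}L(x),\qquad \underline\beta=\liminf_{x\to p^+}L(x).$$ Let $I_J$ be the transitive component of $f$ containing the singularity and let $h$ be the topological entropy of $(I_J,f)$. Then the following hold. (1) If $\overline\beta<1$ and $h>-\frac1n\log(1-\overline\beta)$, then the measure of maximal entropy for $(I_J,f)$ is adapted with respect to $p$. (2) If $\underline\beta<1$ and $h<-\frac1n\log(1-\underline\beta)$, then the measure of maximal entropy for $(I_J,f)$ is nonadapted with respect to $p$. (3) If $\underline\beta=1$, then the measure of maximal entropy for $(I_J,f)$ is nonadapted with respect to $p$.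
   Context: Piecewise $C^1$ uniformly expanding Markov map: a map $f\colon I\to I$ on a closed bounded interval $I=[a,b]$ for which there exist $\lambda>1$ and a finite set $B=\{a=x_0<x_1<\dots<x_m=b\}$, defining subintervals $I_i=[x_i,x_{i+1}]$ ($0\le i\le m-1$), such that (A) on each $I_i$ there is a continuous monotonic map $\tilde f_i\colon I_i\to I$ with $f=\tilde f_i$ on $\operatorname{int}(I_i)$; (B) for each $x_i$, $f(x_i)=\lim_{x\to x_i^+}f(x)$ or $f(x_i)=\lim_{x\to x_i^-}f(x)$ (only the one-sided limit that makes sense being considered at $a$ and $b$); (C) $f|_{\operatorname{int}(I_i)}$ is $C^1$ with $|(f|_{\operatorname{int}(I_i)})'|\ge\lambda$ for each $i$; (D) for each $i$, $\tilde f_i(I_i)=\bigcup_{j\in V(i)}I_j$ for some $V(i)\subset\{0,\dots,m-1\}$. One-sided points and the map $\tilde f$: let $\tilde B=\bigcup_{k\ge0}f^{-k}(B)$. Let $\tilde I$ be obtained from $I$ by replacing each $x\in\tilde B\setminus\{a,b\}$ by two points $x^-=(x,-1)$ and $x^+=(x,1)$; write also $a^+=a$ and $b^-=b$. With the (lexicographic) order topology on $\tilde I$, $\tilde f\colon\tilde I\to\tilde I$ is the continuous piecewise monotonic map that agrees with $f$ on $I\setminus\tilde B$. Explicitly, on one-sided points $\tilde f(x^{+})=y^{s}$, where $y=\lim_{t\to x^{+}}f(t)$ and $s=+$ if $f$ is increasing immediately to the right of $x$, $s=-$ if it is decreasing there; and $\tilde f(x^{-})=y^{s}$, where $y=\lim_{t\to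 x^{-}}f(t)$ and $s=-$ if $f$ is increasing immediately to the left of $x$, $s=+$ if it is decreasing there. Singularities: let $B'=\{a=x_0,x_1^-,x_1^+,\dots,x_{m-1}^-,x_{m-1}^+,x_m=b\}\subset\tilde I$. A point $p^+\in B'$ is a singularity of $f$ if $\limsup_{x\to p^+}|f'(x)|=\infty$; a point $p^-\in B'$ is a singularity of $f$ if $\limsup_{x\to p^-}|f'(x)|=\infty$. A singularity $p^+\in B'$ is periodic if $\tilde f^{\,n}(p^+)=p^+$ for some $n\ge1$; the minimum such $n$ is its period. Transitive component: on $S=\{0,\dots,m-1\}$ write $i\precsim j$ if there is $k\ge1$ with $f^{-k}(\operatorname{int}(I_j))\cap I_i\ne\emptyset$. Let $j^*$ be the index with $p=x_{j^*}$ (so $I_{j^*}$ has left endpoint $p$), let $J=\{j\in S: j^*\precsim j\text{ and }j\precsim j^*\}$ (which contains $j^*$ because $p^+$ is periodic), and $I_J=\bigcup_{j\in J}I_j$. Entropy and MME for $(I_J,f)$: the invariant measures of $(I_J,f)$ are the $f$-invariant Borel probability measures $\mu$ with $\mu(I_J)=1$; the topological entropy $h$ of $(I_J,f)$ is the supremum of their measure-theoretic entropies $h_\mu$, and the measure of maximal entropy (MME) for $(I_J,f)$ is the (unique) such $\mu$ with $h_\mu=h$. Adaptedness: put $I_p^+=\{x\in I:x>p\}$. An $f$-invariant Borel probability measure $\mu$ is adapted with respect to $p$ if $\mu(\{p\})=0$ and $\int_{I_p^+}|\log(x-p)|\,d\mu(x)<\infty$; otherwise it is nonadapted with respect to $p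$.
   Formalization: Parts (2) and (3) are stated under the extra condition that h > 0, or that the measure of maximal entropy exists and is unique and every iterate of f is right-continuous at p; without it (2) can fail when h = 0. *)

theory Defs
  imports "HOL-Probability.Probability"
begin

(* B = {x 0 < ... < x m}. The continuous extension g of f to a closed branch is unique, so one
   existential quantifier serves both (A) and (D). *)
definition expanding_markov_map ::
  "real \<Rightarrow> real \<Rightarrow> (real \<Rightarrow> real) \<Rightarrow> nat \<Rightarrow> (nat \<Rightarrow> real) \<Rightarrow> bool" where
  "expanding_markov_map a b f m x \<longleftrightarrow>
     f ` {a..b} \<subseteq> {a..b} \<and>
     0 < m \<and> strict_mono_on {..m} x \<and> x 0 = a \<and> x m = b \<and>
     (\<forall>i<m. \<exists>g.
        continuous_on {x i..x (Suc i)} g \<and>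
        (mono_on {x i..x (Suc i)} g \<or> antimono_on {x i..x (Suc i)} g) \<and>
        g ` {x i..x (Suc i)} \<subseteq> {a..b} \<and>
        (\<forall>t\<in>{x i<..<x (Suc i)}. f t = g t) \<and>
        (\<exists>V\<subseteq>{..<m}. g ` {x i..x (Suc i)} = (\<Union>j\<in>V. {x j..x (Suc j)}))) \<and>
     (\<forall>i\<le>m. (i < m \<and> (f \<longlongrightarrow> f (x i)) (at_right (x i))) \<or>
            (0 < i \<and> (f \<longlongrightarrow> f (x i)) (at_left (x i)))) \<and>
     (\<exists>c>1. \<forall>i<m. f C1_differentiable_on {x i<..<x (Suc i)} \<and>
        (\<forall>t\<in>{x i<..<x (Suc i)}. \<bar>deriv f t\<bar> \<ge> c))"

(* The one-sided points y^- and y^+ are (y, Minus) and (y, Plus); in particular the end points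
   a = a^+ and b = b^- are (a, Plus) and (b, Minus). *)
datatype side = Minus | Plus

(* The map on the one-sided points only. They are forward invariant and contain B', so this
   part of the map determines the periods of the points of B'. Near a one-sided point f is
   strictly monotone, so "not increasing" below means "decreasing". *)
fun f_tilde :: "(real \<Rightarrow> real) \<Rightarrow> real \<times> side \<Rightarrow> real \<times> side" where
  "f_tilde f (y, Plus) =
     (Lim (at_right y) f,
      if \<exists>e>0. strict_mono_on {y<..<y + e} f then Plus else Minus)"
| "f_tilde f (y, Minus) =
     (Lim (at_left y) f,
      if \<exists>e>0. strict_mono_on {y - e<..<y} f then Minus else Plus)"

definition singularities :: "(real \<Rightarrow> real) \<Rightarrow> nat \<Rightarrow> (nat \<Rightarrow> real) \<Rightarrow> (real \<times> side) set" where
  "singularities f m x =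
     {(x i, Plus) | i. i < m \<and> Limsup (at_right (x i)) (\<lambda>t. ereal \<bar>deriv f t\<bar>) = \<infinity>} \<union>
     {(x i, Minus) | i. 0 < i \<and> i \<le> m \<and> Limsup (at_left (x i)) (\<lambda>t. ereal \<bar>deriv f t\<bar>) = \<infinity>}"

definition has_period :: "('a \<Rightarrow> 'a) \<Rightarrow> 'a \<Rightarrow> nat \<Rightarrow> bool" where
  "has_period T q n \<longleftrightarrow> 1 \<le> n \<and> (T ^^ n) q = q \<and> (\<forall>k. 1 \<le> k \<and> k < n \<longrightarrow> (T ^^ k) q \<noteq> q)"

definition leads_to :: "(real \<Rightarrow> real) \<Rightarrow> (nat \<Rightarrow> real) \<Rightarrow> nat \<Rightarrow> nat \<Rightarrow> bool" where
  "leads_to f x i j \<longleftrightarrow>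
     (\<exists>k\<ge>1. (f ^^ k) -` {x j<..<x (Suc j)} \<inter> {x i..x (Suc i)} \<noteq> {})"

definition transitive_component ::
  "(real \<Rightarrow> real) \<Rightarrow> nat \<Rightarrow> (nat \<Rightarrow> real) \<Rightarrow> nat \<Rightarrow> real set" where
  "transitive_component f m x j =
     (\<Union>i\<in>{i. i < m \<and> leads_to f x j i \<and> leads_to f x i j}. {x i..x (Suc i)})"

definition partition_entropy :: "'a measure \<Rightarrow> 'a set set \<Rightarrow> real" where
  "partition_entropy M P = - (\<Sum>A\<in>P. measure M A * ln (measure M A))"

definition iterated_join :: "'a measure \<Rightarrow> ('a \<Rightarrow> 'a) \<Rightarrow> 'a set set \<Rightarrow> nat \<Rightarrow> 'a set set" where
  "iterated_join M T P n =
     {(\<Inter>k<n. (T ^^ k) -` A k) \<inter> space M | A. A \<in> {..<n} \<rightarrow> P}"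

(* Kolmogorov-Sinai entropy. For a T-invariant probability measure the limit exists, by
   subadditivity. *)
definition measure_entropy :: "'a measure \<Rightarrow> ('a \<Rightarrow> 'a) \<Rightarrow> ereal" where
  "measure_entropy M T =
     (SUP P\<in>{P. finite P \<and> P \<subseteq> sets M \<and> partition_on (space M) P}.
        ereal (lim (\<lambda>n. partition_entropy M (iterated_join M T P n) / real n)))"

definition invariant_measures :: "real set \<Rightarrow> (real \<Rightarrow> real) \<Rightarrow> real set \<Rightarrow> real measure set" where
  "invariant_measures I f K =
     {\<mu>. sets \<mu> = sets (restrict_space borel I) \<and> prob_space \<mu> \<and>
         f \<in> \<mu> \<rightarrow>\<^sub>M \<mu> \<and> distr \<mu> \<mu> f = \<mu> \<and> emeasure \<mu> K = 1}"

definition topological_entropy :: "real set \<Rightarrow> (real \<Rightarrow> real) \<Rightarrow> real set \<Rightarrow> ereal" where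
  "topological_entropy I f K = (SUP \<mu>\<in>invariant_measures I f K. measure_entropy \<mu> f)"

definition is_mme :: "real set \<Rightarrow> (real \<Rightarrow> real) \<Rightarrow> real set \<Rightarrow> real measure \<Rightarrow> bool" where
  "is_mme I f K \<mu> \<longleftrightarrow>
     \<mu> \<in> invariant_measures I f K \<and> measure_entropy \<mu> f = topological_entropy I f K"

definition mme :: "real set \<Rightarrow> (real \<Rightarrow> real) \<Rightarrow> real set \<Rightarrow> real measure" where
  "mme I f K = (THE \<mu>. is_mme I f K \<mu>)"

definition adapted :: "real \<Rightarrow> real measure \<Rightarrow> bool" where
  "adapted p \<mu> \<longleftrightarrow>
     emeasure \<mu> {p} = 0 \<and>
     (\<integral>\<^sup>+t\<in>{t \<in> space \<mu>. p < t}. ennreal \<bar>ln (t - p)\<bar> \<partial>\<mu>) < \<infinity>"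

abbreviation nonadapted :: "real \<Rightarrow> real measure \<Rightarrow> bool" where
  "nonadapted p \<mu> \<equiv> \<not> adapted p \<mu>"

end

theory Submission
  imports Defs
begin

text \<open>
  When the entropy \<open>h\<close> is positive, the measure of maximal entropy is the Parry measure of the
  transition graph on the component, and the question becomes one about two competing exponential
  rates along the orbit of the one-sided point \<open>p\<^sup>+\<close>.

  Let \<open>J\<close> be the communicating class of the interval to the right of \<open>p\<close>, with \<open>0/1\<close> transition
  matrix \<open>A\<close>, Perron eigenvalue \<open>\<lambda> = exp h\<close>, left eigenvector \<open>u\<close> and right eigenvector \<open>v\<close>. The cylinders of
  length \<open>k n + 1\<close> that follow the itinerary of \<open>p\<^sup>+\<close> are intervals \<open>(p, p + \<epsilon>\<^sub>k)\<close>, and \<open>f ^^ n\<close> maps each of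
  them increasingly onto the preceding one (\<open>cylinder_tower\<close>). The Parry measure gives them mass
  \<open>const * \<lambda> ^ (- n k) = const * exp (- n h k)\<close>. If the derivative of the return map is about
  \<open>(t - p) powr (- \<beta>)\<close>, then \<open>\<epsilon>\<^sub>k\<close> is about \<open>\<epsilon>\<^sub>k\<^sub>+\<^sub>1 powr (1 - \<beta>)\<close>, so \<open>- ln \<epsilon>\<^sub>k\<close> grows like
  \<open>(1 / (1 - \<beta>)) ^ k\<close> (\<open>step_upper\<close>, \<open>step_lower\<close>). The integral of \<open>\<bar>ln (t - p)\<bar>\<close> is comparable with
  the sum of \<open>- ln \<epsilon>\<^sub>k\<close> weighted by these masses; it converges if \<open>1 / (1 - \<beta>) < exp (n h)\<close> and diverges
  if \<open>1 / (1 - \<beta>) > exp (n h)\<close>. These are the inequalities between \<open>h\<close> and \<open>- ln (1 - \<beta>) / n\<close>; a lower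
  exponent equal to \<open>1\<close> allows \<open>1 / (1 - \<beta>)\<close> to be as large as one likes.

  Most of the work is to identify the measure of maximal entropy among all invariant measures, with
  entropy defined through arbitrary finite Borel partitions. Uniform expansion makes the partition
  into open branches and knots a generator, so its entropy rate is the full entropy
  (\<open>entropy_rate_le_generator\<close>). For that partition, each increment of the Shannon entropy after the first is at most
  \<open>ln \<lambda>\<close> by Gibbs' inequality against the Parry transition probabilities \<open>A\<^sub>i\<^sub>l v\<^sub>l / (\<lambda> v\<^sub>i)\<close>
  (\<open>shannon_increment\<close>). Equality forces these transition probabilities, hence, by uniqueness of the left
  eigenvector, all cylinder masses (\<open>maximal_entropy_cylinders\<close>), and cylinder masses determine the
  measure (\<open>measure_unique_of_masses\<close>). Existence comes from writing down the distribution function of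
  the Parry measure as a limit over cylinders (\<open>parry_measure_exists\<close>).

  If \<open>h\<close> is not positive, then the uniform measure on the orbit of \<open>p\<close> is a measure of maximal entropy,
  since entropies are nonnegative; one-sided continuity makes \<open>p\<close> itself periodic with orbit inside
  the component. As the maximizing measure is then assumed to be unique, it has an atom at \<open>p\<close>
  (\<open>zero_entropy_case\<close>).
\<close>

section \<open>Perron eigenvectors of irreducible matrices\<close>

definition mat_app :: "'a set \<Rightarrow> ('a \<Rightarrow> 'a \<Rightarrow> real) \<Rightarrow> ('a \<Rightarrow> real) \<Rightarrow> 'a \<Rightarrow> real" where
  "mat_app S A y i = (\<Sum>k\<in>S. A i k * y k)"

definition mat_graph :: "'a set \<Rightarrow> ('a \<Rightarrow> 'a \<Rightarrow> real) \<Rightarrow> ('a \<times> 'a) set" where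
  "mat_graph S A = {(i, k). i \<in> S \<and> k \<in> S \<and> 0 < A i k}"

text \<open>The map \<open>I + A\<close> commutes with \<open>A\<close>, so the excess \<open>A x - t x\<close> transforms like \<open>x\<close> itself when
  \<open>I + A\<close> is applied to \<open>x\<close>.\<close>

lemma mat_app_shift_commute:
  assumes "\<forall>i\<in>S. y i = mat_app S A x i - t * x i"
  shows "\<forall>i\<in>S. y i + mat_app S A y i =
           mat_app S A (\<lambda>i. x i + mat_app S A x i) i - t * (x i + mat_app S A x i)"
proof
  fix i assume i: "i \<in> S"
  have "mat_app S A y i = (\<Sum>k\<in>S. A i k * (mat_app S A x k - t * x k))"
    unfolding mat_app_def[of S A y i] using assms by (intro sum.cong) auto
  also have "\<dots> = mat_app S A (mat_app S A x) i - t * mat_app S A x i"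
    by (simp add: mat_app_def right_diff_distrib sum_subtractf sum_distrib_left mult_ac)
  finally have 1: "mat_app S A y i = mat_app S A (mat_app S A x) i - t * mat_app S A x i" .
  have 2: "mat_app S A (\<lambda>i. x i + mat_app S A x i) i = mat_app S A x i + mat_app S A (mat_app S A x) i"
    by (simp add: mat_app_def[of _ _ "\<lambda>i. x i + mat_app S A x i"] distrib_left sum.distrib)
       (simp add: mat_app_def)
  show "y i + mat_app S A y i =
           mat_app S A (\<lambda>i. x i + mat_app S A x i) i - t * (x i + mat_app S A x i)"
    using 1 2 assms i by (simp add: algebra_simps)
qed

text \<open>Because of the identity summand a positive coordinate stays positive, and positivity spreads
  backwards along edges; as there are finitely many vertices, one exponent serves all of them.\<close>

lemma iterate_shift_positive:
  fixes A :: "'a \<Rightarrow> 'a \<Rightarrow> real"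
  assumes fin: "finite S" and A: "\<forall>i\<in>S. \<forall>k\<in>S. 0 \<le> A i k"
    and irr: "\<forall>i\<in>S. (i, l) \<in> (mat_graph S A)\<^sup>*"
    and l: "l \<in> S" "0 < y l" and y: "\<forall>i\<in>S. 0 \<le> y i"
  defines "K \<equiv> \<lambda>y i. y i + mat_app S A y i"
  shows "\<exists>N. \<forall>i\<in>S. 0 < (K ^^ N) y i"
proof -
  have nonneg: "\<forall>i\<in>S. 0 \<le> (K ^^ N) y i" for N
    by (induction N) (use y A in \<open>auto simp: K_def mat_app_def intro!: add_nonneg_nonneg sum_nonneg mult_nonneg_nonneg\<close>)
  have step: "(K ^^ N) y i \<le> (K ^^ Suc N) y i" if "i \<in> S" for N i
    using nonneg[of N] A that by (auto simp: K_def mat_app_def intro!: sum_nonneg)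
  have mono: "(K ^^ N) y i \<le> (K ^^ N') y i" if "i \<in> S" "N \<le> N'" for N N' i
    using that(2) by (induction rule: dec_induct) (use step[OF that(1)] order_trans in blast)+
  have ex: "i \<in> S \<Longrightarrow> \<exists>N. 0 < (K ^^ N) y i" if "(i, l) \<in> (mat_graph S A)\<^sup>*" for i
    using that
  proof (induction rule: converse_rtrancl_induct)
    case base
    then show ?case using l by (intro exI[of _ 0]) simp
  next
    case (step i k)
    then obtain N where N: "0 < (K ^^ N) y k" by (auto simp: mat_graph_def)
    have ik: "i \<in> S" "k \<in> S" "0 < A i k" using step by (auto simp: mat_graph_def)
    have "0 < mat_app S A ((K ^^ N) y) i"
      unfolding mat_app_def
      by (rule sum_pos2[OF fin ik(2)]) (use N ik A nonneg[of N] in auto)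
    then have "0 < (K ^^ Suc N) y i"
      using nonneg[of N] ik by (auto simp: K_def intro: add_nonneg_pos)
    then show ?case by blast
  qed
  then have "\<forall>i\<in>S. \<exists>N. 0 < (K ^^ N) y i" using irr by blast
  then obtain N where N: "\<forall>i\<in>S. 0 < (K ^^ N i) y i" by metis
  have "0 < (K ^^ (Max (N ` S))) y i" if "i \<in> S" for i
    using N mono[OF that, of "N i" "Max (N ` S)"] fin that by (smt (verit) Max_ge finite_imageI imageI)
  then show ?thesis by blast
qed

text \<open>The Perron eigenvalue will be the largest \<open>t\<close> with \<open>A x \<ge> t x\<close> for some probability vector \<open>x\<close>.
  Vectors are functions with the product topology, so that no type has to encode the dimension.\<close>

lemma compact_collatz_wielandt:
  fixes A :: "'a \<Rightarrow> 'a \<Rightarrow> real"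
  assumes "finite S"
  shows "compact {(x :: 'a \<Rightarrow> real, t). (\<forall>i. x i \<in> (if i \<in> S then {0..1} else {0})) \<and> t \<in> {0..b} \<and>
     (\<Sum>i\<in>S. x i) = 1 \<and> (\<forall>i\<in>S. t * x i \<le> mat_app S A x i)}" (is "compact ?C")
proof -
  have "compactin (product_topology (\<lambda>_. euclideanreal) UNIV)
          (PiE UNIV (\<lambda>i::'a. if i \<in> S then {0..1::real} else {0}))"
    by (subst compactin_PiE) auto
  then have cube: "compact {x::'a \<Rightarrow> real. \<forall>i. x i \<in> (if i \<in> S then {0..1} else {0})}"
    by (simp add: euclidean_product_topology PiE_def Pi_def)
  have "closed {z :: ('a \<Rightarrow> real) \<times> real. (\<Sum>i\<in>S. fst z i) = 1}"
    by (intro closed_Collect_eq continuous_intros continuous_on_product_then_coordinatewise)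
  moreover have "closed {z :: ('a \<Rightarrow> real) \<times> real. \<forall>i\<in>S. snd z * fst z i \<le> mat_app S A (fst z) i}"
    unfolding Ball_def mat_app_def
    by (intro closed_Collect_all closed_Collect_imp closed_Collect_le open_Collect_const
        continuous_intros continuous_on_product_then_coordinatewise)
  ultimately have "compact (({x::'a \<Rightarrow> real. \<forall>i. x i \<in> (if i \<in> S then {0..1} else {0})} \<times> {0..b}) \<inter>
      ({z. (\<Sum>i\<in>S. fst z i) = 1} \<inter> {z. \<forall>i\<in>S. snd z * fst z i \<le> mat_app S A (fst z) i}))"
    by (intro compact_Int_closed compact_Times cube closed_Int) auto
  also have "\<dots> = ?C" by auto
  finally show ?thesis .
qed

text \<open>Take \<open>(x, t)\<close> with \<open>A x \<ge> t x\<close> and \<open>t\<close> maximal. If some inequality were strict, a power of \<open>I + A\<close>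
  would turn the excess into a vector positive in every coordinate, and \<open>t\<close> could be increased.\<close>

theorem perron_frobenius:
  fixes A :: "'a \<Rightarrow> 'a \<Rightarrow> real"
  assumes fin: "finite S" "S \<noteq> {}" and A: "\<forall>i\<in>S. \<forall>k\<in>S. 0 \<le> A i k"
    and irr: "\<forall>i\<in>S. \<forall>k\<in>S. (i, k) \<in> (mat_graph S A)\<^sup>*"
  shows "\<exists>v t. (\<forall>i\<in>S. 0 < v i) \<and> 0 \<le> t \<and> (\<forall>i\<in>S. mat_app S A v i = t * v i)"
proof -
  define b where "b = (\<Sum>i\<in>S. \<Sum>k\<in>S. A i k)"
  define C where "C = {(x :: 'a \<Rightarrow> real, t). (\<forall>i. x i \<in> (if i \<in> S then {0..1} else {0})) \<and> t \<in> {0..b} \<and>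
     (\<Sum>i\<in>S. x i) = 1 \<and> (\<forall>i\<in>S. t * x i \<le> mat_app S A x i)}"
  have "compact C" unfolding C_def by (rule compact_collatz_wielandt[OF fin(1)])
  have b0: "0 \<le> b" unfolding b_def using A by (auto intro!: sum_nonneg)
  obtain s where s: "s \<in> S" using fin by blast
  have "((\<lambda>i. if i = s then 1 else 0), 0) \<in> C"
    using s b0 fin A by (auto simp: C_def mat_app_def intro!: sum_nonneg)
  then have "C \<noteq> {}" by blast
  obtain z where z: "z \<in> C" "\<forall>z'\<in>C. snd z' \<le> snd z"
    using continuous_attains_sup[OF \<open>compact C\<close> \<open>C \<noteq> {}\<close> continuous_on_snd[OF continuous_on_id]]
    by blast
  obtain x t where xt: "z = (x, t)" by (cases z)
  define K where "K = (\<lambda>y i. y i + mat_app S A y i)"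
  have x: "\<forall>i\<in>S. 0 \<le> x i" "(\<Sum>i\<in>S. x i) = 1" "0 \<le> t" "\<forall>i\<in>S. t * x i \<le> mat_app S A x i"
    using z xt by (auto simp: C_def split: if_splits)
  have "\<exists>l\<in>S. 0 < x l"
  proof (rule ccontr)
    assume "\<not> ?thesis"
    then have "(\<Sum>i\<in>S. x i) \<le> 0" by (intro sum_nonpos) force
    then show False using x by simp
  qed
  then obtain l where l: "l \<in> S" "0 < x l" by blast
  have pos: "\<exists>N. \<forall>i\<in>S. 0 < (K ^^ N) y i" if "\<forall>i\<in>S. 0 \<le> y i" "k \<in> S" "0 < y k" for y k
    unfolding K_def by (rule iterate_shift_positive[OF fin(1) A _ that(2,3,1)]) (use irr that in blast)
  define y where "y = (\<lambda>i. mat_app S A x i - t * x i)"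
  have y0: "\<forall>i\<in>S. 0 \<le> y i" using x by (auto simp: y_def)
  have itr: "\<forall>i\<in>S. (K ^^ N) y i = mat_app S A ((K ^^ N) x) i - t * (K ^^ N) x i" for N
  proof (induction N)
    case 0 then show ?case by (simp add: y_def)
  next
    case (Suc N)
    show ?case using mat_app_shift_commute[OF Suc.IH] by (simp add: K_def)
  qed
  have Knn: "\<forall>i\<in>S. 0 \<le> (K ^^ N) x i" for N
    by (induction N) (use x A in \<open>auto simp: K_def mat_app_def intro!: add_nonneg_nonneg sum_nonneg mult_nonneg_nonneg\<close>)
  have Kge: "\<forall>i\<in>S. x i \<le> (K ^^ N) x i" for N
  proof (induction N)
    case (Suc N)
    have "0 \<le> mat_app S A ((K ^^ N) x) i" if "i \<in> S" for i
      unfolding mat_app_def using Knn[of N] A that by (intro sum_nonneg mult_nonneg_nonneg) auto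
    then show ?case using Suc by (fastforce simp: K_def)
  qed auto
  have eig: "\<forall>i\<in>S. mat_app S A x i = t * x i"
  proof (rule ccontr)
    assume "\<not> ?thesis"
    then obtain k where "k \<in> S" "0 < y k" using y0 by (force simp: y_def)
    then obtain N where N: "\<forall>i\<in>S. 0 < (K ^^ N) y i" using pos y0 by blast
    define w where "w = (K ^^ N) x"
    define r where "r = (\<Sum>i\<in>S. w i)"
    have w0: "\<forall>i\<in>S. 0 \<le> w i" using Knn w_def by simp
    have r: "1 \<le> r" unfolding r_def x(2)[symmetric] w_def using Kge by (intro sum_mono) auto
    define d where "d = Min ((K ^^ N) y ` S)"
    have d: "0 < d" unfolding d_def using N fin by (subst Min_gr_iff) auto
    \<comment> \<open>No coordinate of \<open>w\<close> exceeds \<open>r\<close>, so raising \<open>t\<close> by \<open>d / r\<close> costs at most the excess \<open>d\<close>.\<close>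
    define e where "e = d / r"
    have e0: "0 < e" using d r by (simp add: e_def)
    have gt: "(t + e) * w i \<le> mat_app S A w i" if i: "i \<in> S" for i
    proof -
      have "w i \<le> r" unfolding r_def using w0 fin i by (intro member_le_sum) auto
      then have "e * w i \<le> d" using e0 r d by (auto simp: e_def field_simps)
      also have "d \<le> (K ^^ N) y i" unfolding d_def using fin i by auto
      finally show ?thesis using itr[of N] i by (auto simp: w_def algebra_simps)
    qed
    define x' where "x' = (\<lambda>i. if i \<in> S then w i / r else 0)"
    have x'1: "(\<Sum>i\<in>S. x' i) = 1"
      using r by (simp add: x'_def sum_divide_distrib[symmetric] r_def)
    have x'0: "\<forall>i\<in>S. 0 \<le> x' i" using w0 r by (simp add: x'_def)
    have x'le: "x' i \<le> 1" if "i \<in> S" for i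
      using member_le_sum[of i S x'] x'0 that fin x'1 by auto
    have app: "(t + e) * x' i \<le> mat_app S A x' i" if "i \<in> S" for i
    proof -
      have "mat_app S A x' i = mat_app S A w i / r"
        by (simp add: mat_app_def x'_def sum_divide_distrib)
      then show ?thesis using gt[OF that] r that by (simp add: x'_def divide_right_mono)
    qed
    have "t + e = (\<Sum>i\<in>S. (t + e) * x' i)" using x'1 by (simp add: sum_distrib_left[symmetric])
    also have "\<dots> \<le> (\<Sum>i\<in>S. mat_app S A x' i)" using app by (intro sum_mono) auto
    also have "\<dots> \<le> b" unfolding b_def mat_app_def using A x'0 x'le
      by (intro sum_mono) (auto intro: mult_left_le)
    finally have "(x', t + e) \<in> C" unfolding C_def using x'0 x'le x'1 app x(3) e0 by (auto simp: x'_def)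
    then show False using z xt e0 by force
  qed
  obtain N where N: "\<forall>i\<in>S. 0 < (K ^^ N) x i" using pos x(1) l by blast
  have "\<forall>i\<in>S. (K ^^ n) x i = (1 + t) ^ n * x i" for n
  proof (induction n)
    case (Suc n)
    have "mat_app S A ((K ^^ n) x) i = (1 + t) ^ n * mat_app S A x i" for i
      unfolding mat_app_def sum_distrib_left using Suc by (intro sum.cong) auto
    then show ?case using Suc eig by (auto simp: K_def algebra_simps)
  qed auto
  then have "\<forall>i\<in>S. 0 < x i" using N x(3) by (smt (verit) mult_nonneg_nonpos zero_le_power)
  then show ?thesis using eig x(3) by blast
qed

text \<open>A matrix and its transpose share the Perron eigenvalue because both eigenvalues multiply the same
  positive number \<open>u \<bullet> v\<close>.\<close>

corollary perron_frobenius_pair: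
  fixes A :: "'a \<Rightarrow> 'a \<Rightarrow> real"
  assumes fin: "finite S" "S \<noteq> {}" and A: "\<forall>i\<in>S. \<forall>k\<in>S. 0 \<le> A i k"
    and irr: "\<forall>i\<in>S. \<forall>k\<in>S. (i, k) \<in> (mat_graph S A)\<^sup>*"
  obtains u v t where "\<forall>i\<in>S. 0 < u i" "\<forall>i\<in>S. 0 < v i" "0 \<le> t" "(\<Sum>i\<in>S. u i * v i) = 1"
    "\<forall>i\<in>S. (\<Sum>k\<in>S. A i k * v k) = t * v i" "\<forall>k\<in>S. (\<Sum>i\<in>S. u i * A i k) = t * u k"
proof -
  obtain v t where v: "\<forall>i\<in>S. 0 < v i" "0 \<le> t" "\<forall>i\<in>S. mat_app S A v i = t * v i"
    using perron_frobenius[OF assms] by blast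
  have "mat_graph S (\<lambda>i k. A k i) = (mat_graph S A)\<inverse>" by (auto simp: mat_graph_def)
  then have "\<forall>i\<in>S. \<forall>k\<in>S. (i, k) \<in> (mat_graph S (\<lambda>i k. A k i))\<^sup>*"
    using irr by (simp add: rtrancl_converse)
  then obtain u t' where u: "\<forall>i\<in>S. 0 < u i" "\<forall>i\<in>S. mat_app S (\<lambda>i k. A k i) u i = t' * u i"
    using perron_frobenius[OF fin, of "\<lambda>i k. A k i"] A by blast
  define q where "q = (\<Sum>i\<in>S. u i * v i)"
  have q: "0 < q" unfolding q_def using u v fin by (intro sum_pos) auto
  have "t * q = (\<Sum>i\<in>S. u i * mat_app S A v i)"
    using v by (simp add: q_def sum_distrib_left algebra_simps)
  also have "\<dots> = (\<Sum>k\<in>S. mat_app S (\<lambda>i k. A k i) u k * v k)"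
    unfolding mat_app_def sum_distrib_left sum_distrib_right
    by (subst sum.swap) (simp add: mult_ac)
  also have "\<dots> = t' * q" using u by (simp add: q_def sum_distrib_left algebra_simps)
  finally have [simp]: "t' = t" using q by simp
  show thesis
  proof (rule that[of "\<lambda>i. u i / q" v t])
    show "(\<Sum>i\<in>S. u i / q * v i) = 1" using q by (simp add: sum_divide_distrib[symmetric] q_def)
    show "\<forall>k\<in>S. (\<Sum>i\<in>S. u i / q * A i k) = t * (u k / q)"
    proof
      fix k assume "k \<in> S"
      then have "(\<Sum>i\<in>S. A i k * u i) = t * u k" using u by (simp add: mat_app_def)
      then show "(\<Sum>i\<in>S. u i / q * A i k) = t * (u k / q)"
        by (simp add: sum_divide_distrib[symmetric] mult_ac)
    qed
  qed (use u v q in \<open>auto simp: mat_app_def\<close>)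
qed

text \<open>Subtract from \<open>a\<close> the largest multiple of \<open>u\<close> that leaves a nonnegative vector. The difference is an
  eigenvector with a vanishing coordinate, and zeros propagate to all predecessors in the graph.\<close>

lemma left_eigenvector_unique:
  fixes A :: "'a \<Rightarrow> 'a \<Rightarrow> real"
  assumes fin: "finite S" "S \<noteq> {}" and A: "\<forall>i\<in>S. \<forall>k\<in>S. 0 \<le> A i k"
    and irr: "\<forall>i\<in>S. \<forall>k\<in>S. (i, k) \<in> (mat_graph S A)\<^sup>*"
    and u: "\<forall>i\<in>S. 0 < u i" "\<forall>k\<in>S. (\<Sum>i\<in>S. u i * A i k) = t * u k"
    and a: "\<forall>k\<in>S. (\<Sum>i\<in>S. a i * A i k) = t * a k"
  obtains c where "\<forall>i\<in>S. a i = c * u i"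
proof -
  define c where "c = Min ((\<lambda>i. a i / u i) ` S)"
  have "c \<in> (\<lambda>i. a i / u i) ` S" unfolding c_def using fin by (intro Min_in) auto
  then obtain l where l: "l \<in> S" "c = a l / u l" by blast
  define d where "d = (\<lambda>i. a i - c * u i)"
  have d0: "0 \<le> d i" if "i \<in> S" for i
  proof -
    have "c \<le> a i / u i" unfolding c_def using fin that by auto
    then show ?thesis using u(1) that by (auto simp: d_def field_simps)
  qed
  have dA: "(\<Sum>i\<in>S. d i * A i k) = t * d k" if "k \<in> S" for k
  proof -
    have "(\<Sum>i\<in>S. d i * A i k) = (\<Sum>i\<in>S. a i * A i k) - c * (\<Sum>i\<in>S. u i * A i k)"
      by (simp add: d_def left_diff_distrib sum_subtractf sum_distrib_left mult.assoc)
    then show ?thesis using a u(2) that by (simp add: d_def right_diff_distrib)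
  qed
  have "d i = 0" if "(i, l) \<in> (mat_graph S A)\<^sup>*" for i
    using that
  proof (induction rule: converse_rtrancl_induct)
    case base
    then show ?case using l u(1) by (auto simp: d_def)
  next
    case (step i k)
    then have ik: "i \<in> S" "k \<in> S" "0 < A i k" by (auto simp: mat_graph_def)
    have "(\<Sum>i\<in>S. d i * A i k) = 0" using dA[OF ik(2)] step by simp
    then have "d i * A i k = 0"
      using ik d0 A fin by (subst (asm) sum_nonneg_eq_0_iff) auto
    then show ?case using ik by auto
  qed
  then have "\<forall>i\<in>S. d i = 0" using irr l by blast
  then have "\<forall>i\<in>S. a i = c * u i" by (simp add: d_def)
  then show thesis using that by blast
qed

section \<open>Shannon entropy of finite-valued functions\<close>

definition level :: "'a measure \<Rightarrow> ('a \<Rightarrow> 'b) \<Rightarrow> 'b \<Rightarrow> real" where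
  "level M X v = measure M (X -` {v} \<inter> space M)"

text \<open>Finite partitions are represented by functions with finitely many values: a join becomes a tuple,
  and coarsening becomes composition with a function.\<close>

definition shannon :: "'a measure \<Rightarrow> ('a \<Rightarrow> 'b) \<Rightarrow> real" where
  "shannon M X = - (\<Sum>v\<in>X ` space M. level M X v * ln (level M X v))"

text \<open>The value of this function names the cell of the \<open>n\<close>-th iterated join that contains the point.\<close>

definition word :: "('a \<Rightarrow> 'a) \<Rightarrow> ('a \<Rightarrow> 'b) \<Rightarrow> nat \<Rightarrow> 'a \<Rightarrow> 'b list" where
  "word T Y n t = map (\<lambda>k. Y ((T ^^ k) t)) [0..<n]"

definition entropy_rate :: "'a measure \<Rightarrow> ('a \<Rightarrow> 'a) \<Rightarrow> ('a \<Rightarrow> 'b) \<Rightarrow> real" where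
  "entropy_rate M T Y = lim (\<lambda>n. shannon M (word T Y n) / real n)"

lemma shannon_superset:
  assumes "finite S" "X ` space M \<subseteq> S"
  shows "shannon M X = - (\<Sum>v\<in>S. level M X v * ln (level M X v))"
proof -
  have "level M X v = 0" if "v \<in> S - X ` space M" for v
  proof -
    have "X -` {v} \<inter> space M = {}" using that by auto
    then show ?thesis by (simp add: level_def)
  qed
  then show ?thesis unfolding shannon_def
    by (intro arg_cong[where f = uminus] sum.mono_neutral_left assms) auto
qed

lemma level_cong: "(\<And>t. t \<in> space M \<Longrightarrow> X t = Y t) \<Longrightarrow> level M X = level M Y"
  unfolding level_def fun_eq_iff
  by (intro allI arg_cong[where f = "measure M"]) auto

lemma shannon_cong:
  assumes "\<And>t. t \<in> space M \<Longrightarrow> X t = Y t" shows "shannon M X = shannon M Y"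
proof -
  have "X ` space M = Y ` space M" by (intro image_cong assms refl)
  then show ?thesis by (simp add: shannon_def level_cong[OF assms])
qed

context prob_space
begin

lemma level_range: "0 \<le> level M X v" "level M X v \<le> 1"
  by (simp_all add: level_def)

lemma shannon_nonneg: "0 \<le> shannon M X"
  unfolding shannon_def sum_negf[symmetric]
proof (intro sum_nonneg)
  fix v
  show "0 \<le> - (level M X v * ln (level M X v))"
    using level_range[of X v] mult_nonneg_nonpos[of "level M X v" "ln (level M X v)"]
    by (cases "level M X v = 0") auto
qed

lemma sum_level_sub:
  assumes X: "simple_function M X" and S: "S \<subseteq> X ` space M"
  shows "(\<Sum>v\<in>S. level M X v) = measure M {t \<in> space M. X t \<in> S}"
proof -
  have fin: "finite S" using finite_subset[OF S] simple_functionD(1)[OF X] .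
  have "measure M (\<Union>v\<in>S. X -` {v} \<inter> space M) = (\<Sum>v\<in>S. measure M (X -` {v} \<inter> space M))"
    by (intro finite_measure_finite_Union fin)
       (auto simp: disjoint_family_on_def intro!: simple_functionD(2)[OF X])
  moreover have "(\<Union>v\<in>S. X -` {v} \<inter> space M) = {t \<in> space M. X t \<in> S}" by auto
  ultimately show ?thesis by (simp add: level_def)
qed

lemma sum_level: "simple_function M X \<Longrightarrow> (\<Sum>v\<in>X ` space M. level M X v) = 1"
proof -
  have "{t \<in> space M. X t \<in> X ` space M} = space M" by auto
  then show "simple_function M X \<Longrightarrow> ?thesis" using sum_level_sub[of X "X ` space M"] by (simp add: prob_space)
qed

text \<open>Expectations of a function of \<open>\<phi> (X t)\<close> may be computed from the law of \<open>X\<close> or from that of \<open>\<phi> (X t)\<close>.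
  This brings the entropies of all marginals into one sum over the joint law.\<close>

lemma sum_level_compose:
  assumes X: "simple_function M X"
  shows "(\<Sum>v\<in>X ` space M. level M X v * g (\<phi> v)) =
         (\<Sum>u\<in>(\<lambda>t. \<phi> (X t)) ` space M. level M (\<lambda>t. \<phi> (X t)) u * g u)"
proof -
  have fin: "finite (X ` space M)" using simple_functionD(1)[OF X] .
  have "(\<Sum>v\<in>X ` space M. level M X v * g (\<phi> v)) =
        (\<Sum>u\<in>\<phi> ` X ` space M. \<Sum>v\<in>{v \<in> X ` space M. \<phi> v = u}. level M X v * g (\<phi> v))"
    by (rule sum.image_gen[OF fin])
  also have "\<dots> = (\<Sum>u\<in>\<phi> ` X ` space M. level M (\<lambda>t. \<phi> (X t)) u * g u)"
  proof (intro sum.cong refl)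
    fix u
    have "(\<Sum>v\<in>{v \<in> X ` space M. \<phi> v = u}. level M X v * g (\<phi> v)) =
          (\<Sum>v\<in>{v \<in> X ` space M. \<phi> v = u}. level M X v) * g u"
      unfolding sum_distrib_right by (intro sum.cong) auto
    also have "(\<Sum>v\<in>{v \<in> X ` space M. \<phi> v = u}. level M X v) = level M (\<lambda>t. \<phi> (X t)) u"
      by (subst sum_level_sub[OF X]) (auto simp: level_def intro!: arg_cong[where f = "measure M"])
    finally show "(\<Sum>v\<in>{v \<in> X ` space M. \<phi> v = u}. level M X v * g (\<phi> v)) =
      level M (\<lambda>t. \<phi> (X t)) u * g u" .
  qed
  finally show ?thesis by (simp add: image_image)
qed

lemma level_le_compose:
  assumes X: "simple_function M X"
  shows "level M X v \<le> level M (\<lambda>t. \<phi> (X t)) (\<phi> v)"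
proof -
  have "simple_function M (\<lambda>t. \<phi> (X t))"
    using simple_function_compose[OF X, of \<phi>] by (simp add: comp_def)
  then show ?thesis unfolding level_def
    by (intro finite_measure_mono) (auto intro: simple_functionD(2))
qed

lemma shannon_compose_le:
  assumes X: "simple_function M X"
  shows "shannon M (\<lambda>t. \<phi> (X t)) \<le> shannon M X"
proof -
  have "shannon M (\<lambda>t. \<phi> (X t)) =
      - (\<Sum>v\<in>X ` space M. level M X v * ln (level M (\<lambda>t. \<phi> (X t)) (\<phi> v)))"
    unfolding shannon_def by (subst sum_level_compose[OF X, symmetric]) simp
  also have "\<dots> \<le> shannon M X" unfolding shannon_def neg_le_iff_le
  proof (intro sum_mono)
    fix v
    show "level M X v * ln (level M X v) \<le> level M X v * ln (level M (\<lambda>t. \<phi> (X t)) (\<phi> v))"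
      using level_range[of X v] level_le_compose[OF X, of v \<phi>]
      by (cases "level M X v = 0") (auto intro!: mult_left_mono)
  qed
  finally show ?thesis .
qed

lemma shannon_eq_of_determine:
  assumes "simple_function M X" "simple_function M X'"
    and "\<And>t. t \<in> space M \<Longrightarrow> X' t = \<phi> (X t)" "\<And>t. t \<in> space M \<Longrightarrow> X t = \<psi> (X' t)"
  shows "shannon M X = shannon M X'"
proof (rule antisym)
  show "shannon M X \<le> shannon M X'"
    using shannon_compose_le[OF assms(2), of \<psi>] shannon_cong[of M X "\<lambda>t. \<psi> (X' t)"] assms(4) by simp
  show "shannon M X' \<le> shannon M X"
    using shannon_compose_le[OF assms(1), of \<phi>] shannon_cong[of M X' "\<lambda>t. \<phi> (X t)"] assms(3) by simp
qed

lemma shannon_le_of_determined: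
  assumes "simple_function M X" "\<And>t. t \<in> space M \<Longrightarrow> X' t = \<phi> (X t)"
  shows "shannon M X' \<le> shannon M X"
  using shannon_compose_le[OF assms(1), of \<phi>] shannon_cong[of M X' "\<lambda>t. \<phi> (X t)"] assms(2) by simp

lemma sum_level_pair:
  assumes X: "simple_function M X" and Z: "simple_function M Z"
  shows "(\<Sum>a\<in>X ` space M. level M (\<lambda>t. (X t, Z t)) (a, z)) = level M Z z"
proof -
  have "(\<Sum>a\<in>X ` space M. level M (\<lambda>t. (X t, Z t)) (a, z)) =
        measure M (\<Union>a\<in>X ` space M. (\<lambda>t. (X t, Z t)) -` {(a, z)} \<inter> space M)"
    unfolding level_def
    by (rule finite_measure_finite_Union[symmetric])
       (auto simp: disjoint_family_on_def intro!: simple_functionD X Z simple_function_Pair)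
  also have "(\<Union>a\<in>X ` space M. (\<lambda>t. (X t, Z t)) -` {(a, z)} \<inter> space M) = Z -` {z} \<inter> space M"
    by auto
  finally show ?thesis by (simp add: level_def)
qed

text \<open>Over the joint law \<open>p\<close> the difference of the two sides is an average of
  \<open>ln (p\<^sub>X\<^sub>Z p\<^sub>Y\<^sub>Z / (p p\<^sub>Z))\<close>. By \<open>ln r \<le> r - 1\<close> it is at most
  \<open>\<Sum> p\<^sub>X\<^sub>Z p\<^sub>Y\<^sub>Z / p\<^sub>Z - 1\<close>, which summation over \<open>X\<close> and \<open>Y\<close> shows to be nonpositive.\<close>

theorem shannon_strong_subadditive:
  assumes X: "simple_function M X" and Y: "simple_function M Y" and Z: "simple_function M Z"
  shows "shannon M (\<lambda>t. (X t, Y t, Z t)) + shannon M Z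
       \<le> shannon M (\<lambda>t. (X t, Z t)) + shannon M (\<lambda>t. (Y t, Z t))"
proof -
  define W where "W = (\<lambda>t. (X t, Y t, Z t))"
  have W: "simple_function M W" unfolding W_def by (intro simple_function_Pair X Y Z)
  define p where "p = level M W"
  define pZ where "pZ = level M Z"
  define pXZ where "pXZ = level M (\<lambda>t. (X t, Z t))"
  define pYZ where "pYZ = level M (\<lambda>t. (Y t, Z t))"
  note nn = level_range(1)[of W, folded p_def] level_range(1)[of Z, folded pZ_def]
     level_range(1)[of "\<lambda>t. (X t, Z t)", folded pXZ_def] level_range(1)[of "\<lambda>t. (Y t, Z t)", folded pYZ_def]
  have hW: "shannon M W = - (\<Sum>w\<in>W ` space M. p w * ln (p w))"
    by (simp add: shannon_def p_def)
  have hZ: "shannon M Z = - (\<Sum>w\<in>W ` space M. p w * ln (pZ (snd (snd w))))"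
    unfolding shannon_def p_def pZ_def
    by (subst sum_level_compose[OF W, where g = "\<lambda>z. ln (level M Z z)"]) (simp add: W_def)
  have hXZ: "shannon M (\<lambda>t. (X t, Z t)) = - (\<Sum>w\<in>W ` space M. p w * ln (pXZ (fst w, snd (snd w))))"
    unfolding shannon_def p_def pXZ_def
    by (subst sum_level_compose[OF W, where \<phi> = "\<lambda>w. (fst w, snd (snd w))" and
          g = "\<lambda>z. ln (level M (\<lambda>t. (X t, Z t)) z)"]) (simp add: W_def)
  have hYZ: "shannon M (\<lambda>t. (Y t, Z t)) = - (\<Sum>w\<in>W ` space M. p w * ln (pYZ (snd w)))"
    unfolding shannon_def p_def pYZ_def
    by (subst sum_level_compose[OF W, where \<phi> = snd and
          g = "\<lambda>z. ln (level M (\<lambda>t. (Y t, Z t)) z)"]) (simp add: W_def)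
  have le1: "p w \<le> pXZ (fst w, snd (snd w))" and le2: "p w \<le> pYZ (snd w)" for w
    using level_le_compose[OF W, of w "\<lambda>w. (fst w, snd (snd w))"] level_le_compose[OF W, of w snd]
    by (simp_all add: p_def pXZ_def pYZ_def W_def)
  have le3: "p w \<le> pZ (snd (snd w))" for w
    using level_le_compose[OF W, of w "\<lambda>w. snd (snd w)"] by (simp add: p_def pZ_def W_def)
  have term_le: "- (p w * ln (p w)) - p w * ln (pZ (snd (snd w)))
        + p w * ln (pXZ (fst w, snd (snd w))) + p w * ln (pYZ (snd w))
      \<le> pXZ (fst w, snd (snd w)) * pYZ (snd w) / pZ (snd (snd w)) - p w" for w
  proof (cases "p w = 0")
    case True
    then show ?thesis using nn by simp
  next
    case False
    then have pos: "0 < p w" using nn(1)[of w] by simp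
    then have pos': "0 < pXZ (fst w, snd (snd w))" "0 < pYZ (snd w)" "0 < pZ (snd (snd w))"
      using le1 le2 le3 by (meson less_le_trans)+
    define r where "r = pXZ (fst w, snd (snd w)) * pYZ (snd w) / (p w * pZ (snd (snd w)))"
    have "p w * ln r \<le> p w * (r - 1)"
      using pos pos' by (intro mult_left_mono ln_le_minus_one) (auto simp: r_def)
    moreover have "ln r = ln (pXZ (fst w, snd (snd w))) + ln (pYZ (snd w)) - ln (p w) - ln (pZ (snd (snd w)))"
      using pos pos' by (simp add: r_def ln_div ln_mult)
    moreover have "p w * (r - 1) = pXZ (fst w, snd (snd w)) * pYZ (snd w) / pZ (snd (snd w)) - p w"
      using pos by (simp add: r_def field_simps)
    ultimately show ?thesis by (simp add: algebra_simps)
  qed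
  have "shannon M W + shannon M Z - shannon M (\<lambda>t. (X t, Z t)) - shannon M (\<lambda>t. (Y t, Z t))
      = (\<Sum>w\<in>W ` space M. - (p w * ln (p w)) - p w * ln (pZ (snd (snd w)))
        + p w * ln (pXZ (fst w, snd (snd w))) + p w * ln (pYZ (snd w)))"
    unfolding hW hZ hXZ hYZ by (simp add: sum.distrib sum_subtractf sum_negf)
  also have "\<dots> \<le> (\<Sum>w\<in>W ` space M. pXZ (fst w, snd (snd w)) * pYZ (snd w) / pZ (snd (snd w)) - p w)"
    by (intro sum_mono term_le)
  also have "\<dots> = (\<Sum>w\<in>W ` space M. pXZ (fst w, snd (snd w)) * pYZ (snd w) / pZ (snd (snd w))) - 1"
    by (simp add: sum_subtractf p_def sum_level[OF W])
  also have "(\<Sum>w\<in>W ` space M. pXZ (fst w, snd (snd w)) * pYZ (snd w) / pZ (snd (snd w)))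
     \<le> (\<Sum>w\<in>X ` space M \<times> Y ` space M \<times> Z ` space M. pXZ (fst w, snd (snd w)) * pYZ (snd w) / pZ (snd (snd w)))"
    by (intro sum_mono2) (auto simp: W_def simple_functionD X Y Z nn)
  also have "\<dots> = (\<Sum>a\<in>X ` space M. \<Sum>b\<in>Y ` space M. \<Sum>z\<in>Z ` space M. pXZ (a, z) * pYZ (b, z) / pZ z)"
    by (simp add: sum.cartesian_product case_prod_unfold)
  also have "\<dots> = (\<Sum>z\<in>Z ` space M. (\<Sum>a\<in>X ` space M. pXZ (a, z)) * (\<Sum>b\<in>Y ` space M. pYZ (b, z)) / pZ z)"
    by (subst sum.swap[where B = "Z ` space M"], subst sum.swap[where B = "Z ` space M"])
       (simp add: sum_product sum_divide_distrib)
  also have "\<dots> = (\<Sum>z\<in>Z ` space M. pZ z)"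
    unfolding pXZ_def pYZ_def sum_level_pair[OF X Z] sum_level_pair[OF Y Z] pZ_def by simp
  also have "\<dots> = 1" unfolding pZ_def by (rule sum_level[OF Z])
  finally show ?thesis by (simp add: W_def)
qed

end

text \<open>Decreasing increments make the averages \<open>a n / n\<close> decreasing, and each increment bounds the growth
  of all later terms.\<close>

lemma concave_sequence_slope:
  fixes a :: "nat \<Rightarrow> real"
  assumes a0: "a 0 = 0" and concave: "\<And>n. a (Suc (Suc n)) - a (Suc n) \<le> a (Suc n) - a n"
    and nonneg: "\<And>n. 0 \<le> a n"
  shows "convergent (\<lambda>n. a n / real n)" "lim (\<lambda>n. a n / real n) \<le> a (Suc n) - a n"
    "0 \<le> lim (\<lambda>n. a n / real n)"
proof -
  define d where "d = (\<lambda>n. a (Suc n) - a n)"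
  have dec: "decseq d" unfolding decseq_Suc_iff d_def using concave by simp
  have avg: "real n * d n \<le> a n" for n
  proof (induction n)
    case (Suc n)
    have "real n * d (Suc n) \<le> real n * d n"
      using decseq_SucD[OF dec, of n] by (intro mult_left_mono) auto
    then show ?case using Suc decseq_SucD[OF dec, of n] by (simp add: d_def algebra_simps)
  qed (simp add: a0)
  have "decseq (\<lambda>n. a (Suc n) / real (Suc n))"
    unfolding decseq_Suc_iff
  proof
    fix n
    have "real (Suc n) * a (Suc (Suc n)) \<le> real (Suc (Suc n)) * a (Suc n)"
      using avg[of "Suc n"] by (simp add: d_def algebra_simps)
    then show "a (Suc (Suc n)) / real (Suc (Suc n)) \<le> a (Suc n) / real (Suc n)"
      by (simp add: field_simps)
  qed
  then obtain L where L: "(\<lambda>n. a (Suc n) / real (Suc n)) \<longlonglongrightarrow> L"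
    using decseq_convergent[of "\<lambda>n. a (Suc n) / real (Suc n)" 0] nonneg
    by (metis divide_nonneg_nonneg of_nat_0_le_iff)
  have L0: "0 \<le> L" by (rule LIMSEQ_le_const[OF L]) (use nonneg in auto)
  have lim: "(\<lambda>n. a n / real n) \<longlonglongrightarrow> L"
    using L by (subst (asm) filterlim_sequentially_Suc)
  then show "convergent (\<lambda>n. a n / real n)" by (rule convergentI)
  show "0 \<le> lim (\<lambda>n. a n / real n)" using limI[OF lim] L0 by simp
  have le: "a (n + k) \<le> a n + real k * d n" for k
  proof (induction k)
    case (Suc k)
    have "d (n + k) \<le> d n" using dec by (auto simp: decseq_def)
    then show ?case using Suc by (simp add: d_def algebra_simps)
  qed simp
  have "L \<le> d n"
  proof (rule LIMSEQ_le)
    show "(\<lambda>N. a N / real N) \<longlonglongrightarrow> L" by (rule lim)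
    have "(\<lambda>N. (a n - real n * d n) / real N + d n) \<longlonglongrightarrow> 0 + d n"
      by (intro tendsto_add tendsto_const lim_const_over_n)
    then show "(\<lambda>N. (a n - real n * d n) / real N + d n) \<longlonglongrightarrow> d n" by simp
    show "\<exists>N0. \<forall>N\<ge>N0. a N / real N \<le> (a n - real n * d n) / real N + d n"
    proof (intro exI[of _ "Suc n"] allI impI)
      fix N assume N: "Suc n \<le> N"
      then have "a N \<le> a n + real (N - n) * d n" using le[of "N - n"] by simp
      then show "a N / real N \<le> (a n - real n * d n) / real N + d n"
        using N by (simp add: field_simps of_nat_diff)
    qed
  qed
  then show "lim (\<lambda>n. a n / real n) \<le> a (Suc n) - a n"
    using limI[OF lim] by (simp add: d_def)
qed

locale invariant_prob = prob_space +
  fixes T :: "'a \<Rightarrow> 'a"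
  assumes T_meas: "T \<in> M \<rightarrow>\<^sub>M M" and T_inv: "distr M M T = M"
begin

lemma T_pow_meas: "T ^^ k \<in> M \<rightarrow>\<^sub>M M"
  by (induction k) (auto intro: measurable_compose[OF _ T_meas] simp: id_def comp_def)

lemma T_pow_space: "t \<in> space M \<Longrightarrow> (T ^^ k) t \<in> space M"
  using T_pow_meas[of k] by (rule measurable_space)

lemma measure_vimage: "A \<in> sets M \<Longrightarrow> measure M (T -` A \<inter> space M) = measure M A"
  using measure_distr[OF T_meas, of A] T_inv by simp

lemma simple_shift:
  assumes "simple_function M X" shows "simple_function M (\<lambda>t. X (T t))"
  using simple_function_comp[OF T_meas assms] .

lemma simple_shift_pow:
  assumes "simple_function M X" shows "simple_function M (\<lambda>t. X ((T ^^ k) t))"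
  using simple_function_comp[OF T_pow_meas assms] .

lemma level_shift:
  assumes X: "simple_function M X"
  shows "level M (\<lambda>t. X (T t)) v = level M X v"
proof -
  have "(\<lambda>t. X (T t)) -` {v} \<inter> space M = T -` (X -` {v} \<inter> space M) \<inter> space M"
    using measurable_space[OF T_meas] by auto
  then show ?thesis unfolding level_def by (simp only: measure_vimage simple_functionD(2)[OF X])
qed

lemma shannon_shift:
  assumes X: "simple_function M X"
  shows "shannon M (\<lambda>t. X (T t)) = shannon M X"
proof -
  have "(\<lambda>t. X (T t)) ` space M \<subseteq> X ` space M" using measurable_space[OF T_meas] by auto
  then show ?thesis
    using simple_functionD(1)[OF X] by (simp add: shannon_superset[of "X ` space M"] level_shift[OF X])
qed

lemma shannon_shift_pow:
  assumes X: "simple_function M X"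
  shows "shannon M (\<lambda>t. X ((T ^^ k) t)) = shannon M X"
proof (induction k)
  case (Suc k)
  then show ?case using shannon_shift[OF simple_shift_pow[OF X, of k]] by (simp add: funpow_swap1)
qed simp

lemma word_Suc: "word T Y (Suc n) t = word T Y n t @ [Y ((T ^^ n) t)]"
  by (simp add: word_def)

lemma word_Suc_left: "word T Y (Suc n) t = Y t # word T Y n (T t)"
  unfolding word_def by (simp only: upt_conv_Cons[OF zero_less_Suc] list.map map_Suc_upt[symmetric] map_map)
     (simp add: funpow_swap1 comp_def)

lemma length_word [simp]: "length (word T Y n t) = n"
  by (simp add: word_def)

lemma nth_word: "k < n \<Longrightarrow> word T Y n t ! k = Y ((T ^^ k) t)"
  by (simp add: word_def)

lemma simple_word:
  assumes Y: "simple_function M Y" shows "simple_function M (word T Y n)"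
proof (induction n)
  case 0
  then show ?case by (simp add: word_def)
next
  case (Suc n)
  have "simple_function M ((\<lambda>(w, y). w @ [y]) \<circ> (\<lambda>t. (word T Y n t, Y ((T ^^ n) t))))"
    by (intro simple_function_compose simple_function_Pair Suc simple_shift_pow Y)
  then show ?case by (simp add: comp_def word_Suc[abs_def])
qed

lemma shannon_word_0: "shannon M (word T Y 0) = 0"
proof -
  have "word T Y 0 ` space M = {[]}" using not_empty by (auto simp: word_def)
  moreover have "word T Y 0 -` {[]} \<inter> space M = space M" by (auto simp: word_def)
  then have "level M (word T Y 0) [] = 1" by (simp add: level_def prob_space)
  ultimately show ?thesis by (simp add: shannon_def)
qed

text \<open>Strong subadditivity for the first letter, the last letter and the word between them; by
  invariance the shifted words have the entropies of the unshifted ones.\<close>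

lemma shannon_word_concave:
  assumes Y: "simple_function M Y"
  shows "shannon M (word T Y (Suc (Suc n))) - shannon M (word T Y (Suc n))
       \<le> shannon M (word T Y (Suc n)) - shannon M (word T Y n)"
proof -
  define Z where "Z = (\<lambda>t. word T Y n (T t))"
  define E where "E = (\<lambda>t. Y ((T ^^ Suc n) t))"
  have Z: "simple_function M Z" unfolding Z_def by (intro simple_shift simple_word Y)
  have E: "simple_function M E" unfolding E_def by (intro simple_shift_pow Y)
  note sw = simple_word[OF Y]
  have w1: "word T Y (Suc n) t = Y t # Z t" for t by (simp add: word_Suc_left Z_def)
  have w2: "word T Y (Suc n) (T t) = Z t @ [E t]" for t by (simp add: word_Suc Z_def E_def funpow_swap1)
  have w3: "word T Y (Suc (Suc n)) t = Y t # Z t @ [E t]" for t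
    by (simp add: word_Suc_left[of Y "Suc n"] w2)
  have 1: "shannon M (word T Y (Suc (Suc n))) = shannon M (\<lambda>t. (Y t, E t, Z t))"
    by (rule shannon_eq_of_determine[where \<phi> = "\<lambda>w. (hd w, last w, butlast (tl w))"
          and \<psi> = "\<lambda>(y, e, z). y # z @ [e]"])
       (auto intro!: simple_function_Pair sw Y E Z simp: w3)
  have 2: "shannon M (word T Y (Suc n)) = shannon M (\<lambda>t. (Y t, Z t))"
    by (rule shannon_eq_of_determine[where \<phi> = "\<lambda>w. (hd w, tl w)"
          and \<psi> = "\<lambda>(y, z). y # z"])
       (auto intro!: simple_function_Pair sw Y Z simp: w1)
  have "shannon M (\<lambda>t. word T Y (Suc n) (T t)) = shannon M (\<lambda>t. (E t, Z t))"
    by (rule shannon_eq_of_determine[OF simple_shift[OF sw] simple_function_Pair[OF E Z],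
          where \<phi> = "\<lambda>w. (last w, butlast w)" and \<psi> = "\<lambda>(e, z). z @ [e]"])
       (simp_all add: w2)
  then have 3: "shannon M (word T Y (Suc n)) = shannon M (\<lambda>t. (E t, Z t))"
    by (simp add: shannon_shift[OF sw])
  have 4: "shannon M Z = shannon M (word T Y n)" unfolding Z_def by (rule shannon_shift[OF sw])
  show ?thesis using shannon_strong_subadditive[OF Y E Z] 1 2 3 4 by simp
qed

lemma
  assumes Y: "simple_function M Y"
  shows entropy_rate_limit: "(\<lambda>n. shannon M (word T Y n) / real n) \<longlonglongrightarrow> entropy_rate M T Y"
    and entropy_rate_le_increment:
      "entropy_rate M T Y \<le> shannon M (word T Y (Suc n)) - shannon M (word T Y n)"
    and entropy_rate_nonneg: "0 \<le> entropy_rate M T Y"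
  using concave_sequence_slope[of "\<lambda>n. shannon M (word T Y n)", OF shannon_word_0 shannon_word_concave[OF Y] shannon_nonneg]
  by (auto simp: entropy_rate_def convergent_LIMSEQ_iff)

text \<open>The conditional entropy of the \<open>Y\<close>-word given the \<open>Z\<close>-word is at most \<open>n\<close> times that of one letter:
  conditioning on the past and on further \<open>Z\<close>-letters does not increase entropy.\<close>

lemma shannon_word_pair_le:
  assumes Y: "simple_function M Y" and Z: "simple_function M Z"
  shows "shannon M (word T (\<lambda>t. (Y t, Z t)) n)
     \<le> shannon M (word T Z n) + real n * (shannon M (\<lambda>t. (Y t, Z t)) - shannon M Z)"
proof (induction n)
  case 0
  then show ?case by (simp add: shannon_word_0)
next
  case (Suc n)
  define P where "P = word T (\<lambda>t. (Y t, Z t)) n"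
  define y where "y = (\<lambda>t. Y ((T ^^ n) t))"
  define z where "z = (\<lambda>t. Z ((T ^^ n) t))"
  define Q where "Q = word T Z n"
  have P: "simple_function M P" unfolding P_def by (intro simple_word simple_function_Pair Y Z)
  have Q: "simple_function M Q" unfolding Q_def by (intro simple_word Z)
  have y: "simple_function M y" and z: "simple_function M z"
    unfolding y_def z_def by (intro simple_shift_pow Y Z)+
  have QP: "Q t = map snd (P t)" for t by (simp add: P_def Q_def word_def)
  note sp = simple_function_Pair
  have e1: "shannon M (word T (\<lambda>t. (Y t, Z t)) (Suc n)) = shannon M (\<lambda>t. (P t, y t, (z t, Q t)))"
    by (rule shannon_eq_of_determine[OF simple_word[OF sp[OF Y Z]] sp[OF P sp[OF y sp[OF z Q]]],
          where \<phi> = "\<lambda>w. (butlast w, fst (last w), snd (last w), map snd (butlast w))"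
          and \<psi> = "\<lambda>(p, y, z, q). p @ [(y, z)]"])
       (simp_all add: word_Suc QP P_def y_def z_def)
  have e2: "shannon M (word T Z (Suc n)) = shannon M (\<lambda>t. (z t, Q t))"
    by (rule shannon_eq_of_determine[OF simple_word[OF Z] sp[OF z Q],
          where \<phi> = "\<lambda>w. (last w, butlast w)" and \<psi> = "\<lambda>(z, q). q @ [z]"])
       (simp_all add: word_Suc Q_def z_def)
  have s1: "shannon M (\<lambda>t. (P t, y t, (z t, Q t))) + shannon M (\<lambda>t. (z t, Q t))
      \<le> shannon M (\<lambda>t. (P t, (z t, Q t))) + shannon M (\<lambda>t. (y t, (z t, Q t)))"
    by (rule shannon_strong_subadditive[OF P y sp[OF z Q]])
  have s2: "shannon M (\<lambda>t. (P t, z t, Q t)) + shannon M Q \<le> shannon M (\<lambda>t. (P t, Q t)) + shannon M (\<lambda>t. (z t, Q t))"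
    by (rule shannon_strong_subadditive[OF P z Q])
  have s3: "shannon M (\<lambda>t. (y t, Q t, z t)) + shannon M z \<le> shannon M (\<lambda>t. (y t, z t)) + shannon M (\<lambda>t. (Q t, z t))"
    by (rule shannon_strong_subadditive[OF y Q z])
  have e3: "shannon M (\<lambda>t. (P t, Q t)) = shannon M P"
    by (rule shannon_eq_of_determine[OF sp[OF P Q] P, where \<phi> = fst and \<psi> = "\<lambda>p. (p, map snd p)"])
       (simp_all add: QP)
  have e4: "shannon M (\<lambda>t. (y t, Q t, z t)) = shannon M (\<lambda>t. (y t, z t, Q t))"
    by (rule shannon_eq_of_determine[where \<phi> = "\<lambda>(a, b, c). (a, c, b)" and \<psi> = "\<lambda>(a, b, c). (a, c, b)"])
       (auto intro!: sp y z Q)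
  have e5: "shannon M (\<lambda>t. (Q t, z t)) = shannon M (\<lambda>t. (z t, Q t))"
    by (rule shannon_eq_of_determine[where \<phi> = "\<lambda>(a, b). (b, a)" and \<psi> = "\<lambda>(a, b). (b, a)"])
       (auto intro!: sp y z Q)
  have e6: "shannon M z = shannon M Z" unfolding z_def by (rule shannon_shift_pow[OF Z])
  have e7: "shannon M (\<lambda>t. (y t, z t)) = shannon M (\<lambda>t. (Y t, Z t))"
    unfolding y_def z_def by (rule shannon_shift_pow[OF sp[OF Y Z]])
  show ?case
    using Suc s1 s2 s3 unfolding e1 e2 e3 e4 e5 e6 e7 by (fold P_def Q_def) (simp add: algebra_simps)
qed

lemma word_window:
  assumes "k < n" shows "word T X N ((T ^^ k) t) = take N (drop k (word T X (n + N) t))"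
proof -
  have pow: "(T ^^ (k + i)) t = (T ^^ i) ((T ^^ k) t)" for i
    by (simp add: add.commute[of k i] funpow_add)
  show ?thesis
    using assms by (intro nth_equalityI) (simp_all add: nth_word pow)
qed

text \<open>Words of \<open>Z\<close> are determined by words of \<open>X\<close> that are longer by the constant \<open>N\<close>, so the rate of \<open>Z\<close>
  is at most that of \<open>X\<close>; passing from \<open>Z\<close> to \<open>Y\<close> costs the conditional entropy of \<open>Y\<close> given \<open>Z\<close> per
  letter.\<close>

theorem entropy_rate_approximation:
  assumes Y: "simple_function M Y" and X: "simple_function M X" and Z: "simple_function M Z"
    and gen: "\<And>t. t \<in> space M \<Longrightarrow> Z t = g (word T X N t)"
  shows "entropy_rate M T Y \<le> entropy_rate M T X + (shannon M (\<lambda>t. (Y t, Z t)) - shannon M Z)"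
proof -
  define c where "c = shannon M (\<lambda>t. (Y t, Z t)) - shannon M Z"
  define a where "a = (\<lambda>n. shannon M (word T X n))"
  have lim: "(\<lambda>n. a n / real n) \<longlonglongrightarrow> entropy_rate M T X"
    unfolding a_def by (rule entropy_rate_limit[OF X])
  have 1: "shannon M (word T Y n) \<le> a (n + N) + real n * c" for n
  proof -
    have "shannon M (word T Y n) \<le> shannon M (word T (\<lambda>t. (Y t, Z t)) n)"
      by (rule shannon_le_of_determined[where \<phi> = "map fst"])
         (auto intro!: simple_word simple_function_Pair Y Z simp: word_def)
    also have "\<dots> \<le> shannon M (word T Z n) + real n * c"
      unfolding c_def by (rule shannon_word_pair_le[OF Y Z])
    also have "shannon M (word T Z n) \<le> a (n + N)" unfolding a_def
      by (rule shannon_le_of_determined[where \<phi> = "\<lambda>w. map (\<lambda>k. g (take N (drop k w))) [0..<n]"])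
         (auto intro!: simple_word X simp: word_def[of T Z] gen T_pow_space word_window)
    finally show ?thesis by simp
  qed
  have "(\<lambda>n. a (n + N) / real (n + N) * (real (n + N) / real n) + c) \<longlonglongrightarrow> entropy_rate M T X * 1 + c"
  proof (intro tendsto_intros)
    show "(\<lambda>n. a (n + N) / real (n + N)) \<longlonglongrightarrow> entropy_rate M T X"
      using LIMSEQ_ignore_initial_segment[OF lim] .
    have "(\<lambda>n. 1 + real N / real n) \<longlonglongrightarrow> 1"
      using tendsto_add[OF tendsto_const lim_const_over_n, of 1 "real N"] by simp
    then show "(\<lambda>n. real (n + N) / real n) \<longlonglongrightarrow> 1"
      by (rule Lim_transform_eventually)
        (auto intro!: eventually_sequentiallyI[of 1] simp: field_simps)
  qed
  moreover have "\<exists>N0. \<forall>n\<ge>N0. shannon M (word T Y n) / real n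
      \<le> a (n + N) / real (n + N) * (real (n + N) / real n) + c"
  proof (intro exI[of _ 1] allI impI)
    fix n :: nat assume "1 \<le> n"
    then have "a (n + N) / real (n + N) * (real (n + N) / real n) + c = (a (n + N) + real n * c) / real n"
      by (simp add: add_divide_distrib del: of_nat_add)
    then show "shannon M (word T Y n) / real n \<le> a (n + N) / real (n + N) * (real (n + N) / real n) + c"
      using 1[of n] by (simp add: divide_right_mono)
  qed
  ultimately show ?thesis
    using LIMSEQ_le[OF entropy_rate_limit[OF Y]] by (simp add: c_def)
qed

end

context invariant_prob
begin

text \<open>The sets in the iterated join are the level sets of the word function. Different words yield the
  same set only when it is empty, and empty sets contribute nothing to the entropy.\<close>

lemma partition_entropy_eq_shannon:
  fixes P :: "'a set set"
  assumes P: "finite P" "P \<subseteq> sets M" "partition_on (space M) P"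
  defines "cell \<equiv> (\<lambda>t. THE A. A \<in> P \<and> t \<in> A)"
  shows "simple_function M cell"
    and "partition_entropy M (iterated_join M T P n) = shannon M (word T cell n)"
proof -
  have cover: "\<exists>A\<in>P. t \<in> A" if "t \<in> space M" for t
    using P(3) that by (auto simp: partition_on_def)
  have unique: "A = B" if "A \<in> P" "B \<in> P" "t \<in> A" "t \<in> B" for A B t
    using P(3) that unfolding partition_on_def disjoint_def by blast
  have cell: "cell t = A" if "A \<in> P" "t \<in> A" for t A
  proof -
    have "(THE A. A \<in> P \<and> t \<in> A) = A"
    proof (rule the_equality)
      show "A \<in> P \<and> t \<in> A" using that by simp
    next
      fix B assume "B \<in> P \<and> t \<in> B"
      then show "B = A" using that by (intro unique[of B A t]) simp_all
    qed
    then show ?thesis by (simp add: cell_def)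
  qed
  have cell_in: "cell t \<in> P" "t \<in> cell t" if "t \<in> space M" for t
  proof -
    from cover[OF that] obtain A where "A \<in> P" "t \<in> A" by blast
    then show "cell t \<in> P" "t \<in> cell t" using cell[of A t] by simp_all
  qed
  have sub: "A \<subseteq> space M" if "A \<in> P" for A using P(3) that by (auto simp: partition_on_def)
  have "cell -` {A} \<inter> space M \<in> sets M" if "A \<in> P" for A
  proof -
    have "cell t = A \<longleftrightarrow> t \<in> A" if "t \<in> space M" for t
      using cell[OF \<open>A \<in> P\<close>, of t] cell_in(2)[OF that] by blast
    then have "cell -` {A} \<inter> space M = A" using sub[OF that] by blast
    then show ?thesis using P(2) that by auto
  qed
  moreover have im: "cell ` space M \<subseteq> P" using cell_in by auto
  ultimately show sf: "simple_function M cell"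
    using finite_subset[OF im P(1)] im by (auto simp: simple_function_def)
  define W where "W = {w. set w \<subseteq> P \<and> length w = n}"
  have finW: "finite W" unfolding W_def by (rule finite_lists_length_eq[OF P(1)])
  have imW: "word T cell n ` space M \<subseteq> W"
    using cell_in(1)[OF T_pow_space] by (auto simp: W_def word_def)
  define F where "F = (\<lambda>w. word T cell n -` {w} \<inter> space M)"
  have F: "F (map A [0..<n]) = (\<Inter>k<n. (T ^^ k) -` A k) \<inter> space M" if "A \<in> {..<n} \<rightarrow> P" for A
  proof -
    have "cell ((T ^^ k) t) = A k \<longleftrightarrow> (T ^^ k) t \<in> A k" if "t \<in> space M" "k < n" for t k
    proof -
      have "A k \<in> P" using \<open>A \<in> {..<n} \<rightarrow> P\<close> that by auto
      then show ?thesis using cell[of "A k" "(T ^^ k) t"] cell_in(2)[OF T_pow_space[OF that(1)], of k] by blast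
    qed
    then show ?thesis by (auto simp: F_def word_def)
  qed
  have "iterated_join M T P n = F ` W"
  proof (intro set_eqI iffI)
    fix C assume "C \<in> iterated_join M T P n"
    then obtain A where A: "A \<in> {..<n} \<rightarrow> P" "C = (\<Inter>k<n. (T ^^ k) -` A k) \<inter> space M"
      unfolding iterated_join_def by blast
    then have "C = F (map A [0..<n])" "map A [0..<n] \<in> W" using F[OF A(1)] by (auto simp: W_def)
    then show "C \<in> F ` W" by blast
  next
    fix C assume "C \<in> F ` W"
    then obtain w where w: "w \<in> W" "C = F w" by blast
    then have A: "(\<lambda>k. w ! k) \<in> {..<n} \<rightarrow> P" by (auto simp: W_def)
    have "map (\<lambda>k. w ! k) [0..<n] = w" using w by (intro nth_equalityI) (auto simp: W_def)
    then show "C \<in> iterated_join M T P n" using F[OF A] w(2) A unfolding iterated_join_def by auto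
  qed
  then have "partition_entropy M (iterated_join M T P n) = - (\<Sum>A\<in>F ` W. measure M A * ln (measure M A))"
    by (simp add: partition_entropy_def)
  also have "\<dots> = - (\<Sum>w\<in>W. measure M (F w) * ln (measure M (F w)))"
  proof (subst sum.reindex_nontrivial[OF finW])
    fix w w' assume "w \<noteq> w'" "F w = F w'"
    then have "F w = {}" by (auto simp: F_def)
    then show "measure M (F w) * ln (measure M (F w)) = 0" by simp
  qed simp
  also have "\<dots> = shannon M (word T cell n)"
    by (subst shannon_superset[OF finW imW]) (simp add: level_def F_def)
  finally show "partition_entropy M (iterated_join M T P n) = shannon M (word T cell n)" .
qed

lemma measure_entropy_le:
  assumes "\<And>Y :: 'a \<Rightarrow> 'a set. simple_function M Y \<Longrightarrow> entropy_rate M T Y \<le> b"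
  shows "measure_entropy M T \<le> ereal b"
  unfolding measure_entropy_def
proof (rule SUP_least)
  fix P assume "P \<in> {P. finite P \<and> P \<subseteq> sets M \<and> partition_on (space M) P}"
  then have P: "finite P" "P \<subseteq> sets M" "partition_on (space M) P" by auto
  show "ereal (lim (\<lambda>n. partition_entropy M (iterated_join M T P n) / real n)) \<le> ereal b"
    using assms[OF partition_entropy_eq_shannon(1)[OF P]]
    by (simp add: partition_entropy_eq_shannon(2)[OF P] entropy_rate_def)
qed

lemma entropy_rate_le_measure_entropy:
  assumes Y: "simple_function M Y"
  shows "ereal (entropy_rate M T Y) \<le> measure_entropy M T"
proof -
  define C where "C = (\<lambda>v. Y -` {v} \<inter> space M)"
  define P where "P = C ` Y ` space M"
  have P: "finite P" "P \<subseteq> sets M" "partition_on (space M) P"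
    unfolding P_def C_def by (auto simp: simple_functionD[OF Y] partition_on_def disjoint_def)
  define cell where "cell = (\<lambda>t. THE A. A \<in> P \<and> t \<in> A)"
  have cell: "cell t = C (Y t)" if "t \<in> space M" for t
    unfolding cell_def using that by (intro the_equality) (auto simp: P_def C_def)
  note sf = partition_entropy_eq_shannon(1)[OF P, folded cell_def]
  have inj: "inj_on C (Y ` space M)" by (auto simp: inj_on_def C_def)
  have "shannon M (word T cell n) = shannon M (word T Y n)" for n
    by (rule shannon_eq_of_determine[OF simple_word[OF sf] simple_word[OF Y],
          where \<phi> = "map (the_inv_into (Y ` space M) C)" and \<psi> = "map C"])
       (auto simp: word_def cell[OF T_pow_space] the_inv_into_f_f[OF inj] T_pow_space)
  then have "entropy_rate M T Y = lim (\<lambda>n. partition_entropy M (iterated_join M T P n) / real n)"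
    by (simp add: partition_entropy_eq_shannon(2)[OF P, folded cell_def] entropy_rate_def)
  then show ?thesis unfolding measure_entropy_def by (auto intro!: SUP_upper2[of P] P)
qed

lemma measure_entropy_nonneg: "0 \<le> measure_entropy M T"
proof -
  have Y: "simple_function M (\<lambda>t. ())" by simp
  have "0 \<le> ereal (entropy_rate M T (\<lambda>t. ()))" using entropy_rate_nonneg[OF Y] by simp
  then show ?thesis using entropy_rate_le_measure_entropy[OF Y] by (rule order_trans)
qed

end

text \<open>Continuity of \<open>x ln x\<close> on the half-line. At \<open>0\<close> it follows from
  \<open>\<bar>x ln x\<bar> \<le> x \<bar>x\<bar> + 2 sqrt x\<close>.\<close>

lemma tendsto_x_ln_x:
  assumes "(p \<longlongrightarrow> q) F" "\<And>k. (0::real) \<le> p k"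
  shows "((\<lambda>k. p k * ln (p k)) \<longlongrightarrow> q * ln q) F"
proof (cases "q = 0")
  case False
  then show ?thesis by (intro tendsto_intros assms) 
next
  case True
  have bound: "\<bar>x * ln x\<bar> \<le> x * \<bar>x\<bar> + 2 * sqrt x" if "0 \<le> x" for x :: real
  proof (cases "x = 0")
    case False
    then have x: "0 < x" using that by simp
    have "ln (inverse (sqrt x)) \<le> inverse (sqrt x)"
      using x by (intro ln_bound) auto
    then have "- ln x \<le> 2 * inverse (sqrt x)" using x by (simp add: ln_inverse ln_sqrt)
    then have "x * - ln x \<le> x * (2 * inverse (sqrt x))" using x by (intro mult_left_mono) auto
    also have "\<dots> = 2 * sqrt x" using x by (simp add: field_simps)
    finally have 1: "- (x * ln x) \<le> 2 * sqrt x" by simp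
    have "x * ln x \<le> x * x" using x ln_bound[of x] by (intro mult_left_mono) auto
    then have 2: "x * ln x \<le> x * \<bar>x\<bar>" using x by simp
    show ?thesis using 1 2 x by (simp add: abs_le_iff add_increasing add_increasing2)
  qed simp
  have "((\<lambda>k. p k * \<bar>p k\<bar> + 2 * sqrt (p k)) \<longlongrightarrow> 0 * \<bar>0\<bar> + 2 * sqrt 0) F"
    using assms(1) True by (intro tendsto_intros) auto
  then have lim: "((\<lambda>k. p k * \<bar>p k\<bar> + 2 * sqrt (p k)) \<longlongrightarrow> 0) F" by simp
  have "((\<lambda>k. p k * ln (p k)) \<longlongrightarrow> 0) F"
    by (rule Lim_null_comparison[OF _ lim]) (use bound assms(2) in \<open>auto intro!: always_eventually\<close>)
  then show ?thesis using True by simp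
qed

context prob_space
begin

text \<open>Entropy is a continuous function of a law on a fixed finite set, and the laws of \<open>(Y, Z\<^sub>k)\<close> and
  of \<open>Z\<^sub>k\<close> tend to those of \<open>(Y, Y)\<close> and \<open>Y\<close>, which have the same entropy.\<close>

lemma conditional_shannon_vanishes:
  assumes Y: "simple_function M Y" and Z: "\<And>k::nat. simple_function M (Z k)"
    and range: "\<And>k. Z k ` space M \<subseteq> Y ` space M"
    and conv: "(\<lambda>k. measure M {t \<in> space M. Y t \<noteq> Z k t}) \<longlonglongrightarrow> 0"
  shows "(\<lambda>k. shannon M (\<lambda>t. (Y t, Z k t)) - shannon M (Z k)) \<longlonglongrightarrow> 0"
proof -
  define S where "S = Y ` space M"
  have S: "finite S" using simple_functionD(1)[OF Y] by (simp add: S_def)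
  note sp = simple_function_Pair[OF Y Z]
  have Dset: "{t \<in> space M. Y t \<noteq> Z k t} \<in> sets M" for k
  proof -
    have "(\<lambda>t. (Y t, Z k t)) -` {z. fst z \<noteq> snd z} \<inter> space M \<in> sets M"
      by (rule simple_functionD(2)[OF sp])
    also have "(\<lambda>t. (Y t, Z k t)) -` {z. fst z \<noteq> snd z} \<inter> space M = {t \<in> space M. Y t \<noteq> Z k t}" by auto
    finally show ?thesis .
  qed
  have dist_le: "\<bar>measure M A - measure M B\<bar> \<le> measure M {t \<in> space M. Y t \<noteq> Z k t}"
    if "A \<in> sets M" "B \<in> sets M" "A \<subseteq> B \<union> {t \<in> space M. Y t \<noteq> Z k t}" "B \<subseteq> A \<union> {t \<in> space M. Y t \<noteq> Z k t}"
    for A B k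
  proof -
    have "measure M A \<le> measure M B + measure M {t \<in> space M. Y t \<noteq> Z k t}"
      using that Dset[of k] by (intro order_trans[OF finite_measure_mono[of A] measure_Un_le]) auto
    moreover have "measure M B \<le> measure M A + measure M {t \<in> space M. Y t \<noteq> Z k t}"
      using that Dset[of k] by (intro order_trans[OF finite_measure_mono[of B] measure_Un_le]) auto
    ultimately show ?thesis by linarith
  qed
  have lvl: "(\<lambda>k. level M (X k) v) \<longlonglongrightarrow> level M X' v"
    if "\<And>k. simple_function M (X k)" "simple_function M X'"
      "\<And>k t. Y t = Z k t \<Longrightarrow> X k t = X' t" for X :: "nat \<Rightarrow> 'a \<Rightarrow> 'c" and X' v
  proof (rule LIM_zero_cancel, rule Lim_null_comparison[OF always_eventually conv], rule allI)
    fix k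
    show "norm (level M (X k) v - level M X' v) \<le> measure M {t \<in> space M. Y t \<noteq> Z k t}"
      unfolding level_def real_norm_def
      by (rule dist_le) (use that(3)[of _ k] in \<open>auto intro!: simple_functionD that(1,2)\<close>)
  qed
  have sh: "(\<lambda>k. shannon M (X k)) \<longlonglongrightarrow> shannon M X'"
    if "\<And>k. simple_function M (X k)" "simple_function M X'" "finite R" "\<And>k. X k ` space M \<subseteq> R" "X' ` space M \<subseteq> R"
      "\<And>k t. Y t = Z k t \<Longrightarrow> X k t = X' t" for X :: "nat \<Rightarrow> 'a \<Rightarrow> 'c" and X' R
    using that by (simp add: shannon_superset[of R])
      (intro tendsto_intros tendsto_x_ln_x lvl level_range(1); simp)
  have "(\<lambda>k. shannon M (\<lambda>t. (Y t, Z k t))) \<longlonglongrightarrow> shannon M (\<lambda>t. (Y t, Y t))"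
    by (rule sh[of _ _ "S \<times> S"]) (use range S in \<open>auto intro!: sp simple_function_Pair Y simp: S_def\<close>)
  moreover have "(\<lambda>k. shannon M (Z k)) \<longlonglongrightarrow> shannon M Y"
    by (rule sh[of _ _ S]) (use range S in \<open>auto intro!: Z Y simp: S_def\<close>)
  moreover have "shannon M (\<lambda>t. (Y t, Y t)) = shannon M Y"
    by (rule shannon_eq_of_determine[OF simple_function_Pair[OF Y Y] Y, where \<phi> = fst and \<psi> = "\<lambda>y. (y, y)"]) auto
  ultimately show ?thesis using tendsto_diff by fastforce
qed

end

text \<open>Inner regularity of finite Borel measures, transferred to a Borel subspace.\<close>

lemma compact_cores:
  fixes M :: "'a :: {second_countable_topology, complete_space} measure"
  assumes "prob_space M" and M: "space M = S" "sets M = sets (restrict_space borel S)" "S \<in> sets borel"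
    and B: "B \<in> sets M" and e: "0 < e"
  shows "\<exists>K\<subseteq>B. compact K \<and> measure M (B - K) < e"
proof -
  interpret prob_space M by fact
  have id: "(\<lambda>t. t) \<in> M \<rightarrow>\<^sub>M borel"
    using measurable_cong_sets[OF M(2) refl, of borel] measurable_restrict_space1[of "\<lambda>t. t" borel borel S]
    by (metis measurable_ident_sets)
  define D where "D = distr M borel (\<lambda>t. t)"
  interpret D: prob_space D unfolding D_def by (rule prob_space_distr[OF id])
  have emD: "measure D A = measure M (A \<inter> space M)" if "A \<in> sets borel" for A
    unfolding D_def using that by (subst measure_distr[OF id]) auto
  have Bb: "B \<in> sets borel" "B \<subseteq> S"
    using B M by (auto simp: sets_restrict_space_iff)
  have "emeasure D B = (SUP K \<in> {K. K \<subseteq> B \<and> compact K}. emeasure D K)"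
    by (rule inner_regular) (simp_all add: D_def Bb D.emeasure_eq_measure[unfolded D_def])
  then have "\<exists>K. K \<subseteq> B \<and> compact K \<and> measure D B - e < measure D K"
  proof -
    assume SUP: "emeasure D B = (SUP K \<in> {K. K \<subseteq> B \<and> compact K}. emeasure D K)"
    show ?thesis
    proof (cases "measure D B - e < 0")
      case True
      then show ?thesis by (intro exI[of _ "{}"]) (auto simp: measure_nonneg)
    next
      case False
      have "ennreal (measure D B - e) < emeasure D B"
        unfolding D.emeasure_eq_measure using e False by (intro ennreal_lessI) auto
      then obtain K where K: "K \<subseteq> B" "compact K" "ennreal (measure D B - e) < emeasure D K"
        unfolding SUP less_SUP_iff by auto
      then have "measure D B - e < measure D K"
        using False by (simp add: D.emeasure_eq_measure ennreal_less_iff)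
      then show ?thesis using K by blast
    qed
  qed
  then obtain K where K: "K \<subseteq> B" "compact K" "measure D B - e < measure D K" by blast
  have Kb: "K \<in> sets borel" using K(2) by (simp add: compact_imp_closed borel_closed)
  have "K \<inter> S = K" "B \<inter> S = B" using K(1) Bb by auto
  then have "measure M B - e < measure M K" using K(3) emD Bb(1) Kb M(1) by simp
  moreover have "K \<in> sets M" using Kb K(1) Bb(2) M by (auto simp: sets_restrict_space_iff)
  ultimately have "measure M (B - K) < e" using K(1) B by (simp add: finite_measure_Diff)
  then show ?thesis using K by blast
qed

lemma separated_compact_family:
  fixes K :: "'b \<Rightarrow> 'c :: heine_borel set"
  assumes "finite V" "\<And>v. v \<in> V \<Longrightarrow> compact (K v)" "\<And>v v'. v \<in> V \<Longrightarrow> v' \<in> V \<Longrightarrow> v \<noteq> v' \<Longrightarrow> K v \<inter> K v' = {}"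
  shows "\<exists>d>0. \<forall>v\<in>V. \<forall>v'\<in>V. \<forall>s\<in>K v. \<forall>t\<in>K v'. dist s t < d \<longrightarrow> v = v'"
proof -
  have "\<forall>z\<in>V \<times> V. \<exists>d>0. fst z \<noteq> snd z \<longrightarrow> (\<forall>s\<in>K (fst z). \<forall>t\<in>K (snd z). d \<le> dist s t)"
  proof (clarify, simp only: fst_conv snd_conv)
    fix v v' assume v: "v \<in> V" "v' \<in> V"
    show "\<exists>d>0. v \<noteq> v' \<longrightarrow> (\<forall>s\<in>K v. \<forall>t\<in>K v'. d \<le> dist s t)"
    proof (cases "v = v'")
      case True
      then show ?thesis by (auto intro: exI[of _ 1])
    next
      case False
      then show ?thesis
        using separate_compact_closed[of "K v" "K v'"] assms v by (auto intro: compact_imp_closed)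
    qed
  qed
  then obtain d where d: "\<forall>z\<in>V \<times> V. 0 < d z \<and> (fst z \<noteq> snd z \<longrightarrow> (\<forall>s\<in>K (fst z). \<forall>t\<in>K (snd z). d z \<le> dist s t))"
    by metis
  show ?thesis
  proof (cases "V = {}")
    case True
    then show ?thesis by (auto intro: exI[of _ 1])
  next
    case False
    define e where "e = Min (d ` (V \<times> V))"
    have "0 < e" unfolding e_def using False assms(1) d by (subst Min_gr_iff) auto
    moreover have "v = v'" if "v \<in> V" "v' \<in> V" "s \<in> K v" "t \<in> K v'" "dist s t < e" for v v' s t
    proof (rule ccontr)
      assume "v \<noteq> v'"
      then have "d (v, v') \<le> dist s t" using d that by auto
      moreover have "e \<le> d (v, v')" unfolding e_def using assms(1) that by (intro Min_le) auto
      ultimately show False using that by simp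
    qed
    ultimately show ?thesis by blast
  qed
qed

text \<open>The Kolmogorov--Sinai theorem for a partition whose iterated joins shrink in diameter. The level
  sets of \<open>Y\<close> contain compact cores of almost full measure, and these have positive distance from
  each other. A word of \<open>X\<close> with sufficiently small cell meets at most one core, so \<open>Y\<close> agrees up to a
  small set with a function of that word.\<close>

theorem entropy_rate_le_generator:
  fixes M :: "'a :: {heine_borel, second_countable_topology, complete_space} measure"
  assumes "invariant_prob M T" and M: "space M = S" "sets M = sets (restrict_space borel S)" "S \<in> sets borel"
    and X: "simple_function M X" and Y: "simple_function M Y"
    and gen: "\<And>d. 0 < d \<Longrightarrow> \<exists>N. \<forall>s\<in>S. \<forall>t\<in>S. word T X N s = word T X N t \<longrightarrow> dist s t < d"
  shows "entropy_rate M T Y \<le> entropy_rate M T X"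
proof -
  interpret invariant_prob M T by fact
  define V where "V = Y ` space M"
  have finV: "finite V" using simple_functionD(1)[OF Y] by (simp add: V_def)
  have "V \<noteq> {}" using not_empty by (simp add: V_def)
  then obtain v0 where v0: "v0 \<in> V" by blast
  have cV: "0 < card V" using finV \<open>V \<noteq> {}\<close> by (simp add: card_gt_0_iff)
  have "\<exists>Z N g. simple_function M Z \<and> Z ` space M \<subseteq> V \<and> measure M {t \<in> space M. Y t \<noteq> Z t} \<le> e
      \<and> (\<forall>t\<in>space M. Z t = g (word T X N t))" if e: "0 < e" for e
  proof -
    have "\<exists>K\<subseteq>Y -` {v} \<inter> space M. compact K \<and> measure M ((Y -` {v} \<inter> space M) - K) < e / card V" for v
      by (rule compact_cores[OF prob_space_axioms M]) (use e cV simple_functionD(2)[OF Y] in auto)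
    then obtain K where K: "K v \<subseteq> Y -` {v} \<inter> space M" "compact (K v)"
        "measure M ((Y -` {v} \<inter> space M) - K v) < e / card V" for v
      by metis
    obtain d where d: "0 < d" "\<forall>v\<in>V. \<forall>v'\<in>V. \<forall>s\<in>K v. \<forall>t\<in>K v'. dist s t < d \<longrightarrow> v = v'"
    proof -
      have "K v \<inter> K v' = {}" if "v \<noteq> v'" for v v' using K(1)[of v] K(1)[of v'] that by auto
      then show thesis using separated_compact_family[OF finV, of K] K(2) that by (metis (no_types, lifting))
    qed
    obtain N where N: "\<forall>s\<in>S. \<forall>t\<in>S. word T X N s = word T X N t \<longrightarrow> dist s t < d"
      using gen[OF d(1)] by blast
    define ok where "ok = (\<lambda>w v. v \<in> V \<and> (\<exists>s\<in>K v. word T X N s = w))"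
    define g where "g = (\<lambda>w. if \<exists>v. ok w v then SOME v. ok w v else v0)"
    define Z where "Z = (\<lambda>t. g (word T X N t))"
    have Z: "simple_function M Z"
      using simple_function_compose[OF simple_word[OF X], of g N] by (simp add: Z_def comp_def)
    have "g w \<in> V" for w
      unfolding g_def using v0 someI_ex[of "ok w"] by (auto simp: ok_def)
    then have ZV: "Z ` space M \<subseteq> V" by (auto simp: Z_def)
    have good: "Z t = v" if "v \<in> V" "t \<in> K v" for v t
    proof -
      have "ok (word T X N t) v" using that by (auto simp: ok_def)
      moreover have "v' = v" if "ok (word T X N t) v'" for v'
      proof -
        obtain s where s: "s \<in> K v'" "word T X N s = word T X N t" "v' \<in> V"
          using \<open>ok (word T X N t) v'\<close> by (auto simp: ok_def)
        then have "s \<in> S" "t \<in> S" using K(1) \<open>t \<in> K v\<close> M(1) by blast+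
        then have "dist s t < d" using N s by blast
        then show ?thesis using d(2) s \<open>v \<in> V\<close> \<open>t \<in> K v\<close> by blast
      qed
      ultimately have "(SOME v. ok (word T X N t) v) = v" by (metis someI)
      then show ?thesis using \<open>ok (word T X N t) v\<close> by (auto simp: Z_def g_def)
    qed
    have Ks: "K v \<in> sets M" for v
    proof -
      have "K v \<in> sets borel" using K(2) by (simp add: compact_imp_closed borel_closed)
      then show ?thesis using K(1)[of v] M by (auto simp: sets_restrict_space_iff)
    qed
    have "{t \<in> space M. Y t \<noteq> Z t} \<subseteq> (\<Union>v\<in>V. (Y -` {v} \<inter> space M) - K v)"
    proof
      fix t assume t: "t \<in> {t \<in> space M. Y t \<noteq> Z t}"
      then have "Y t \<in> V" by (simp add: V_def)
      then have "t \<in> (Y -` {Y t} \<inter> space M) - K (Y t)" using good[of "Y t" t] t by auto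
      then show "t \<in> (\<Union>v\<in>V. (Y -` {v} \<inter> space M) - K v)" using \<open>Y t \<in> V\<close> by blast
    qed
    then have "measure M {t \<in> space M. Y t \<noteq> Z t} \<le> measure M (\<Union>v\<in>V. (Y -` {v} \<inter> space M) - K v)"
      using simple_functionD(2)[OF Y] Ks finV by (intro finite_measure_mono) auto
    also have "\<dots> \<le> (\<Sum>v\<in>V. measure M ((Y -` {v} \<inter> space M) - K v))"
      using simple_functionD(2)[OF Y] Ks finV by (intro finite_measure_subadditive_finite) auto
    also have "\<dots> \<le> (\<Sum>v\<in>V. e / card V)"
      using K(3) by (intro sum_mono less_imp_le)
    also have "\<dots> = e" using cV by simp
    finally show ?thesis using Z ZV Z_def by blast
  qed
  moreover define approx where "approx e Z N g \<longleftrightarrow> simple_function M Z \<and> Z ` space M \<subseteq> V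
      \<and> measure M {t \<in> space M. Y t \<noteq> Z t} \<le> e \<and> (\<forall>t\<in>space M. Z t = g (word T X N t))" for e Z N g
  ultimately have "\<exists>Z N g. approx e Z N g" if "0 < e" for e
    using that by simp
  then have "\<exists>Z N g. approx (1 / real (Suc k)) Z N g" for k
    by simp
  then obtain Z N g where Z': "approx (1 / real (Suc k)) (Z k) (N k) (g k)" for k
    by metis
  have Z: "simple_function M (Z k)" "Z k ` space M \<subseteq> V"
      "measure M {t \<in> space M. Y t \<noteq> Z k t} \<le> 1 / real (Suc k)" "\<forall>t\<in>space M. Z k t = g k (word T X (N k) t)" for k
    using Z'[of k] unfolding approx_def by auto
  have "(\<lambda>k. measure M {t \<in> space M. Y t \<noteq> Z k t}) \<longlonglongrightarrow> 0"
  proof (rule tendsto_sandwich[OF _ _ tendsto_const LIMSEQ_inverse_real_of_nat])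
    show "\<forall>\<^sub>F n in sequentially. measure M {t \<in> space M. Y t \<noteq> Z n t} \<le> inverse (real (Suc n))"
      using Z(3) by (simp add: inverse_eq_divide)
  qed simp
  then have "(\<lambda>k. shannon M (\<lambda>t. (Y t, Z k t)) - shannon M (Z k)) \<longlonglongrightarrow> 0"
    by (intro conditional_shannon_vanishes[OF Y Z(1)]) (use Z(2) in \<open>auto simp: V_def\<close>)
  then have "(\<lambda>k. entropy_rate M T X + (shannon M (\<lambda>t. (Y t, Z k t)) - shannon M (Z k))) \<longlonglongrightarrow> entropy_rate M T X + 0"
    by (intro tendsto_intros)
  moreover have "entropy_rate M T Y \<le> entropy_rate M T X + (shannon M (\<lambda>t. (Y t, Z k t)) - shannon M (Z k))" for k
    by (rule entropy_rate_approximation[OF Y X Z(1)]) (use Z(4) in auto)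
  ultimately show ?thesis using LIMSEQ_le_const by force
qed

section \<open>Branches and cylinders of a Markov map\<close>

lemma convex_open_real_interval:
  fixes C :: "real set"
  assumes "open C" "bounded C" "C \<noteq> {}" and conv: "\<And>s t u. s \<in> C \<Longrightarrow> t \<in> C \<Longrightarrow> s < u \<Longrightarrow> u < t \<Longrightarrow> u \<in> C"
  shows "\<exists>l r. l < r \<and> C = {l<..<r}"
proof -
  have bdd: "bdd_above C" "bdd_below C" using bounded_imp_bdd_above bounded_imp_bdd_below assms by auto
  have 1: "C \<subseteq> {Inf C<..<Sup C}"
  proof
    fix t assume t: "t \<in> C"
    then obtain e where e: "0 < e" "ball t e \<subseteq> C" using assms(1) openE by blast
    then have "t - e / 2 \<in> C" "t + e / 2 \<in> C" by (auto simp: dist_real_def intro!: subsetD[OF e(2)])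
    then have "Inf C \<le> t - e / 2" "t + e / 2 \<le> Sup C" using bdd by (auto intro: cInf_lower cSup_upper)
    then show "t \<in> {Inf C<..<Sup C}" using e(1) by auto
  qed
  have 2: "{Inf C<..<Sup C} \<subseteq> C"
  proof
    fix u assume "u \<in> {Inf C<..<Sup C}"
    then obtain s t where "s \<in> C" "s < u" "t \<in> C" "u < t"
      using bdd assms(3) by (auto simp: cInf_less_iff less_cSup_iff)
    then show "u \<in> C" using conv by blast
  qed
  have "C = {Inf C<..<Sup C}" using 1 2 by blast
  moreover then have "Inf C < Sup C" using assms(3) by (metis greaterThanLessThan_empty_iff2 not_le)
  ultimately show ?thesis by blast
qed

text \<open>The combinatorial and metric content of an expanding Markov map: \<open>f\<close> carries the \<open>i\<close>-th open
  interval onto the open interval from knot \<open>lo i\<close> to knot \<open>hi i\<close> and expands it, and knots go to knots.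
  The direction in which \<open>f\<close> is monotone on an interval is recovered where it matters.\<close>

locale markov_branches =
  fixes f :: "real \<Rightarrow> real" and m :: nat and x :: "nat \<Rightarrow> real" and c :: real
    and lo hi :: "nat \<Rightarrow> nat"
  assumes m_pos: "0 < m"
    and x_strict: "strict_mono_on {..m} x" and x0: "x 0 = 0" and xm: "x m = 1"
    and f_unit: "t \<in> {0..1} \<Longrightarrow> f t \<in> {0..1}"
    and f_knot: "i \<le> m \<Longrightarrow> \<exists>k\<le>m. f (x i) = x k"
    and lo_hi: "i < m \<Longrightarrow> lo i < hi i" "i < m \<Longrightarrow> hi i \<le> m"
    and f_branch: "i < m \<Longrightarrow> f ` {x i<..<x (Suc i)} = {x (lo i)<..<x (hi i)}"
    and c1: "1 < c"
    and diff: "i < m \<Longrightarrow> t \<in> {x i<..<x (Suc i)} \<Longrightarrow> f differentiable (at t)"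
    and slope: "i < m \<Longrightarrow> t \<in> {x i<..<x (Suc i)} \<Longrightarrow> c \<le> \<bar>deriv f t\<bar>"
begin

definition branch :: "nat \<Rightarrow> real set" where "branch i = {x i<..<x (Suc i)}"

definition nxt :: "nat \<Rightarrow> nat \<Rightarrow> bool" where "nxt i l \<longleftrightarrow> lo i \<le> l \<and> l < hi i"

fun cyl :: "nat list \<Rightarrow> real set" where
  "cyl [] = UNIV"
| "cyl (i # w) = {t \<in> branch i. f t \<in> cyl w}"

text \<open>Labels below \<open>m\<close> name the open branches, and \<open>m + i\<close> names the knot \<open>x i\<close>. Knots get labels of their
  own since the value of \<open>f\<close> at a knot may belong to either adjacent branch.\<close>

definition lab :: "real \<Rightarrow> nat" where
  "lab t = (if \<exists>i\<le>m. t = x i then m + (THE i. i \<le> m \<and> t = x i) else (THE i. i < m \<and> t \<in> branch i))"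

lemma x_less: "i < k \<Longrightarrow> k \<le> m \<Longrightarrow> x i < x k"
  using x_strict by (auto simp: strict_mono_on_def)

lemma x_le: "i \<le> k \<Longrightarrow> k \<le> m \<Longrightarrow> x i \<le> x k"
  using x_less[of i k] by (cases "i = k") auto

lemma x_inj: "i \<le> m \<Longrightarrow> k \<le> m \<Longrightarrow> x i = x k \<Longrightarrow> i = k"
  using x_less[of i k] x_less[of k i] by (cases i k rule: linorder_cases) auto

lemma x_unit: "i \<le> m \<Longrightarrow> x i \<in> {0..1}"
  using x_le[of 0 i] x_le[of i m] x0 xm by auto

lemma branch_unit: "i < m \<Longrightarrow> branch i \<subseteq> {0<..<1}"
  using x_unit[of i] x_unit[of "Suc i"] by (auto simp: branch_def)

lemma branch_not_knot:
  assumes "i < m" "k \<le> m" shows "x k \<notin> branch i"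
proof (cases "k \<le> i")
  case True
  then show ?thesis using x_le[of k i] assms by (auto simp: branch_def)
next
  case False
  then show ?thesis using x_le[of "Suc i" k] assms by (auto simp: branch_def)
qed

lemma branch_disjoint:
  assumes "i < m" "k < m" "t \<in> branch i" "t \<in> branch k" shows "i = k"
proof (rule ccontr)
  assume "i \<noteq> k"
  then consider "Suc i \<le> k" | "Suc k \<le> i" by linarith
  then show False
    using x_le[of "Suc i" k] x_le[of "Suc k" i] assms by cases (auto simp: branch_def)
qed

lemma branch_nonempty: "i < m \<Longrightarrow> \<exists>t. t \<in> branch i"
  using x_less[of i "Suc i"] dense[of "x i" "x (Suc i)"] by (auto simp: branch_def)

lemma unit_cases_upto: "k \<le> m \<Longrightarrow> t \<in> {0..x k} \<Longrightarrow> (\<exists>i<m. t \<in> branch i) \<or> (\<exists>i\<le>m. t = x i)"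
proof (induction k)
  case 0
  then show ?case using x0 by auto
next
  case (Suc k)
  show ?case
  proof (cases "t \<le> x k")
    case True
    then show ?thesis using Suc by auto
  next
    case False
    then have "t \<in> branch k \<or> t = x (Suc k)" using Suc by (auto simp: branch_def)
    then show ?thesis using Suc.prems by (auto intro: exI[of _ k] exI[of _ "Suc k"])
  qed
qed

lemma unit_cases:
  assumes "t \<in> {0..1}"
  obtains i where "i < m" "t \<in> branch i" | i where "i \<le> m" "t = x i"
  using unit_cases_upto[of m t] assms xm by auto

lemma lab_branch:
  assumes "i < m" "t \<in> branch i" shows "lab t = i"
proof -
  have "\<not> (\<exists>k\<le>m. t = x k)" using branch_not_knot assms by blast
  then have "lab t = (THE k. k < m \<and> t \<in> branch k)" unfolding lab_def by (rule if_not_P)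
  moreover have "(THE k. k < m \<and> t \<in> branch k) = i" using branch_disjoint assms by blast
  ultimately show ?thesis by simp
qed

lemma lab_knot:
  assumes "i \<le> m" shows "lab (x i) = m + i"
proof -
  have "(THE k. k \<le> m \<and> x i = x k) = i" using x_inj assms by blast
  then show ?thesis using assms by (auto simp: lab_def)
qed

lemma lab_eq_branch: "i < m \<Longrightarrow> t \<in> {0..1} \<Longrightarrow> lab t = i \<longleftrightarrow> t \<in> branch i"
  by (rule unit_cases[of t]) (auto simp: lab_branch lab_knot dest: branch_disjoint branch_not_knot)

lemma lab_eq_knot: "i \<le> m \<Longrightarrow> t \<in> {0..1} \<Longrightarrow> lab t = m + i \<longleftrightarrow> t = x i"
  by (rule unit_cases[of t]) (auto simp: lab_branch lab_knot dest: branch_not_knot x_inj)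

lemma lab_bound: "t \<in> {0..1} \<Longrightarrow> lab t \<in> {..m + m}"
  by (rule unit_cases[of t]) (auto simp: lab_branch lab_knot)

lemma f_has_deriv: "i < m \<Longrightarrow> t \<in> branch i \<Longrightarrow> (f has_real_derivative deriv f t) (at t)"
  using diff[of i t] by (simp add: branch_def DERIV_deriv_iff_real_differentiable)

lemma f_cont: "i < m \<Longrightarrow> continuous_on (branch i) f"
  by (intro continuous_at_imp_continuous_on ballI DERIV_isCont[OF f_has_deriv])

lemma expand_less:
  assumes i: "i < m" and st: "s \<in> branch i" "t \<in> branch i" "s < t"
  shows "c * \<bar>s - t\<bar> \<le> \<bar>f s - f t\<bar>"
proof -
  have sub: "u \<in> branch i" if "s \<le> u" "u \<le> t" for u using st that by (auto simp: branch_def)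
  obtain z where z: "s < z" "z < t" "f t - f s = (t - s) * deriv f z"
    using MVT2[OF st(3), of f "deriv f"] f_has_deriv[OF i sub] by auto
  have "c \<le> \<bar>deriv f z\<bar>" using slope[OF i] sub[of z] z by (auto simp: branch_def)
  then have "c * \<bar>s - t\<bar> \<le> \<bar>deriv f z\<bar> * \<bar>s - t\<bar>" by (rule mult_right_mono) simp
  also have "\<dots> = \<bar>f t - f s\<bar>" using z(3) st(3) by (simp add: abs_mult)
  finally show ?thesis by (simp add: abs_minus_commute)
qed

lemma expand:
  assumes "i < m" "s \<in> branch i" "t \<in> branch i"
  shows "c * \<bar>s - t\<bar> \<le> \<bar>f s - f t\<bar>"
  using expand_less[of i s t] expand_less[of i t s] assms
  by (cases s t rule: linorder_cases) (auto simp: abs_minus_commute)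

lemma inj_branch: "i < m \<Longrightarrow> inj_on f (branch i)"
proof (rule inj_onI)
  fix s t assume "i < m" "s \<in> branch i" "t \<in> branch i" "f s = f t"
  then have "c * \<bar>s - t\<bar> \<le> 0" using expand[of i s t] by simp
  then show "s = t" using c1 by (simp add: mult_le_0_iff)
qed

text \<open>Monotonicity on a branch in a form that does not mention the direction.\<close>

lemma f_between:
  assumes i: "i < m" and "s \<in> branch i" "t \<in> branch i" "s < u" "u < t"
  shows "f s < f u \<and> f u < f t \<or> f t < f u \<and> f u < f s"
proof -
  have sub: "{s..t} \<subseteq> branch i" using assms by (auto simp: branch_def)
  show ?thesis
    using continuous_inj_imp_mono[of s u t f] assms continuous_on_subset[OF f_cont[OF i] sub]
      inj_on_subset[OF inj_branch[OF i] sub] by auto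
qed

text \<open>Points with equal labels lie in one branch, where the mean value theorem applies, or are the same
  knot.\<close>

lemma lab_expand:
  assumes "s \<in> {0..1}" "t \<in> {0..1}" "lab s = lab t"
  shows "c * \<bar>s - t\<bar> \<le> \<bar>f s - f t\<bar>"
proof (rule unit_cases[OF assms(1)])
  fix i assume i: "i < m" "s \<in> branch i"
  then have "t \<in> branch i" using assms lab_eq_branch[of i t] lab_branch[of i s] by simp
  then show ?thesis using expand i by blast
next
  fix i assume i: "i \<le> m" "s = x i"
  then have "t = x i" using assms lab_eq_knot[of i t] lab_knot[of i] by simp
  then show ?thesis using i by simp
qed

lemma f_pow_unit: "t \<in> {0..1} \<Longrightarrow> (f ^^ k) t \<in> {0..1}"
proof (induction k)
  case (Suc k)
  then show ?case using f_unit[of "(f ^^ k) t"] by simp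
qed simp

lemma word_lab_expand:
  assumes "s \<in> {0..1}" "t \<in> {0..1}" "word f lab N s = word f lab N t"
  shows "c ^ N * \<bar>s - t\<bar> \<le> 1"
proof -
  have eq: "lab ((f ^^ k) s) = lab ((f ^^ k) t)" if "k < N" for k
    using assms(3) that by (auto simp: word_def)
  have "c ^ k * \<bar>s - t\<bar> \<le> \<bar>(f ^^ k) s - (f ^^ k) t\<bar>" if "k \<le> N" for k
    using that
  proof (induction k)
    case (Suc k)
    have "c ^ Suc k * \<bar>s - t\<bar> \<le> c * \<bar>(f ^^ k) s - (f ^^ k) t\<bar>"
      using Suc c1 by (simp add: mult.assoc)
    also have "\<dots> \<le> \<bar>f ((f ^^ k) s) - f ((f ^^ k) t)\<bar>"
      using Suc by (intro lab_expand f_pow_unit assms eq) auto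
    finally show ?case by simp
  qed simp
  then have "c ^ N * \<bar>s - t\<bar> \<le> \<bar>(f ^^ N) s - (f ^^ N) t\<bar>" by blast
  also have "\<dots> \<le> 1" using f_pow_unit[OF assms(1), of N] f_pow_unit[OF assms(2), of N] by auto
  finally show ?thesis .
qed

text \<open>Orbits with the same labels separate at least by the factor \<open>c\<close> in each step but stay in the unit
  interval.\<close>

lemma lab_generates:
  assumes "0 < d"
  shows "\<exists>N. \<forall>s\<in>{0..1}. \<forall>t\<in>{0..1}. word f lab N s = word f lab N t \<longrightarrow> dist s t < d"
proof -
  obtain N where N: "1 / d < c ^ N" using real_arch_pow[OF c1] by blast
  have "dist s t < d" if st: "s \<in> {0..1}" "t \<in> {0..1}" "word f lab N s = word f lab N t" for s t
  proof -
    have "c ^ N * \<bar>s - t\<bar> \<le> 1" by (rule word_lab_expand[OF st])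
    also have "1 < c ^ N * d" using N assms by (simp add: field_simps)
    finally show ?thesis using c1 by (simp add: dist_real_def)
  qed
  then show ?thesis by blast
qed

lemma nxt_less: "i < m \<Longrightarrow> nxt i l \<Longrightarrow> l < m"
  using lo_hi(2)[of i] by (auto simp: nxt_def)

lemma nxt_subset:
  assumes "i < m" "nxt i l" shows "branch l \<subseteq> f ` branch i"
  unfolding branch_def f_branch[OF assms(1)]
  using x_le[of "lo i" l] x_le[of "Suc l" "hi i"] assms lo_hi[of i] by (auto simp: nxt_def)

text \<open>The image of a branch ends at knots, so it contains every branch that it meets.\<close>

lemma nxt_of_mem:
  assumes "i < m" "l < m" "t \<in> branch i" "f t \<in> branch l" shows "nxt i l"
proof -
  have "f t \<in> {x (lo i)<..<x (hi i)}" using assms f_branch[of i] by (auto simp: branch_def)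
  then have "x (lo i) < x (Suc l)" "x l < x (hi i)" using assms by (auto simp: branch_def)
  then have "lo i < Suc l" "l < hi i"
    using x_le[of "Suc l" "lo i"] x_le[of "hi i" l] assms lo_hi[of i] by fastforce+
  then show ?thesis by (simp add: nxt_def)
qed

lemma mem_cyl: "t \<in> cyl w \<longleftrightarrow> (\<forall>k<length w. (f ^^ k) t \<in> branch (w ! k))"
proof (induction w arbitrary: t)
  case (Cons i w)
  show ?case using Cons by (auto simp: All_less_Suc2 funpow_swap1)
qed simp

lemma cyl_append: "t \<in> cyl (w @ v) \<longleftrightarrow> t \<in> cyl w \<and> (f ^^ length w) t \<in> cyl v"
  by (induction w arbitrary: t) (auto simp: funpow_swap1)

lemma cyl_subset_branch: "w \<noteq> [] \<Longrightarrow> cyl w \<subseteq> branch (hd w)"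
  by (cases w) auto

lemma cyl_take: "cyl w \<subseteq> cyl (take k w)"
  using cyl_append[of _ "take k w" "drop k w"] by auto

lemma path_of_mem_cyl:
  "set w \<subseteq> {..<m} \<Longrightarrow> t \<in> cyl w \<Longrightarrow> successively nxt w"
proof (induction w arbitrary: t)
  case (Cons i w)
  then show ?case
    by (cases w) (auto intro: nxt_of_mem)
qed simp

lemma cyl_unique:
  assumes "set w \<subseteq> {..<m}" "set v \<subseteq> {..<m}" "length w = length v" "t \<in> cyl w" "t \<in> cyl v"
  shows "w = v"
  using assms(3,1,2,4,5)
  by (induction w v arbitrary: t rule: list_induct2) (auto intro: branch_disjoint)

lemma cyl_expand:
  assumes "set w \<subseteq> {..<m}" "s \<in> cyl w" "t \<in> cyl w"
  shows "c ^ length w * \<bar>s - t\<bar> \<le> \<bar>(f ^^ length w) s - (f ^^ length w) t\<bar>"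
  using assms
proof (induction w arbitrary: s t)
  case (Cons i w)
  have "c ^ length (i # w) * \<bar>s - t\<bar> = c ^ length w * (c * \<bar>s - t\<bar>)" by simp
  also have "\<dots> \<le> c ^ length w * \<bar>f s - f t\<bar>"
    using Cons.prems c1 by (intro mult_left_mono expand[of i]) auto
  also have "\<dots> \<le> \<bar>(f ^^ length w) (f s) - (f ^^ length w) (f t)\<bar>"
    using Cons.prems by (intro Cons.IH) auto
  finally show ?case by (simp add: funpow_swap1)
qed simp

lemma cyl_unit: "w \<noteq> [] \<Longrightarrow> set w \<subseteq> {..<m} \<Longrightarrow> cyl w \<subseteq> {0<..<1}"
  using cyl_subset_branch[of w] branch_unit[of "hd w"] by (cases w) auto

lemma cyl_diameter:
  assumes "set w \<subseteq> {..<m}" "w \<noteq> []" "s \<in> cyl w" "t \<in> cyl w"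
  shows "c ^ length w * \<bar>s - t\<bar> \<le> 1"
proof -
  have "s \<in> {0..1}" "t \<in> {0..1}" using cyl_unit[OF assms(2,1)] assms(3,4) by force+
  then have "(f ^^ length w) s \<in> {0..1}" "(f ^^ length w) t \<in> {0..1}" by (simp_all only: f_pow_unit)
  then show ?thesis using cyl_expand[OF assms(1,3,4)] by auto
qed

text \<open>Pulling back an interval through a branch yields an open set that is closed under betweenness,
  because the branch is monotone.\<close>

lemma cyl_interval:
  assumes "w \<noteq> []" "set w \<subseteq> {..<m}" "successively nxt w"
  shows "\<exists>l r. l < r \<and> cyl w = {l<..<r}"
  using assms
proof (induction w rule: list_nonempty_induct)
  case (single i)
  then have "x i < x (Suc i)" "cyl [i] = {x i<..<x (Suc i)}" using x_less[of i "Suc i"] by (auto simp: branch_def)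
  then show ?case by blast
next
  case (cons i w)
  then have i: "i < m" and w: "set w \<subseteq> {..<m}" "nxt i (hd w)" "successively nxt w"
    by (auto simp: successively_Cons)
  obtain l r where lr: "l < r" "cyl w = {l<..<r}" using cons w by auto
  have sub: "cyl w \<subseteq> f ` branch i" using cyl_subset_branch[OF cons(1)] nxt_subset[OF i w(2)] by blast
  show ?case
  proof (rule convex_open_real_interval)
    have "open (branch i \<inter> f -` cyl w)"
      by (rule continuous_open_preimage[OF f_cont[OF i]]) (auto simp: branch_def lr)
    moreover have "branch i \<inter> f -` cyl w = cyl (i # w)" by auto
    ultimately show "open (cyl (i # w))" by simp
    show "bounded (cyl (i # w))"
      by (rule bounded_subset[of "{x i<..<x (Suc i)}"]) (auto simp: branch_def)
    show "cyl (i # w) \<noteq> {}" using sub lr dense[OF lr(1)] by (auto simp: image_iff subset_eq) (metis greaterThanLessThan_iff)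
  next
    fix s t u assume st: "s \<in> cyl (i # w)" "t \<in> cyl (i # w)" "s < u" "u < t"
    then have "f u \<in> cyl w" using f_between[OF i, of s t u] by (auto simp: lr)
    then show "u \<in> cyl (i # w)" using st by (auto simp: branch_def)
  qed
qed

lemma open_cyl: "set w \<subseteq> {..<m} \<Longrightarrow> open (cyl w)"
proof (cases "w \<noteq> [] \<and> successively nxt w")
  case True
  then show "set w \<subseteq> {..<m} \<Longrightarrow> ?thesis" using cyl_interval[of w] by auto
next
  case False
  then show "set w \<subseteq> {..<m} \<Longrightarrow> ?thesis" using path_of_mem_cyl[of w] by (cases "w = []") (auto, metis empty_iff equals0I open_empty)
qed

end

section \<open>Invariant measures on a communicating class\<close>

context markov_branches
begin

definition adj :: "nat \<Rightarrow> nat \<Rightarrow> real" where "adj i l = (if nxt i l then 1 else 0)"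

lemma branch_borel: "branch i \<in> sets borel" by (simp add: branch_def)

lemma f_measurable: "f \<in> restrict_space borel {0..1} \<rightarrow>\<^sub>M restrict_space borel {0..1}"
proof (rule measurable_restrict_space2)
  show "f \<in> space (restrict_space borel {0..1}) \<rightarrow> {0..1}"
    using f_unit by (auto simp: space_restrict_space)
  define C where "C = branch ` {..<m} \<union> (\<lambda>i. {x i}) ` {..m}"
  show "f \<in> restrict_space borel {0..1} \<rightarrow>\<^sub>M borel"
  proof (rule measurable_piecewise_restrict[of C])
    show "countable C" by (simp add: C_def)
    show "\<Omega> \<inter> space (restrict_space borel {0..1}) \<in> sets (restrict_space borel {0..1})"
      if "\<Omega> \<in> C" for \<Omega>
    proof -
      have "\<Omega> \<in> sets borel" using that by (auto simp: C_def branch_borel)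
      then show ?thesis by (auto simp: sets_restrict_space space_restrict_space)
    qed
    show "space (restrict_space borel {0..1}) \<subseteq> \<Union>C"
    proof
      fix t assume "t \<in> space (restrict_space borel {0..1::real})"
      then have "t \<in> {0..1}" by (simp add: space_restrict_space)
      then show "t \<in> \<Union>C" by (rule unit_cases) (auto simp: C_def)
    qed
    fix \<Omega> assume "\<Omega> \<in> C"
    then consider i where "i < m" "\<Omega> = branch i" | i where "\<Omega> = {x i}" by (auto simp: C_def)
    then show "f \<in> restrict_space (restrict_space borel {0..1}) \<Omega> \<rightarrow>\<^sub>M borel"
    proof cases
      case 1
      then have "restrict_space (restrict_space borel {0..1}) \<Omega> = restrict_space borel (branch i)"
        using branch_unit[of i] by (subst restrict_restrict_space) (auto simp: branch_borel intro!: arg_cong[where f = "restrict_space borel"])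
      then show ?thesis using borel_measurable_continuous_on_restrict[OF f_cont[OF 1(1)]] by simp
    next
      case 2
      have "f t = f (x i)" if "t \<in> space (restrict_space (restrict_space borel {0..1}) \<Omega>)" for t
        using that 2 by (auto simp: space_restrict_space)
      then show ?thesis by (subst measurable_cong[where g = "\<lambda>_. f (x i)"]) auto
    qed
  qed
qed

lemma simple_lab:
  assumes M: "space M = {0..1}" "sets M = sets (restrict_space borel {0..1})"
  shows "simple_function M lab"
proof -
  have "lab ` space M \<subseteq> {..m + m}" using lab_bound M by blast
  moreover have "lab -` {k} \<inter> space M \<in> sets M" if k: "k \<in> lab ` space M" for k
  proof -
    obtain t where t: "t \<in> {0..1}" "k = lab t" using k M by auto
    from t(1) show ?thesis
    proof (rule unit_cases)
      fix i assume i: "i < m" "t \<in> branch i"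
      then have "lab -` {k} \<inter> space M = branch i"
      proof -
        have "s \<in> lab -` {k} \<inter> space M \<longleftrightarrow> s \<in> branch i" for s
          using branch_unit[OF i(1)] M(1) t(2) lab_branch[OF i] lab_eq_branch[OF i(1), of s] by fastforce
        then show ?thesis by blast
      qed
      then show ?thesis using branch_unit[OF i(1)] M branch_borel by (auto simp: sets_restrict_space_iff)
    next
      fix i assume i: "i \<le> m" "t = x i"
      then have "lab -` {k} \<inter> space M = {x i}"
        using M t i lab_knot[OF i(1)] lab_eq_knot[OF i(1)] by auto
      then show ?thesis using i t M by (auto simp: sets_restrict_space_iff)
    qed
  qed
  ultimately show ?thesis
    unfolding simple_function_def using finite_subset[OF _ finite_atMost] by simp
qed

lemma word_eq_cyl:
  assumes "set w \<subseteq> {..<m}" "length w = n" "t \<in> {0..1}"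
  shows "word f lab n t = w \<longleftrightarrow> t \<in> cyl w"
proof -
  have "word f lab n t = w \<longleftrightarrow> (\<forall>k<n. lab ((f ^^ k) t) = w ! k)"
    using assms(2) by (auto simp: word_def list_eq_iff_nth_eq)
  also have "\<dots> \<longleftrightarrow> (\<forall>k<n. (f ^^ k) t \<in> branch (w ! k))"
  proof -
    have "lab ((f ^^ k) t) = w ! k \<longleftrightarrow> (f ^^ k) t \<in> branch (w ! k)" if "k < n" for k
    proof (rule lab_eq_branch)
      show "w ! k < m" using assms that by (metis lessThan_iff nth_mem subset_iff)
      show "(f ^^ k) t \<in> {0..1}" by (rule f_pow_unit[OF assms(3)])
    qed
    then show ?thesis by blast
  qed
  finally show ?thesis using assms(2) by (simp add: mem_cyl)
qed

end

text \<open>The normalization \<open>\<Sum> u v = 1\<close> makes \<open>u i * v i\<close> the stationary law of the Parry chain.\<close>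

locale perron_data = markov_branches +
  fixes J :: "nat set" and u v :: "nat \<Rightarrow> real" and lam :: real
  assumes J_sub: "J \<subseteq> {..<m}" and J_nonempty: "J \<noteq> {}"
    and irreducible: "\<forall>i\<in>J. \<forall>l\<in>J. (i, l) \<in> (mat_graph J adj)\<^sup>*"
    and u_pos: "\<forall>i\<in>J. 0 < u i" and v_pos: "\<forall>i\<in>J. 0 < v i"
    and uv_sum: "(\<Sum>i\<in>J. u i * v i) = 1" and lam_pos: "0 < lam"
    and v_eigen: "\<forall>i\<in>J. (\<Sum>l\<in>J. adj i l * v l) = lam * v i"
    and u_eigen: "\<forall>l\<in>J. (\<Sum>i\<in>J. u i * adj i l) = lam * u l"
begin

text \<open>The transition probabilities of the Parry chain; their rows sum to \<open>1\<close> by the eigenvalue equation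
  for \<open>v\<close>.\<close>

definition transition :: "nat \<Rightarrow> nat \<Rightarrow> real" where "transition i l = adj i l * v l / (lam * v i)"

text \<open>The mass of a cylinder under the Parry measure. In the product of \<open>u i * v i\<close> with the transition
  probabilities along the word the intermediate values of \<open>v\<close> cancel.\<close>

definition mass :: "nat list \<Rightarrow> real" where
  "mass w = u (hd w) * v (last w) / lam ^ (length w - 1)"

definition IJ :: "real set" where "IJ = (\<Union>i\<in>J. {x i..x (Suc i)})"

lemma finite_J: "finite J" using J_sub finite_subset by blast

lemma J_less: "i \<in> J \<Longrightarrow> i < m" using J_sub by auto

lemma transition_nonneg: "i \<in> J \<Longrightarrow> l \<in> J \<Longrightarrow> 0 \<le> transition i l"
  using v_pos lam_pos by (auto simp: transition_def adj_def intro!: divide_nonneg_nonneg mult_nonneg_nonneg less_imp_le)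

lemma transition_sum: "i \<in> J \<Longrightarrow> (\<Sum>l\<in>J. transition i l) = 1"
  using v_eigen v_pos lam_pos by (simp add: transition_def sum_divide_distrib[symmetric] less_imp_neq[THEN not_sym])

lemma transition_pos: "i \<in> J \<Longrightarrow> l \<in> J \<Longrightarrow> nxt i l \<Longrightarrow> 0 < transition i l"
  using v_pos lam_pos by (auto simp: transition_def adj_def)

lemma branch_meets_IJ:
  assumes "i < m" "i \<notin> J" shows "branch i \<inter> IJ = {}"
proof (rule ccontr)
  assume "branch i \<inter> IJ \<noteq> {}"
  then obtain t k where t: "t \<in> branch i" "k \<in> J" "t \<in> {x k..x (Suc k)}" unfolding IJ_def by blast
  have "k < m" using t J_less by blast
  then have "t \<noteq> x k" "t \<noteq> x (Suc k)" using branch_not_knot[OF assms(1)] t(1) by auto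
  then have "t \<in> branch k" using t(3) by (auto simp: branch_def)
  then show False using branch_disjoint[OF assms(1) \<open>k < m\<close> t(1)] t(2) assms(2) by simp
qed

end

text \<open>An arbitrary competitor in the definition of topological entropy.\<close>

locale perron_measure = perron_data +
  fixes M :: "real measure"
  assumes M_inv: "M \<in> invariant_measures {0..1} f IJ"
begin

lemma sets_M: "sets M = sets (restrict_space borel {0..1})"
  using M_inv by (simp add: invariant_measures_def)

lemma space_M: "space M = {0..1}"
  using sets_eq_imp_space_eq[OF sets_M] by (simp add: space_restrict_space)

sublocale invariant_prob M f
  using M_inv unfolding invariant_prob_def invariant_prob_axioms_def invariant_measures_def by blast

lemma borel_sub_M: "A \<in> sets borel \<Longrightarrow> A \<subseteq> {0..1} \<Longrightarrow> A \<in> sets M"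
  by (simp add: sets_M sets_restrict_space_iff)

lemmas lab_simple = simple_lab[OF space_M sets_M]

definition word_prob :: "nat list \<Rightarrow> real" where "word_prob w = level M (word f lab (length w)) w"

definition words :: "nat \<Rightarrow> nat list set" where "words n = {w. set w \<subseteq> {..m + m} \<and> length w = n}"

lemma finite_words: "finite (words n)" unfolding words_def by (rule finite_lists_length_eq) simp

lemma word_in_words: "word f lab n ` space M \<subseteq> words n"
  using lab_bound[OF f_pow_unit] space_M by (auto simp: words_def word_def)

lemma word_prob_nonneg: "0 \<le> word_prob w" by (simp add: word_prob_def level_range)

lemma word_prob_eq_measure_cyl:
  assumes "w \<noteq> []" "set w \<subseteq> {..<m}" shows "word_prob w = measure M (cyl w)"
proof -
  have "word f lab (length w) -` {w} \<inter> space M = cyl w"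
    using word_eq_cyl[OF assms(2) refl] cyl_unit[OF assms] by (force simp: space_M)
  then show ?thesis by (simp add: word_prob_def level_def)
qed

lemma word_prob_pos_witness: "word_prob w \<noteq> 0 \<Longrightarrow> \<exists>t\<in>{0..1}. word f lab (length w) t = w"
proof (rule ccontr)
  assume "word_prob w \<noteq> 0" "\<not> (\<exists>t\<in>{0..1}. word f lab (length w) t = w)"
  then have "word f lab (length w) -` {w} \<inter> space M = {}" by (auto simp: space_M)
  then show False using \<open>word_prob w \<noteq> 0\<close> by (simp add: word_prob_def level_def)
qed

lemma word_prob_le_event:
  assumes "A \<in> sets M" "\<And>t. t \<in> {0..1} \<Longrightarrow> word f lab (length w) t = w \<Longrightarrow> (f ^^ k) t \<in> A"
  shows "word_prob w \<le> measure M A"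
proof -
  have "word f lab (length w) -` {w} \<inter> space M \<subseteq> (f ^^ k) -` A \<inter> space M"
    using assms(2) by (auto simp: space_M)
  then have "word_prob w \<le> measure M ((f ^^ k) -` A \<inter> space M)"
    unfolding word_prob_def level_def using T_pow_meas[of k] assms(1)
    by (intro finite_measure_mono) auto
  also have "measure M ((f ^^ k) -` A \<inter> space M) = measure M A"
  proof (induction k)
    case 0
    then show ?case using sets.sets_into_space[OF assms(1)] by (simp add: Int_absorb2)
  next
    case (Suc k)
    have "(f ^^ Suc k) -` A \<inter> space M = f -` ((f ^^ k) -` A \<inter> space M) \<inter> space M"
      using T_meas by (auto dest: measurable_space simp: funpow_Suc_right simp del: funpow.simps)
    moreover have "(f ^^ k) -` A \<inter> space M \<in> sets M" using T_pow_meas assms(1) by auto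
    ultimately show ?case using Suc measure_vimage by (simp del: funpow.simps vimage_Int)
  qed
  finally show ?thesis .
qed

lemma word_prob_zero_outside:
  assumes "k < length w" "w ! k < m" "w ! k \<notin> J" shows "word_prob w = 0"
proof -
  have brM: "branch (w ! k) \<in> sets M" using branch_unit[OF assms(2)] branch_borel by (intro borel_sub_M) auto
  have IJM: "IJ \<in> sets M"
  proof (rule borel_sub_M)
    show "IJ \<in> sets borel" unfolding IJ_def using finite_J by (intro sets.finite_UN) auto
    have "{x i..x (Suc i)} \<subseteq> {0..1}" if "i \<in> J" for i
      using x_unit[of i] x_unit[of "Suc i"] J_less[OF that] by auto
    then show "IJ \<subseteq> {0..1}" unfolding IJ_def by (rule UN_least)
  qed
  have "measure M IJ = 1" using M_inv by (simp add: invariant_measures_def measure_def)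
  have "measure M (branch (w ! k)) + measure M IJ = measure M (branch (w ! k) \<union> IJ)"
    by (rule finite_measure_Union[symmetric, OF brM IJM branch_meets_IJ[OF assms(2,3)]])
  also have "\<dots> \<le> 1" by (rule prob_le_1)
  finally have "measure M (branch (w ! k)) = 0" using \<open>measure M IJ = 1\<close> measure_nonneg[of M "branch (w ! k)"] by linarith
  moreover have "word_prob w \<le> measure M (branch (w ! k))"
  proof (rule word_prob_le_event[OF brM])
    fix t :: real assume "t \<in> {0..1}" "word f lab (length w) t = w"
    then have "lab ((f ^^ k) t) = w ! k" using nth_word[OF assms(1), of lab t] by simp
    then show "(f ^^ k) t \<in> branch (w ! k)" using lab_eq_branch[OF assms(2) f_pow_unit[OF \<open>t \<in> {0..1}\<close>]] by simp
  qed
  ultimately show ?thesis using word_prob_nonneg[of w] by simp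
qed

text \<open>The set of knots is contained in its preimage, which has the same measure by invariance. So almost
  no orbit enters the knots from outside.\<close>

lemma word_prob_zero_into_knots:
  assumes "Suc k < length w" "w ! k < m" "m \<le> w ! Suc k" shows "word_prob w = 0"
proof -
  define B where "B = x ` {..m}"
  have BM: "B \<in> sets M" using x_unit by (intro borel_sub_M) (auto simp: B_def intro: finite_imp_closed borel_closed)
  have fB: "f t \<in> B" if "t \<in> B" for t using f_knot that by (fastforce simp: B_def)
  have sub: "B \<subseteq> f -` B \<inter> space M" using fB sets.sets_into_space[OF BM] by auto
  have fBM: "f -` B \<inter> space M \<in> sets M" using T_meas BM by auto
  have "measure M ((f -` B \<inter> space M) - B) = 0"
    using finite_measure_Diff[OF fBM BM sub] measure_vimage[OF BM] by simp
  moreover have "word_prob w \<le> measure M ((f -` B \<inter> space M) - B)"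
  proof (rule word_prob_le_event)
    show "(f -` B \<inter> space M) - B \<in> sets M" using fBM BM by auto
    fix t :: real assume t: "t \<in> {0..1}" "word f lab (length w) t = w"
    have 1: "lab ((f ^^ k) t) = w ! k" "lab ((f ^^ Suc k) t) = w ! Suc k"
      using nth_word[of k "length w" lab t] nth_word[OF assms(1), of lab t] t assms by auto
    have u: "(f ^^ k) t \<in> {0..1}" "(f ^^ Suc k) t \<in> {0..1}" by (rule f_pow_unit[OF t(1)])+
    have "(f ^^ k) t \<notin> B" using 1(1) assms(2) lab_knot by (auto simp: B_def)
    moreover from u(2) have "(f ^^ Suc k) t \<in> B"
      by (rule unit_cases) (use 1(2) assms(3) lab_branch in \<open>auto simp: B_def\<close>)
    ultimately show "(f ^^ k) t \<in> (f -` B \<inter> space M) - B" using u(1) by (simp add: space_M)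
  qed
  ultimately show ?thesis using word_prob_nonneg[of w] by simp
qed

text \<open>The orbit of a knot is determined, so its next label carries no information.\<close>

lemma word_prob_knot:
  assumes w: "w \<in> words (Suc (Suc n))" and word_prob: "word_prob w \<noteq> 0" and knot: "m \<le> w ! n"
  shows "word_prob w = word_prob (butlast w)"
proof -
  have len: "length w = Suc (Suc n)" using w by (simp add: words_def)
  obtain t where t: "t \<in> {0..1}" "word f lab (length w) t = w" using word_prob_pos_witness[OF word_prob] by blast
  have lt: "lab ((f ^^ n) t) = w ! n" using nth_word[of n "length w" lab t] t len by simp
  obtain i where i: "i \<le> m" "(f ^^ n) t = x i"
    using f_pow_unit[OF t(1), of n] by (rule unit_cases) (use lt knot lab_branch in auto)
  have "word f lab (length w) s = w \<longleftrightarrow> word f lab (Suc n) s = butlast w" if s: "s \<in> {0..1}" for s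
  proof
    assume "word f lab (Suc n) s = butlast w"
    then have "word f lab (Suc n) s = word f lab (Suc n) t"
      using t(2) len by (metis word_Suc butlast_snoc)
    then have "lab ((f ^^ n) s) = lab ((f ^^ n) t)"
      using nth_word[of n "Suc n" lab s] nth_word[of n "Suc n" lab t] by simp
    then have "(f ^^ n) s = x i" using lab_eq_knot[OF i(1) f_pow_unit[OF s]] lab_knot[OF i(1)] i by simp
    then have "(f ^^ Suc n) s = (f ^^ Suc n) t" using i by simp
    then show "word f lab (length w) s = w"
      using \<open>word f lab (Suc n) s = word f lab (Suc n) t\<close> t(2) len by (metis word_Suc)
  next
    assume "word f lab (length w) s = w"
    then show "word f lab (Suc n) s = butlast w" using len by (metis word_Suc butlast_snoc)
  qed
  then have "word f lab (length w) -` {w} \<inter> space M = word f lab (Suc n) -` {butlast w} \<inter> space M"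
    by (auto simp: space_M)
  then show ?thesis using len by (simp add: word_prob_def level_def)
qed

lemma sum_words_compose:
  assumes "finite Q" "\<phi> ` words n \<subseteq> Q"
  shows "(\<Sum>w\<in>words n. word_prob w * g (\<phi> w)) = (\<Sum>z\<in>Q. level M (\<lambda>t. \<phi> (word f lab n t)) z * g z)"
proof -
  note sw = simple_word[OF lab_simple, of n]
  have zero: "level M X z = 0" if "z \<notin> X ` space M" for X :: "real \<Rightarrow> 'z" and z
  proof -
    have "X -` {z} \<inter> space M = {}" using that by auto
    then show ?thesis by (simp add: level_def)
  qed
  have "(\<Sum>w\<in>words n. word_prob w * g (\<phi> w)) = (\<Sum>w\<in>words n. level M (word f lab n) w * g (\<phi> w))"
    by (intro sum.cong) (auto simp: word_prob_def words_def)
  also have "\<dots> = (\<Sum>w\<in>word f lab n ` space M. level M (word f lab n) w * g (\<phi> w))"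
    by (intro sum.mono_neutral_right finite_words word_in_words) (auto simp: zero)
  also have "\<dots> = (\<Sum>z\<in>(\<lambda>t. \<phi> (word f lab n t)) ` space M. level M (\<lambda>t. \<phi> (word f lab n t)) z * g z)"
    by (rule sum_level_compose[OF sw])
  also have "\<dots> = (\<Sum>z\<in>Q. level M (\<lambda>t. \<phi> (word f lab n t)) z * g z)"
    using word_in_words[of n] assms by (intro sum.mono_neutral_left) (auto simp: zero)
  finally show ?thesis .
qed

text \<open>By stationarity the law of a letter does not depend on its position.\<close>

lemma sum_words_letter:
  assumes "k < n"
  shows "(\<Sum>w\<in>words n. word_prob w * g (w ! k)) = (\<Sum>i\<le>m + m. level M lab i * g i)"
proof -
  have "(\<lambda>w. w ! k) ` words n \<subseteq> {..m + m}" using assms nth_mem[of k] by (fastforce simp: words_def)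
  then have "(\<Sum>w\<in>words n. word_prob w * g (w ! k)) = (\<Sum>i\<in>{..m + m}. level M (\<lambda>t. word f lab n t ! k) i * g i)"
    by (intro sum_words_compose[where \<phi> = "\<lambda>w. w ! k"]) auto
  also have "(\<lambda>t. word f lab n t ! k) = (\<lambda>t. lab ((f ^^ k) t))" using assms by (simp add: nth_word)
  also have "level M (\<lambda>t. lab ((f ^^ k) t)) = level M lab"
  proof (induction k)
    case (Suc k)
    then show ?case using level_shift[OF simple_shift_pow[OF lab_simple, of k]] by (auto simp: funpow_swap1)
  qed simp
  finally show ?thesis .
qed

lemma sum_words: "(\<Sum>w\<in>words n. word_prob w) = 1"
proof -
  note sw = simple_word[OF lab_simple, of n]
  have "(\<Sum>w\<in>words n. word_prob w) = (\<Sum>w\<in>words n. word_prob w * 1)" by simp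
  also have "\<dots> = (\<Sum>z\<in>{()}. level M (\<lambda>t. ()) z * 1)" by (rule sum_words_compose) auto
  also have "\<dots> = 1" by (simp add: level_def prob_space)
  finally show ?thesis .
qed

lemma shannon_words: "shannon M (word f lab n) = - (\<Sum>w\<in>words n. word_prob w * ln (word_prob w))"
  by (subst shannon_superset[OF finite_words word_in_words])
     (auto simp: word_prob_def words_def intro!: sum.cong)

end

section \<open>Maximality and the Markov property\<close>

lemma mult_ln_ratio_le:
  fixes p r :: real
  assumes "0 \<le> p" "0 \<le> r" "p \<noteq> 0 \<Longrightarrow> r \<noteq> 0"
  shows "p * ln (r / p) \<le> r - p" and "p * ln (r / p) = r - p \<Longrightarrow> r = p"
proof -
  have *: "p * ln (r / p) \<le> r - p \<and> (p * ln (r / p) = r - p \<longrightarrow> r = p)"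
  proof (cases "p = 0")
    case False
    then have pos: "0 < p" "0 < r / p" using assms by auto
    have "p * ln (r / p) \<le> p * (r / p - 1)"
      using pos by (intro mult_left_mono ln_le_minus_one) auto
    moreover have "r = p" if "p * ln (r / p) = p * (r / p - 1)"
    proof -
      have "ln (r / p) = r / p - 1" using that pos by simp
      then have "r / p = 1" by (rule ln_eq_minus_one[OF pos(2)])
      then show ?thesis using pos by simp
    qed
    moreover have "p * (r / p - 1) = r - p" using pos by (simp add: field_simps)
    ultimately show ?thesis by simp
  qed (use assms in auto)
  show "p * ln (r / p) \<le> r - p" "p * ln (r / p) = r - p \<Longrightarrow> r = p" using * by auto
qed

context perron_measure
begin

text \<open>The probability that \<open>w\<close>, of length \<open>n + 2\<close>, would have if its last step followed the Parry chain.
  If the last but one label is not in \<open>J\<close>, the word keeps its probability: when that is positive, the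
  label is a knot, which determines the last label.\<close>

definition markov_prob :: "nat \<Rightarrow> nat list \<Rightarrow> real" where
  "markov_prob n w = (if w ! n \<in> J then if w ! Suc n \<in> J then word_prob (butlast w) * transition (w ! n) (w ! Suc n) else 0 else word_prob w)"

text \<open>The measure of the open branches of \<open>J\<close>; the rest of the mass sits on knots.\<close>

definition weight :: real where "weight = (\<Sum>i\<in>J. level M lab i)"

lemma J_letters: "J \<subseteq> {..m + m}" using J_sub by auto

lemma sum_letters_J: "(\<Sum>i\<le>m + m. if i \<in> J then g i else 0) = (\<Sum>i\<in>J. g i)" for g :: "nat \<Rightarrow> real"
  using J_letters by (intro sum.mono_neutral_cong_right) auto

lemma word_prob_letter_le:
  assumes "k < length w" shows "word_prob w \<le> level M lab (w ! k)"
proof -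
  have "word_prob w \<le> measure M (lab -` {w ! k} \<inter> space M)"
  proof (rule word_prob_le_event[where k = k])
    show "lab -` {w ! k} \<inter> space M \<in> events" by (rule simple_functionD(2)[OF lab_simple])
    fix t :: real assume t: "t \<in> {0..1}" "word f lab (length w) t = w"
    then have "lab ((f ^^ k) t) = w ! k" using nth_word[OF assms, of lab t] by simp
    then show "(f ^^ k) t \<in> lab -` {w ! k} \<inter> space M" using f_pow_unit[OF t(1)] by (simp add: space_M)
  qed
  then show ?thesis by (simp add: level_def)
qed

lemma word_prob_butlast:
  assumes "length w = Suc n" shows "word_prob w \<le> word_prob (butlast w)"
proof -
  have "word f lab (length w) -` {w} \<inter> space M \<subseteq> word f lab n -` {butlast w} \<inter> space M"
    using assms by (auto simp: word_Suc)
  then show ?thesis using assms unfolding word_prob_def level_def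
    by (auto intro!: finite_measure_mono simple_functionD(2) simple_word lab_simple)
qed

lemma words_Suc: "words (Suc n) = (\<lambda>(w, l). w @ [l]) ` (words n \<times> {..m + m})"
proof (intro set_eqI iffI)
  fix w assume w: "w \<in> words (Suc n)"
  then have "w \<noteq> []" by (auto simp: words_def)
  then have "w = (\<lambda>(w, l). w @ [l]) (butlast w, last w)" by simp
  moreover have "(butlast w, last w) \<in> words n \<times> {..m + m}"
    using w \<open>w \<noteq> []\<close> by (auto simp: words_def dest: in_set_butlastD last_in_set)
  ultimately show "w \<in> (\<lambda>(w, l). w @ [l]) ` (words n \<times> {..m + m})" by (rule image_eqI)
qed (auto simp: words_def)

lemma sum_words_Suc: "(\<Sum>w\<in>words (Suc n). g w) = (\<Sum>w\<in>words n. \<Sum>l\<le>m + m. g (w @ [l]))" for g :: "nat list \<Rightarrow> real"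
proof -
  have "inj_on (\<lambda>(w, l). w @ [l]) (words n \<times> {..m + m})" by (auto simp: inj_on_def)
  then show ?thesis
    unfolding words_Suc by (subst sum.reindex) (auto simp: sum.cartesian_product case_prod_unfold)
qed

lemma markov_prob_nonneg: "length w = Suc (Suc n) \<Longrightarrow> 0 \<le> markov_prob n w"
  unfolding markov_prob_def using word_prob_nonneg transition_nonneg by simp

lemma markov_prob_sum: "(\<Sum>w\<in>words (Suc (Suc n)). markov_prob n w) = 1"
proof -
  define ind where "ind = (\<lambda>i. if i \<in> J then 0 else 1 :: real)"
  have "(\<Sum>w\<in>words (Suc (Suc n)). markov_prob n w) =
      (\<Sum>w\<in>words (Suc (Suc n)). (if w ! n \<in> J \<and> w ! Suc n \<in> J then word_prob (butlast w) * transition (w ! n) (w ! Suc n) else 0)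
        + word_prob w * ind (w ! n))"
    by (intro sum.cong) (auto simp: markov_prob_def ind_def)
  also have "\<dots> = (\<Sum>w\<in>words (Suc (Suc n)). if w ! n \<in> J \<and> w ! Suc n \<in> J then word_prob (butlast w) * transition (w ! n) (w ! Suc n) else 0)
      + (\<Sum>w\<in>words (Suc (Suc n)). word_prob w * ind (w ! n))"
    by (rule sum.distrib)
  also have "(\<Sum>w\<in>words (Suc (Suc n)). if w ! n \<in> J \<and> w ! Suc n \<in> J then word_prob (butlast w) * transition (w ! n) (w ! Suc n) else 0)
      = (\<Sum>w\<in>words (Suc n). \<Sum>l\<le>m + m. if w ! n \<in> J \<and> l \<in> J then word_prob w * transition (w ! n) l else 0)"
    unfolding sum_words_Suc[of _ "Suc n"]
    by (intro sum.cong refl) (auto simp: words_def nth_append)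
  also have "\<dots> = (\<Sum>w\<in>words (Suc n). word_prob w * (1 - ind (w ! n)))"
  proof (intro sum.cong refl)
    fix w
    show "(\<Sum>l\<le>m + m. if w ! n \<in> J \<and> l \<in> J then word_prob w * transition (w ! n) l else 0) = word_prob w * (1 - ind (w ! n))"
    proof (cases "w ! n \<in> J")
      case True
      then have "(\<Sum>l\<le>m + m. if w ! n \<in> J \<and> l \<in> J then word_prob w * transition (w ! n) l else 0) = word_prob w * (\<Sum>l\<in>J. transition (w ! n) l)"
        using sum_letters_J[of "\<lambda>l. word_prob w * transition (w ! n) l"] by (simp add: sum_distrib_left)
      then show ?thesis using transition_sum True by (simp add: ind_def)
    qed (simp add: ind_def)
  qed
  also have "\<dots> = 1 - (\<Sum>w\<in>words (Suc n). word_prob w * ind (w ! n))"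
    by (simp add: right_diff_distrib sum_subtractf sum_words)
  also have "(\<Sum>w\<in>words (Suc n). word_prob w * ind (w ! n)) = (\<Sum>w\<in>words (Suc (Suc n)). word_prob w * ind (w ! n))"
    by (simp add: sum_words_letter)
  finally show ?thesis by simp
qed

text \<open>Almost every orbit either stays in the open branches of \<open>J\<close>, or stays in the knots, where the last
  label is redundant.\<close>

lemma word_prob_pos_cases:
  assumes w: "w \<in> words (Suc (Suc n))" and word_prob: "word_prob w \<noteq> 0"
  shows "w ! n \<in> J \<and> w ! Suc n \<in> J \<and> nxt (w ! n) (w ! Suc n) \<or>
         w ! n \<notin> J \<and> w ! Suc n \<notin> J \<and> word_prob w = word_prob (butlast w)"
proof -
  have len: "length w = Suc (Suc n)" using w by (simp add: words_def)
  obtain t where t: "t \<in> {0..1}" "word f lab (length w) t = w" using word_prob_pos_witness[OF word_prob] by blast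
  have lt: "lab ((f ^^ n) t) = w ! n" "lab (f ((f ^^ n) t)) = w ! Suc n"
    using nth_word[of n "length w" lab t] nth_word[of "Suc n" "length w" lab t] t len by auto
  note fu = f_pow_unit[OF t(1), of n] f_pow_unit[OF t(1), of "Suc n", simplified]
  show ?thesis
  proof (cases "w ! n < m")
    case True
    have 1: "w ! n \<in> J" using word_prob_zero_outside[of n w] word_prob True len by auto
    have l: "w ! Suc n < m" using word_prob_zero_into_knots[of n w] word_prob True len by (auto simp: not_less[symmetric])
    have 2: "w ! Suc n \<in> J" using word_prob_zero_outside[of "Suc n" w] word_prob l len by auto
    have "nxt (w ! n) (w ! Suc n)"
      using lab_eq_branch[OF True fu(1)] lab_eq_branch[OF l] fu(2) lt by (intro nxt_of_mem[OF True l]) auto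
    then show ?thesis using 1 2 by blast
  next
    case False
    obtain i where i: "i \<le> m" "(f ^^ n) t = x i"
      using fu(1) by (rule unit_cases) (use lt(1) False lab_branch in auto)
    obtain k where "k \<le> m" "f (x i) = x k" using f_knot[OF i(1)] by blast
    then have "w ! Suc n = m + k" using lt(2) i lab_knot by simp
    then have "w ! n \<notin> J" "w ! Suc n \<notin> J" using False J_less by fastforce+
    then show ?thesis using word_prob_knot[OF w word_prob] False by simp
  qed
qed

lemma markov_prob_pos:
  assumes "w \<in> words (Suc (Suc n))" "word_prob w \<noteq> 0" shows "markov_prob n w \<noteq> 0"
proof -
  have "length w = Suc (Suc n)" using assms by (simp add: words_def)
  then have "word_prob (butlast w) \<noteq> 0" using word_prob_butlast[of w "Suc n"] word_prob_nonneg[of w] assms(2) by auto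
  then show ?thesis using word_prob_pos_cases[OF assms] transition_pos assms(2) by (force simp: markov_prob_def)
qed

text \<open>On a word of positive probability with last step from \<open>i\<close> to \<open>l\<close> in \<open>J\<close>, the logarithm of the last conditional probability equals
  \<open>- ln lam - ln (v i) + ln (v l)\<close> plus the logarithm of the actual probability over the Parry
  prediction. The terms with \<open>v\<close> cancel in the mean by stationarity.\<close>

theorem shannon_increment:
  "shannon M (word f lab (Suc (Suc n))) - shannon M (word f lab (Suc n)) =
     weight * ln lam + (\<Sum>w\<in>words (Suc (Suc n)). word_prob w * ln (markov_prob n w / word_prob w))"
proof -
  define g where "g = (\<lambda>i. if i \<in> J then ln (v i) else 0)"
  define ind where "ind = (\<lambda>i. if i \<in> J then ln lam else 0)"
  have "level M (\<lambda>t. butlast (word f lab (Suc (Suc n)) t)) = level M (word f lab (Suc n))"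
    by (simp add: word_Suc[of lab "Suc n"] del: funpow.simps)
  then have "(\<Sum>w\<in>words (Suc (Suc n)). word_prob w * ln (word_prob (butlast w))) = (\<Sum>w\<in>words (Suc n). word_prob w * ln (word_prob w))"
    by (subst sum_words_compose[where Q = "words (Suc n)" and \<phi> = butlast and g = "\<lambda>w. ln (word_prob w)"])
       (auto simp: words_def word_prob_def dest: in_set_butlastD intro!: sum.cong finite_words[unfolded words_def])
  then have "shannon M (word f lab (Suc (Suc n))) - shannon M (word f lab (Suc n))
     = (\<Sum>w\<in>words (Suc (Suc n)). word_prob w * ln (word_prob (butlast w)) - word_prob w * ln (word_prob w))"
    by (simp add: shannon_words sum_subtractf)
  also have "\<dots> = (\<Sum>w\<in>words (Suc (Suc n)). word_prob w * ind (w ! n) + (word_prob w * g (w ! n) - word_prob w * g (w ! Suc n))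
      + word_prob w * ln (markov_prob n w / word_prob w))"
  proof (intro sum.cong refl)
    fix w assume w: "w \<in> words (Suc (Suc n))"
    show "word_prob w * ln (word_prob (butlast w)) - word_prob w * ln (word_prob w) =
      word_prob w * ind (w ! n) + (word_prob w * g (w ! n) - word_prob w * g (w ! Suc n)) + word_prob w * ln (markov_prob n w / word_prob w)"
    proof (cases "word_prob w = 0")
      case False
      then have pos: "0 < word_prob w" using word_prob_nonneg[of w] by simp
      have len: "length w = Suc (Suc n)" using w by (simp add: words_def)
      have pos': "0 < word_prob (butlast w)" using pos word_prob_butlast[OF len] by simp
      consider "w ! n \<in> J" "w ! Suc n \<in> J" "nxt (w ! n) (w ! Suc n)"
        | "w ! n \<notin> J" "w ! Suc n \<notin> J" "word_prob w = word_prob (butlast w)"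
        using word_prob_pos_cases[OF w False] by blast
      then show ?thesis
      proof cases
        case 1
        then have vp: "0 < v (w ! n)" "0 < v (w ! Suc n)" using v_pos by auto
        have eq: "ln (markov_prob n w / word_prob w) = ln (word_prob (butlast w)) + ln (v (w ! Suc n)) - (ln lam + ln (v (w ! n))) - ln (word_prob w)"
          using 1 pos pos' vp lam_pos by (simp add: markov_prob_def transition_def adj_def ln_div ln_mult)
        show ?thesis unfolding eq using 1 by (simp add: ind_def g_def right_diff_distrib distrib_left)
      next
        case 2
        then have "markov_prob n w = word_prob w" by (simp add: markov_prob_def)
        then show ?thesis using 2 pos by (simp add: ind_def g_def)
      qed
    qed simp
  qed
  also have "\<dots> = (\<Sum>i\<le>m + m. level M lab i * ind i) + (\<Sum>w\<in>words (Suc (Suc n)). word_prob w * ln (markov_prob n w / word_prob w))"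
    by (simp add: sum.distrib sum_subtractf sum_words_letter)
  also have "(\<Sum>i\<le>m + m. level M lab i * ind i) = weight * ln lam"
    using sum_letters_J[of "\<lambda>i. level M lab i * ln lam"]
    by (simp add: ind_def weight_def sum_distrib_right if_distrib[of "\<lambda>a. _ * a"] cong: if_cong)
  finally show ?thesis .
qed

lemma gain_le:
  assumes "w \<in> words (Suc (Suc n))"
  shows "word_prob w * ln (markov_prob n w / word_prob w) \<le> markov_prob n w - word_prob w" "word_prob w * ln (markov_prob n w / word_prob w) = markov_prob n w - word_prob w \<Longrightarrow> markov_prob n w = word_prob w"
proof -
  have "0 \<le> markov_prob n w" using assms by (intro markov_prob_nonneg) (simp add: words_def)
  note * = mult_ln_ratio_le[OF word_prob_nonneg this markov_prob_pos[OF assms]]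
  show "word_prob w * ln (markov_prob n w / word_prob w) \<le> markov_prob n w - word_prob w" "word_prob w * ln (markov_prob n w / word_prob w) = markov_prob n w - word_prob w \<Longrightarrow> markov_prob n w = word_prob w"
    using * by auto
qed

text \<open>Gibbs' inequality: both the actual and the predicted probabilities sum to \<open>1\<close>.\<close>

lemma gain_sum_le: "(\<Sum>w\<in>words (Suc (Suc n)). word_prob w * ln (markov_prob n w / word_prob w)) \<le> 0"
proof -
  have "(\<Sum>w\<in>words (Suc (Suc n)). word_prob w * ln (markov_prob n w / word_prob w)) \<le> (\<Sum>w\<in>words (Suc (Suc n)). markov_prob n w - word_prob w)"
    by (intro sum_mono gain_le)
  then show ?thesis by (simp add: sum_subtractf markov_prob_sum sum_words)
qed

lemma weight_range: "0 \<le> weight" "weight \<le> 1"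
proof -
  show "0 \<le> weight" unfolding weight_def by (intro sum_nonneg level_range)
  have "weight \<le> (\<Sum>i\<le>m + m. level M lab i)"
    unfolding weight_def using J_letters by (intro sum_mono2) (auto simp: level_range)
  also have "\<dots> = 1" using sum_words_letter[of 0 1 "\<lambda>_. 1"] by (simp add: sum_words)
  finally show "weight \<le> 1" .
qed

theorem entropy_rate_lab_le: "entropy_rate M f lab \<le> weight * ln lam"
  using entropy_rate_le_increment[OF lab_simple, of "Suc 0"] shannon_increment[of 0] gain_sum_le[of 0] by simp

lemma entropy_rate_le_lab: "simple_function M Y \<Longrightarrow> entropy_rate M f Y \<le> entropy_rate M f lab"
  by (rule entropy_rate_le_generator[OF invariant_prob_axioms space_M sets_M _ lab_simple _ lab_generates]) auto

lemma measure_entropy_eq: "measure_entropy M f = ereal (entropy_rate M f lab)"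
  by (intro antisym measure_entropy_le entropy_rate_le_lab entropy_rate_le_measure_entropy lab_simple)

text \<open>The entropy rate lies below every increment, so maximality forces equality in Gibbs' inequality for
  words of every length, and leaves no mass on the knots.\<close>

theorem maximal_entropy_transitions:
  assumes lam: "1 < lam" and max: "ln lam \<le> entropy_rate M f lab"
  shows "weight = 1" "w \<in> words (Suc (Suc n)) \<Longrightarrow> word_prob w = markov_prob n w"
proof -
  have lnp: "0 < ln lam" using lam by simp
  have le: "ln lam \<le> weight * ln lam + (\<Sum>w\<in>words (Suc (Suc n)). word_prob w * ln (markov_prob n w / word_prob w))" for n
    using max entropy_rate_le_increment[OF lab_simple, of "Suc n"] shannon_increment[of n] by simp
  have "1 * ln lam \<le> weight * ln lam" using gain_sum_le[of 0] le[of 0] by linarith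
  then show w1: "weight = 1" using lnp weight_range by (simp only: mult_le_cancel_right) auto
  assume w: "w \<in> words (Suc (Suc n))"
  have "(\<Sum>w\<in>words (Suc (Suc n)). word_prob w * ln (markov_prob n w / word_prob w)) = 0"
    using le[of n] gain_sum_le[of n] w1 by simp
  also have "0 = (\<Sum>w\<in>words (Suc (Suc n)). markov_prob n w - word_prob w)" by (simp add: sum_subtractf markov_prob_sum sum_words)
  finally have "word_prob w * ln (markov_prob n w / word_prob w) = markov_prob n w - word_prob w"
    by (rule sum_mono_inv) (use w finite_words gain_le in auto)
  then show "word_prob w = markov_prob n w" using gain_le(2)[OF w] by simp
qed

lemma words_of_J: "set w \<subseteq> J \<Longrightarrow> w \<in> words (length w)"
  using J_letters by (auto simp: words_def)

lemma word_prob_outside_zero: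
  assumes "weight = 1" "\<not> set w \<subseteq> J" "set w \<subseteq> {..m + m}" shows "word_prob w = 0"
proof -
  obtain k where k: "k < length w" "w ! k \<notin> J" using assms(2) by (metis in_set_conv_nth subsetI)
  have "(\<Sum>i\<le>m + m. level M lab i) = 1" using sum_words_letter[of 0 1 "\<lambda>_. 1"] by (simp add: sum_words)
  moreover have "(\<Sum>i\<le>m + m. level M lab i) = (\<Sum>i\<in>{..m + m} - J. level M lab i) + weight"
    unfolding weight_def using J_letters by (intro sum.subset_diff) auto
  ultimately have "(\<Sum>i\<in>{..m + m} - J. level M lab i) = 0" using assms(1) by simp
  moreover have "w ! k \<in> {..m + m} - J" using k assms(3) nth_mem[OF k(1)] by blast
  ultimately have "level M lab (w ! k) = 0"
    by (subst (asm) sum_nonneg_eq_0_iff) (auto simp: level_range)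
  then show ?thesis using word_prob_letter_le[OF k(1)] word_prob_nonneg[of w] by simp
qed

text \<open>Now the measure is a Markov chain with the Parry transition probabilities. Stationarity says that
  the law of the first letter divided by \<open>v\<close> is a left eigenvector, hence a multiple of \<open>u\<close>.\<close>

theorem maximal_entropy_cylinders:
  assumes lam: "1 < lam" and max: "ln lam \<le> entropy_rate M f lab"
    and w: "w \<noteq> []" "set w \<subseteq> J" "successively nxt w"
  shows "measure M (cyl w) = mass w"
proof -
  note trans = maximal_entropy_transitions[OF lam max]
  have ext: "word_prob (w @ [i, l]) = word_prob (w @ [i]) * transition i l" if "set w \<subseteq> J" "i \<in> J" "l \<in> J" for w i l
  proof -
    have mem: "w @ [i, l] \<in> words (Suc (Suc (length w)))"
      using words_of_J[of "w @ [i, l]"] that by simp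
    have "(w @ [i, l]) ! length w = i" "(w @ [i, l]) ! Suc (length w) = l" "butlast (w @ [i, l]) = w @ [i]"
      by (simp_all add: nth_append butlast_append)
    then show ?thesis using trans(2)[OF mem] that by (simp add: markov_prob_def)
  qed
  have P1: "word_prob [i] = level M lab i" for i
  proof -
    have "word f lab (length [i]) -` {[i]} \<inter> space M = lab -` {i} \<inter> space M"
      by (auto simp: word_def)
    then show ?thesis by (simp add: word_prob_def level_def)
  qed
  have stat: "(\<Sum>i\<in>J. word_prob [i] * transition i l) = word_prob [l]" if l: "l \<in> J" for l
  proof -
    define g where "g = (\<lambda>k. if k = l then 1 else 0 :: real)"
    have "(\<Sum>w\<in>words 2. word_prob w * g (w ! 1)) = (\<Sum>i\<le>m + m. level M lab i * g i)"
      by (rule sum_words_letter) simp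
    also have "\<dots> = word_prob [l]" using l J_letters by (auto simp: g_def P1 if_distrib[of "\<lambda>a. _ * a"] cong: if_cong)
    finally have 1: "(\<Sum>w\<in>words 2. word_prob w * g (w ! 1)) = word_prob [l]" .
    have "(\<Sum>w\<in>words 2. word_prob w * g (w ! 1)) = (\<Sum>w\<in>(\<lambda>i. [i, l]) ` J. word_prob w * g (w ! 1))"
    proof (rule sum.mono_neutral_right[OF finite_words])
      show "(\<lambda>i. [i, l]) ` J \<subseteq> words 2" using J_letters l by (auto simp: words_def)
      show "\<forall>w\<in>words 2 - (\<lambda>i. [i, l]) ` J. word_prob w * g (w ! 1) = 0"
      proof
        fix w assume w: "w \<in> words 2 - (\<lambda>i. [i, l]) ` J"
        then obtain a b where ab: "w = [a, b]" by (auto simp: words_def numeral_2_eq_2 length_Suc_conv)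
        show "word_prob w * g (w ! 1) = 0"
        proof (cases "b = l")
          case True
          then have "\<not> set w \<subseteq> J" using w ab l by auto
          then show ?thesis using word_prob_outside_zero[OF trans(1)] w by (auto simp: words_def)
        qed (simp add: ab g_def)
      qed
    qed
    also have "\<dots> = (\<Sum>i\<in>J. word_prob [i, l])" by (subst sum.reindex) (auto simp: inj_on_def g_def)
    also have "\<dots> = (\<Sum>i\<in>J. word_prob [i] * transition i l)" using ext[of "[]"] l by (intro sum.cong) auto
    finally show ?thesis using 1 by simp
  qed
  have A: "\<forall>i\<in>J. \<forall>l\<in>J. 0 \<le> adj i l" by (simp add: adj_def)
  have "\<forall>l\<in>J. (\<Sum>i\<in>J. word_prob [i] / v i * adj i l) = lam * (word_prob [l] / v l)"
  proof
    fix l assume l: "l \<in> J"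
    have "(\<Sum>i\<in>J. word_prob [i] / v i * adj i l) = (\<Sum>i\<in>J. (lam / v l) * (word_prob [i] * transition i l))"
      using v_pos lam_pos l by (intro sum.cong refl) (simp add: transition_def field_simps less_imp_neq[THEN not_sym])
    then show "(\<Sum>i\<in>J. word_prob [i] / v i * adj i l) = lam * (word_prob [l] / v l)"
      unfolding sum_distrib_left[symmetric] stat[OF l] by simp
  qed
  then obtain k where k: "\<forall>i\<in>J. word_prob [i] / v i = k * u i"
    by (rule left_eigenvector_unique[OF finite_J J_nonempty A irreducible u_pos u_eigen])
  then have k': "word_prob [i] = k * (u i * v i)" if "i \<in> J" for i
  proof -
    have "word_prob [i] / v i = k * u i" "0 < v i" using k v_pos that by blast+
    then show ?thesis by (simp add: field_simps)
  qed
  have "1 = (\<Sum>i\<in>J. word_prob [i])" using trans(1) by (simp add: weight_def P1)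
  also have "\<dots> = k" using k' uv_sum by (simp add: sum_distrib_left[symmetric])
  finally have init: "word_prob [i] = u i * v i" if "i \<in> J" for i using k' that by simp
  have "word_prob w = mass w" using w
  proof (induction w rule: rev_nonempty_induct)
    case (single i)
    then show ?case using init by (simp add: mass_def)
  next
    case (snoc l w)
    obtain i w' where w': "w = w' @ [i]" using snoc(1) by (metis rev_exhaust)
    have "word_prob (w @ [l]) = word_prob w * transition i l" using ext[of w' i l] snoc w' by simp
    also have "word_prob w = mass w" using snoc by (auto simp: successively_append_iff)
    also have "mass w * transition i l = mass (w @ [l])"
      using snoc v_pos lam_pos by (auto simp: w' mass_def transition_def adj_def successively_append_iff hd_append less_imp_neq[THEN not_sym])
    finally show ?case .
  qed
  then show ?thesis using word_prob_eq_measure_cyl[OF w(1)] w(2) J_sub by auto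
qed

text \<open>With Parry masses, actual and predicted probabilities agree, so every increment is exactly
  \<open>ln lam\<close>.\<close>

theorem entropy_rate_of_mass:
  assumes cyl: "\<And>w. w \<noteq> [] \<Longrightarrow> set w \<subseteq> J \<Longrightarrow> successively nxt w \<Longrightarrow> measure M (cyl w) = mass w"
  shows "entropy_rate M f lab = ln lam"
proof -
  have Pm: "word_prob w = mass w" if "w \<noteq> []" "set w \<subseteq> J" "successively nxt w" for w
    using cyl[OF that] word_prob_eq_measure_cyl[OF that(1)] that(2) J_sub by auto
  have "level M lab i = u i * v i" if "i \<in> J" for i
  proof -
    have "lab -` {i} \<inter> space M = cyl [i]"
      using lab_eq_branch[OF J_less[OF that]] branch_unit[OF J_less[OF that]] by (force simp: space_M)
    then show ?thesis using cyl[of "[i]"] that by (simp add: level_def mass_def)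
  qed
  then have w1: "weight = 1" using uv_sum by (simp add: weight_def)
  have PR: "word_prob w = markov_prob n w" if w: "w \<in> words (Suc (Suc n))" for n w
  proof -
    have len: "length w = Suc (Suc n)" "set w \<subseteq> {..m + m}" using w by (auto simp: words_def)
    obtain w0 i l where wil: "w = w0 @ [i, l]"
    proof -
      have "w \<noteq> []" "butlast w \<noteq> []" using len by (auto simp flip: length_0_conv)
      then show thesis using that[of "butlast (butlast w)" "last (butlast w)" "last w"] by (metis append_assoc append_butlast_last_id append_Cons append_Nil)
    qed
    have lw0: "length w0 = n" using len wil by simp
    have wn: "w ! n = i" "w ! Suc n = l" "butlast w = w0 @ [i]"
      using lw0 by (simp_all add: wil nth_append butlast_append)
    show ?thesis
    proof (cases "set w \<subseteq> J")
      case False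
      then have 0: "word_prob w = 0" by (rule word_prob_outside_zero[OF w1 _ len(2)])
      show ?thesis
      proof (cases "i \<in> J \<and> l \<in> J")
        case True
        then have "\<not> set (w0 @ [i]) \<subseteq> J" "set (w0 @ [i]) \<subseteq> {..m + m}" using False len(2) by (auto simp: wil)
        then have "word_prob (w0 @ [i]) = 0" by (rule word_prob_outside_zero[OF w1])
        then show ?thesis using 0 by (simp add: markov_prob_def wn)
      qed (use 0 in \<open>auto simp: markov_prob_def wn\<close>)
    next
      case True
      then have J: "i \<in> J" "l \<in> J" "set (w0 @ [i]) \<subseteq> J" by (auto simp: wil)
      have zero: "word_prob z = 0" if "z \<noteq> []" "set z \<subseteq> J" "\<not> successively nxt z" for z
        using word_prob_eq_measure_cyl[OF that(1)] path_of_mem_cyl[of z] that J_sub by (metis measure_empty equals0I order_trans)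
      show ?thesis
      proof (cases "successively nxt w")
        case True
        then have n: "successively nxt (w0 @ [i])" "nxt i l" by (auto simp: wil successively_append_iff)
        have "word_prob w = mass w" "word_prob (w0 @ [i]) = mass (w0 @ [i])" using Pm True \<open>set w \<subseteq> J\<close> J n by (auto simp: wil)
        moreover have "mass w = mass (w0 @ [i]) * transition i l"
          using J n v_pos lam_pos by (auto simp: wil mass_def transition_def adj_def hd_append less_imp_neq[THEN not_sym])
        ultimately show ?thesis using J by (simp add: markov_prob_def wn)
      next
        case False
        then have "word_prob w = 0" using zero[of w] \<open>set w \<subseteq> J\<close> wil by simp
        moreover have "word_prob (w0 @ [i]) * transition i l = 0"
        proof (cases "nxt i l")
          case True
          then have "\<not> successively nxt (w0 @ [i])" using False by (auto simp: wil successively_append_iff)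
          then show ?thesis using zero[of "w0 @ [i]"] J by simp
        qed (simp add: transition_def adj_def)
        ultimately show ?thesis using J by (simp add: markov_prob_def wn)
      qed
    qed
  qed
  have "(\<Sum>w\<in>words (Suc (Suc n)). word_prob w * ln (markov_prob n w / word_prob w)) = 0" for n
    using PR by (intro sum.neutral) auto
  then have inc: "shannon M (word f lab (Suc (Suc n))) - shannon M (word f lab (Suc n)) = ln lam" for n
    using shannon_increment[of n] w1 by simp
  define H1 where "H1 = shannon M (word f lab (Suc 0))"
  have H: "shannon M (word f lab (Suc n)) = H1 + real n * ln lam" for n
  proof (induction n)
    case (Suc n)
    then show ?case using inc[of n] by (simp add: algebra_simps)
  qed (simp add: H1_def)
  have "(\<lambda>n. (H1 - ln lam) / real n + ln lam) \<longlonglongrightarrow> 0 + ln lam"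
    by (intro tendsto_intros lim_const_over_n)
  moreover have "shannon M (word f lab n) / real n = (H1 - ln lam) / real n + ln lam" if n: "1 \<le> n" for n
  proof -
    obtain k where k: "n = Suc k" using n by (cases n) auto
    have "shannon M (word f lab n) = (H1 - ln lam) + real n * ln lam"
      using H[of k] by (simp add: k algebra_simps)
    then show ?thesis using n by (simp add: add_divide_distrib)
  qed
  ultimately have "(\<lambda>n. shannon M (word f lab n) / real n) \<longlonglongrightarrow> 0 + ln lam"
    by (elim Lim_transform_eventually) (auto intro!: eventually_sequentiallyI[of 1])
  then show ?thesis using LIMSEQ_unique[OF entropy_rate_limit[OF lab_simple]] by simp
qed

end

section \<open>The distribution function of the Parry measure\<close>

context perron_data
begin

definition admissible :: "nat \<Rightarrow> nat list set" where
  "admissible n = {w. length w = n \<and> set w \<subseteq> J \<and> successively nxt w}"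

definition left_end :: "nat list \<Rightarrow> real" where "left_end w = Inf (cyl w)"
definition right_end :: "nat list \<Rightarrow> real" where "right_end w = Sup (cyl w)"

text \<open>The mass of the cylinders of level \<open>n\<close> that lie to the left of \<open>t\<close>. As \<open>n\<close> grows this increases to
  the distribution function of the Parry measure.\<close>

definition level_cdf :: "nat \<Rightarrow> real \<Rightarrow> real" where
  "level_cdf n t = (\<Sum>w\<in>{w \<in> admissible n. right_end w \<le> t}. mass w)"

lemma finite_admissible: "finite (admissible n)"
  by (rule finite_subset[OF _ finite_lists_length_eq[OF finite_J, of n]]) (auto simp: admissible_def)

lemma admissible_ends:
  assumes "w \<in> admissible n" "0 < n"
  shows "left_end w < right_end w" "cyl w = {left_end w<..<right_end w}"
proof -
  obtain l r where lr: "l < r" "cyl w = {l<..<r}"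
    using cyl_interval[of w] assms J_sub by (auto simp: admissible_def)
  then show "left_end w < right_end w" "cyl w = {left_end w<..<right_end w}"
    by (simp_all add: left_end_def right_end_def)
qed

lemma admissible_unit:
  assumes "w \<in> admissible n" "0 < n" shows "cyl w \<subseteq> {0<..<1}" "0 \<le> left_end w" "right_end w \<le> 1"
proof -
  show sub: "cyl w \<subseteq> {0<..<1}" using cyl_unit[of w] assms J_sub by (auto simp: admissible_def)
  have "{left_end w<..<right_end w} \<subseteq> {0<..<1}" using sub admissible_ends(2)[OF assms] by simp
  then show "0 \<le> left_end w" "right_end w \<le> 1"
    using admissible_ends(1)[OF assms] by (simp_all add: greaterThanLessThan_subseteq_greaterThanLessThan)
qed

lemma admissible_unique:
  assumes "w \<in> admissible n" "w' \<in> admissible n" "t \<in> cyl w" "t \<in> cyl w'" shows "w = w'"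
  using assms cyl_unique[of w w' t] J_sub by (auto simp: admissible_def)

lemma mass_nonneg:
  assumes "w \<noteq> []" "set w \<subseteq> J" shows "0 \<le> mass w"
proof -
  have "hd w \<in> J" "last w \<in> J" using assms by auto
  then have "0 < u (hd w)" "0 < v (last w)" using u_pos v_pos by auto
  then show ?thesis using lam_pos by (simp add: mass_def)
qed

lemma mass_nonneg_admissible: "w \<in> admissible n \<Longrightarrow> 0 < n \<Longrightarrow> 0 \<le> mass w"
  by (rule mass_nonneg) (auto simp: admissible_def)

lemma mass_append:
  assumes "w \<in> admissible n" "0 < n"
  shows "(\<Sum>l\<in>{l \<in> J. nxt (last w) l}. mass (w @ [l])) = mass w"
proof -
  have w: "w \<noteq> []" "set w \<subseteq> J" using assms by (auto simp: admissible_def)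
  then have lJ: "last w \<in> J" by auto
  have len: "length w = Suc (length w - 1)" using w by (cases w) auto
  have "(\<Sum>l\<in>{l \<in> J. nxt (last w) l}. mass (w @ [l])) = (\<Sum>l\<in>J. mass w * transition (last w) l)"
  proof (rule sum.mono_neutral_cong_left[OF finite_J])
    fix l assume "l \<in> {l \<in> J. nxt (last w) l}"
    then show "mass (w @ [l]) = mass w * transition (last w) l"
      using w lJ v_pos lam_pos len
      by (cases "length w") (auto simp: mass_def transition_def adj_def less_imp_neq[THEN not_sym])
  qed (auto simp: transition_def adj_def)
  also have "\<dots> = mass w" by (simp add: sum_distrib_left[symmetric] transition_sum[OF lJ])
  finally show ?thesis .
qed

lemma mass_Cons:
  assumes "w \<in> admissible n" "0 < n"
  shows "(\<Sum>i\<in>{i \<in> J. nxt i (hd w)}. mass (i # w)) = mass w"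
proof -
  have w: "w \<noteq> []" "set w \<subseteq> J" using assms by (auto simp: admissible_def)
  then have hJ: "hd w \<in> J" by auto
  have "(\<Sum>i\<in>{i \<in> J. nxt i (hd w)}. mass (i # w)) = (\<Sum>i\<in>J. (v (last w) / lam ^ length w) * (u i * adj i (hd w)))"
    by (rule sum.mono_neutral_cong_left[OF finite_J]) (use w in \<open>auto simp: mass_def adj_def\<close>)
  also have "\<dots> = (v (last w) / lam ^ length w) * (lam * u (hd w))"
    unfolding sum_distrib_left[symmetric] using u_eigen hJ by simp
  also have "\<dots> = mass w"
    using w lam_pos by (cases "length w") (auto simp: mass_def)
  finally show ?thesis .
qed

lemma admissible_Suc:
  assumes "0 < n"
  shows "admissible (Suc n) = (\<lambda>(w, l). w @ [l]) ` (SIGMA w : admissible n. {l \<in> J. nxt (last w) l})"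
proof (intro set_eqI iffI)
  fix w assume w: "w \<in> admissible (Suc n)"
  define z where "z = butlast w"
  have "w \<noteq> []" using w by (auto simp: admissible_def)
  then have wz: "w = z @ [last w]" by (simp add: z_def)
  have "z \<noteq> []" using w assms by (auto simp: z_def admissible_def simp flip: length_0_conv)
  have "z \<in> admissible n" "last w \<in> J" "nxt (last z) (last w)"
  proof -
    have "successively nxt (z @ [last w])" using w wz by (simp add: admissible_def)
    then show "nxt (last z) (last w)" "z \<in> admissible n"
      using w \<open>z \<noteq> []\<close> by (auto simp: admissible_def z_def successively_append_iff dest: in_set_butlastD)
    show "last w \<in> J" using w \<open>w \<noteq> []\<close> by (auto simp: admissible_def)
  qed
  then have "(z, last w) \<in> (SIGMA w : admissible n. {l \<in> J. nxt (last w) l})" by simp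
  then show "w \<in> (\<lambda>(w, l). w @ [l]) ` (SIGMA w : admissible n. {l \<in> J. nxt (last w) l})"
    using wz by (metis (no_types, lifting) case_prod_conv image_eqI)
qed (use assms in \<open>auto simp: admissible_def successively_append_iff\<close>)

lemma sum_admissible_Suc:
  fixes g :: "nat list \<Rightarrow> real"
  assumes "0 < n"
  shows "(\<Sum>w\<in>admissible (Suc n). g w) = (\<Sum>w\<in>admissible n. \<Sum>l\<in>{l \<in> J. nxt (last w) l}. g (w @ [l]))"
proof -
  have "inj_on (\<lambda>(w, l). w @ [l]) (SIGMA w : admissible n. {l \<in> J. nxt (last w) l})" by (auto simp: inj_on_def)
  then show ?thesis
    unfolding admissible_Suc[OF assms] using finite_J
    by (subst sum.reindex) (auto simp: sum.Sigma finite_admissible case_prod_unfold)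
qed

lemma sum_mass_admissible: "0 < n \<Longrightarrow> (\<Sum>w\<in>admissible n. mass w) = 1"
proof (induction n rule: nat_induct_non_zero)
  case 1
  have "admissible 1 = (\<lambda>i. [i]) ` J" by (auto simp: admissible_def length_Suc_conv)
  then have "(\<Sum>w\<in>admissible 1. mass w) = (\<Sum>i\<in>J. mass [i])" by (simp add: sum.reindex inj_on_def)
  then show ?case using uv_sum by (simp add: mass_def)
next
  case (Suc n)
  then show ?case by (simp add: sum_admissible_Suc mass_append)
qed

lemma mass_bound: "\<exists>K>0. \<forall>n>0. \<forall>w\<in>admissible n. mass w \<le> K / lam ^ n"
proof -
  define K where "K = lam * (1 + (\<Sum>i\<in>J. u i) * (\<Sum>i\<in>J. v i))"
  have su: "0 \<le> (\<Sum>i\<in>J. u i)" "0 \<le> (\<Sum>i\<in>J. v i)" using u_pos v_pos by (auto intro!: sum_nonneg intro: less_imp_le)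
  then have K: "0 < K" using lam_pos by (auto simp: K_def intro!: mult_pos_pos add_pos_nonneg)
  have "mass w \<le> K / lam ^ n" if n: "0 < n" "w \<in> admissible n" for n w
  proof -
    have w: "hd w \<in> J" "last w \<in> J" "length w = n" using n by (auto simp: admissible_def)
    have "u (hd w) * v (last w) \<le> (\<Sum>i\<in>J. u i) * (\<Sum>i\<in>J. v i)"
      using w u_pos v_pos finite_J su by (intro mult_mono member_le_sum) (auto intro: less_imp_le)
    then have "lam * (u (hd w) * v (last w)) \<le> K" using lam_pos by (simp add: K_def)
    moreover have "mass w = lam * (u (hd w) * v (last w)) / lam ^ n"
      using w n lam_pos by (cases n) (auto simp: mass_def)
    ultimately show ?thesis using lam_pos by (simp add: divide_right_mono)
  qed
  then show ?thesis using K by blast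
qed

lemma right_end_cases:
  assumes "w \<in> admissible n" "0 < n"
  obtains "right_end w \<le> t" | "t \<in> cyl w" | "t \<le> left_end w" "\<not> right_end w \<le> t"
  using admissible_ends[OF assms] by force

lemma child_ends:
  assumes "w @ [l] \<in> admissible (Suc n)" "w \<in> admissible n" "0 < n"
  shows "right_end (w @ [l]) \<le> right_end w" "left_end w < right_end (w @ [l])"
proof -
  have "cyl (w @ [l]) \<subseteq> cyl w" using cyl_append[of _ w "[l]"] by blast
  then have sub: "{left_end (w @ [l])<..<right_end (w @ [l])} \<subseteq> {left_end w<..<right_end w}"
    using admissible_ends(2)[OF assms(1)] admissible_ends(2)[OF assms(2,3)] by simp
  show "right_end (w @ [l]) \<le> right_end w" "left_end w < right_end (w @ [l])"
    using sub admissible_ends(1)[OF assms(1)] greaterThanLessThan_subseteq_greaterThanLessThan[of "left_end (w @ [l])" "right_end (w @ [l])"]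
    by auto
qed

lemma child_in_admissible: "w \<in> admissible n \<Longrightarrow> 0 < n \<Longrightarrow> l \<in> J \<Longrightarrow> nxt (last w) l \<Longrightarrow> w @ [l] \<in> admissible (Suc n)"
  by (auto simp: admissible_def successively_append_iff)

lemma level_cdf_alt: "level_cdf n t = (\<Sum>w\<in>admissible n. if right_end w \<le> t then mass w else 0)"
  unfolding level_cdf_def by (rule sum.inter_filter[OF finite_admissible])

text \<open>Refining the cylinders redistributes only the mass of the cylinder that contains \<open>t\<close>.\<close>

lemma level_cdf_step:
  assumes n: "0 < n"
  shows "level_cdf n t \<le> level_cdf (Suc n) t"
    and "level_cdf (Suc n) t \<le> level_cdf n t + (\<Sum>w\<in>{w \<in> admissible n. t \<in> cyl w}. mass w)"
proof -
  define G where "G = (\<lambda>w. \<Sum>l\<in>{l \<in> J. nxt (last w) l}. if right_end (w @ [l]) \<le> t then mass (w @ [l]) else 0)"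
  have FS: "level_cdf (Suc n) t = (\<Sum>w\<in>admissible n. G w)"
    unfolding level_cdf_alt sum_admissible_Suc[OF n] G_def ..
  have G0: "0 \<le> G w" if "w \<in> admissible n" for w
    unfolding G_def using mass_nonneg_admissible[OF child_in_admissible[OF that n]] by (auto intro!: sum_nonneg)
  have G1: "G w = mass w" if w: "w \<in> admissible n" "right_end w \<le> t" for w
  proof -
    have "G w = (\<Sum>l\<in>{l \<in> J. nxt (last w) l}. mass (w @ [l]))"
      unfolding G_def using child_ends(1)[OF child_in_admissible[OF w(1) n] w(1) n] w(2)
      by (intro sum.cong) (auto intro: order_trans)
    then show ?thesis using mass_append[OF w(1) n] by simp
  qed
  have G2: "G w \<le> mass w" if w: "w \<in> admissible n" for w
  proof -
    have "G w \<le> (\<Sum>l\<in>{l \<in> J. nxt (last w) l}. mass (w @ [l]))"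
      unfolding G_def using mass_nonneg_admissible[OF child_in_admissible[OF w n]] by (intro sum_mono) auto
    then show ?thesis using mass_append[OF w n] by simp
  qed
  have G3: "G w = 0" if w: "w \<in> admissible n" "t \<le> left_end w" for w
    unfolding G_def using child_ends(2)[OF child_in_admissible[OF w(1) n] w(1) n] w(2)
    by (intro sum.neutral) force
  show "level_cdf n t \<le> level_cdf (Suc n) t"
    unfolding FS level_cdf_alt[of n] using G0 G1 by (intro sum_mono) auto
  have "level_cdf (Suc n) t \<le> (\<Sum>w\<in>admissible n. (if right_end w \<le> t then mass w else 0) + (if t \<in> cyl w then mass w else 0))"
    unfolding FS
  proof (rule sum_mono)
    fix w assume w: "w \<in> admissible n"
    show "G w \<le> (if right_end w \<le> t then mass w else 0) + (if t \<in> cyl w then mass w else 0)"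
      by (rule right_end_cases[OF w n, of t])
         (use G1[OF w] G2[OF w] G3[OF w] mass_nonneg_admissible[OF w n] in auto)
  qed
  then show "level_cdf (Suc n) t \<le> level_cdf n t + (\<Sum>w\<in>{w \<in> admissible n. t \<in> cyl w}. mass w)"
    unfolding level_cdf_alt[of n] sum.distrib sum.inter_filter[OF finite_admissible] .
qed

lemma straddle_le:
  assumes "0 \<le> K" "\<forall>w\<in>admissible n. mass w \<le> K"
    and unique: "\<And>w w'. w \<in> admissible n \<Longrightarrow> w' \<in> admissible n \<Longrightarrow> Q w \<Longrightarrow> Q w' \<Longrightarrow> w = w'"
  shows "(\<Sum>w\<in>{w \<in> admissible n. Q w}. mass w) \<le> K"
proof (cases "\<exists>w\<in>admissible n. Q w")
  case True
  then obtain w where w: "w \<in> admissible n" "Q w" by blast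
  then have "{w \<in> admissible n. Q w} = {w}" using unique by blast
  then show ?thesis using assms w by simp
next
  case False
  then have "{w \<in> admissible n. Q w} = {}" by blast
  then show ?thesis using assms(1) by (simp only: sum.empty)
qed

lemma level_cdf_mono: "0 < n \<Longrightarrow> s \<le> t \<Longrightarrow> level_cdf n s \<le> level_cdf n t"
  unfolding level_cdf_alt by (intro sum_mono) (auto simp: mass_nonneg_admissible)

lemma level_cdf_range: "0 < n \<Longrightarrow> 0 \<le> level_cdf n t" "0 < n \<Longrightarrow> level_cdf n t \<le> 1"
proof -
  assume n: "0 < n"
  show "0 \<le> level_cdf n t" unfolding level_cdf_def using n by (intro sum_nonneg) (auto intro: mass_nonneg_admissible)
  have "level_cdf n t \<le> (\<Sum>w\<in>admissible n. mass w)"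
    unfolding level_cdf_alt using n by (intro sum_mono) (auto intro: mass_nonneg_admissible)
  then show "level_cdf n t \<le> 1" using sum_mass_admissible[OF n] by simp
qed

lemma level_cdf_left: "0 < n \<Longrightarrow> t \<le> 0 \<Longrightarrow> level_cdf n t = 0"
  unfolding level_cdf_alt using admissible_ends(1) admissible_unit(2) by (intro sum.neutral) fastforce

lemma level_cdf_right: "0 < n \<Longrightarrow> 1 \<le> t \<Longrightarrow> level_cdf n t = 1"
proof -
  assume n: "0 < n" "1 \<le> t"
  then have "level_cdf n t = (\<Sum>w\<in>admissible n. mass w)"
    unfolding level_cdf_alt using admissible_unit(3) by (intro sum.cong) fastforce+
  then show "level_cdf n t = 1" using sum_mass_admissible[OF n(1)] by simp
qed

definition cdf_limit :: "real \<Rightarrow> real" where "cdf_limit t = lim (\<lambda>n. level_cdf (Suc n) t)"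

lemma level_cdf_tendsto: "(\<lambda>n. level_cdf (Suc n) t) \<longlonglongrightarrow> cdf_limit t"
proof -
  have "incseq (\<lambda>n. level_cdf (Suc n) t)" by (auto simp: incseq_Suc_iff intro: level_cdf_step)
  moreover have "\<forall>n. level_cdf (Suc n) t \<le> 1" using level_cdf_range(2) by simp
  ultimately obtain L where "(\<lambda>n. level_cdf (Suc n) t) \<longlonglongrightarrow> L"
    by (rule incseq_convergent)
  then show ?thesis by (simp add: cdf_limit_def limI)
qed

lemma level_cdf_le_limit: "0 < n \<Longrightarrow> level_cdf n t \<le> cdf_limit t"
proof -
  assume n: "0 < n"
  have "incseq (\<lambda>n. level_cdf (Suc n) t)" by (auto simp: incseq_Suc_iff intro: level_cdf_step)
  then have "level_cdf (Suc (n - 1)) t \<le> cdf_limit t" by (rule incseq_le[OF _ level_cdf_tendsto])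
  then show ?thesis using n by simp
qed

text \<open>The masses of single cylinders decay geometrically, so the corrections from all finer levels sum
  to a multiple of the mass at level \<open>n\<close>.\<close>

lemma limit_le_level_cdf:
  assumes lam: "1 < lam"
  shows "\<exists>C>0. \<forall>n>0. \<forall>t. cdf_limit t \<le> level_cdf n t + C / lam ^ n \<and> (\<forall>w\<in>admissible n. mass w \<le> C / lam ^ n)"
proof -
  obtain K where K: "0 < K" "\<forall>n>0. \<forall>w\<in>admissible n. mass w \<le> K / lam ^ n" using mass_bound by blast
  \<comment> \<open>\<open>C / lam ^ n\<close> is the sum of \<open>K / lam ^ k\<close> over \<open>k \<ge> n\<close>.\<close>
  define C where "C = K * lam / (lam - 1)"
  have C: "0 < C" "K \<le> C" using K lam by (auto simp: C_def field_simps)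
  have "cdf_limit t \<le> level_cdf n t + C / lam ^ n" if n: "0 < n" for n t
  proof -
    have dec: "level_cdf (Suc k) t + C / lam ^ Suc k \<le> level_cdf k t + C / lam ^ k" if k: "0 < k" for k
    proof -
      have "(\<Sum>w\<in>{w \<in> admissible k. t \<in> cyl w}. mass w) \<le> K / lam ^ k"
        by (rule straddle_le) (use K k lam admissible_unique in \<open>auto intro!: divide_nonneg_pos\<close>)
      then have "level_cdf (Suc k) t \<le> level_cdf k t + K / lam ^ k" using level_cdf_step(2)[OF k, of t] by simp
      moreover have "K / lam ^ k + C / lam ^ Suc k = C / lam ^ k"
        using lam by (simp add: C_def field_simps)
      ultimately show ?thesis by linarith
    qed
    have le: "level_cdf (n + k) t + C / lam ^ (n + k) \<le> level_cdf n t + C / lam ^ n" for k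
    proof (induction k)
      case (Suc k)
      then show ?case using dec[of "n + k"] n by simp
    qed simp
    have "level_cdf (Suc k) t \<le> level_cdf n t + C / lam ^ n" if "n \<le> k" for k
    proof -
      have "level_cdf (Suc k) t + C / lam ^ Suc k \<le> level_cdf n t + C / lam ^ n"
        using le[of "Suc k - n"] that by simp
      moreover have "0 \<le> C / lam ^ Suc k" using C lam by simp
      ultimately show ?thesis by linarith
    qed
    then show ?thesis by (intro LIMSEQ_le_const2[OF level_cdf_tendsto]) blast
  qed
  moreover have "mass w \<le> C / lam ^ n" if "0 < n" "w \<in> admissible n" for n w
    using K(2) that C(2) lam by (meson divide_right_mono order_trans zero_le_power less_imp_le zero_less_one less_trans)
  ultimately show ?thesis using C by blast
qed

lemma cdf_limit_mono: "mono cdf_limit"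
proof (rule monoI)
  fix s t :: real assume "s \<le> t"
  then show "cdf_limit s \<le> cdf_limit t"
    by (intro LIMSEQ_le[OF level_cdf_tendsto level_cdf_tendsto]) (auto intro: level_cdf_mono)
qed

lemma right_end_unique:
  assumes "w \<in> admissible n" "w' \<in> admissible n" "0 < n" "left_end w < right_end w'" "right_end w' \<le> right_end w"
  shows "w = w'"
proof -
  have "max (left_end w) (left_end w') < right_end w'" using admissible_ends(1)[OF assms(2,3)] assms(4) by simp
  then obtain t where "max (left_end w) (left_end w') < t" "t < right_end w'" using dense by blast
  then have "t \<in> cyl w" "t \<in> cyl w'" using admissible_ends(2) assms by auto
  then show ?thesis using admissible_unique assms by blast
qed

text \<open>The step function of level \<open>n\<close> jumps at \<open>t\<close> by the mass of at most one cylinder, and it is uniformly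
  close to the limit.\<close>

lemma cdf_limit_continuous:
  assumes lam: "1 < lam" shows "isCont cdf_limit t"
proof -
  obtain C where C: "0 < C" "\<And>n t. 0 < n \<Longrightarrow> cdf_limit t \<le> level_cdf n t + C / lam ^ n"
    "\<And>n w. 0 < n \<Longrightarrow> w \<in> admissible n \<Longrightarrow> mass w \<le> C / lam ^ n" using limit_le_level_cdf[OF lam] by blast
  have "\<forall>\<^sub>F s in at t. \<bar>cdf_limit s - cdf_limit t\<bar> < e" if e: "0 < e" for e
  proof -
    obtain n0 where n0: "2 * C / e < lam ^ n0" using real_arch_pow[OF lam] by blast
    define n where "n = Suc n0"
    have "lam ^ n0 \<le> lam ^ n" unfolding n_def using lam by (intro power_increasing) auto
    then have "2 * C / e < lam ^ n" using n0 by linarith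
    then have n: "0 < n" "2 * (C / lam ^ n) < e" using e lam by (auto simp: n_def field_simps)
    have "\<forall>\<^sub>F s in at t. \<forall>w\<in>admissible n. right_end w \<noteq> t \<longrightarrow> (right_end w \<le> s \<longleftrightarrow> right_end w \<le> t)"
    proof (intro eventually_ball_finite finite_admissible ballI)
      fix w
      show "\<forall>\<^sub>F s in at t. right_end w \<noteq> t \<longrightarrow> (right_end w \<le> s \<longleftrightarrow> right_end w \<le> t)"
      proof (cases "right_end w < t")
        case True
        then have "\<forall>\<^sub>F s in at t. right_end w < s" using order_tendstoD(1)[OF tendsto_ident_at] by blast
        then show ?thesis by eventually_elim (use True in auto)
      next
        case False
        show ?thesis
        proof (cases "right_end w = t")
          case False
          then have *: "t < right_end w" using \<open>\<not> right_end w < t\<close> by simp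
          then have "\<forall>\<^sub>F s in at t. s < right_end w" using order_tendstoD(2)[OF tendsto_ident_at] by blast
          then show ?thesis by eventually_elim (use * in auto)
        qed simp
      qed
    qed
    then show ?thesis
    proof eventually_elim
      case (elim s)
      have "\<bar>level_cdf n s - level_cdf n t\<bar> \<le> (\<Sum>w\<in>{w \<in> admissible n. right_end w = t}. mass w)"
      proof -
        have "\<bar>level_cdf n s - level_cdf n t\<bar> \<le> (\<Sum>w\<in>admissible n. \<bar>(if right_end w \<le> s then mass w else 0) - (if right_end w \<le> t then mass w else 0)\<bar>)"
          unfolding level_cdf_alt sum_subtractf[symmetric] by (rule sum_abs)
        also have "\<dots> \<le> (\<Sum>w\<in>admissible n. if right_end w = t then mass w else 0)"
          by (intro sum_mono) (use elim mass_nonneg_admissible[OF _ n(1)] in auto)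
        finally show ?thesis by (simp add: sum.inter_filter[OF finite_admissible])
      qed
      also have "\<dots> \<le> C / lam ^ n"
        by (rule straddle_le) (use C n lam admissible_ends(1) right_end_unique in \<open>auto intro!: divide_nonneg_pos\<close>)
      finally have 1: "\<bar>level_cdf n s - level_cdf n t\<bar> \<le> C / lam ^ n" .
      have "level_cdf n s \<le> cdf_limit s" "level_cdf n t \<le> cdf_limit t" "cdf_limit s \<le> level_cdf n s + C / lam ^ n" "cdf_limit t \<le> level_cdf n t + C / lam ^ n"
        using level_cdf_le_limit[OF n(1)] C(2)[OF n(1)] by auto
      then show ?case using 1 n(2) by linarith
    qed
  qed
  then show ?thesis unfolding isCont_def tendsto_iff dist_real_def by blast
qed

lemma level_cdf_Suc_at_end:
  assumes "0 < n" "\<And>w. w \<in> admissible n \<Longrightarrow> t \<notin> cyl w" shows "level_cdf (Suc n) t = level_cdf n t"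
proof -
  have "{w \<in> admissible n. t \<in> cyl w} = {}" using assms by blast
  then have "(\<Sum>w\<in>{w \<in> admissible n. t \<in> cyl w}. mass w) = 0" by (simp only: sum.empty)
  then show ?thesis using level_cdf_step[OF assms(1), of t] by simp
qed

text \<open>Cylinders are open and those of one level are disjoint, so an end point of a cylinder is never
  interior to a finer one. Hence refinement does not change the distribution function there.\<close>

lemma ends_not_in_cyl:
  assumes w: "w \<in> admissible k" and w': "w' \<in> admissible n" and k: "0 < k" "k \<le> n"
  shows "left_end w \<notin> cyl w'" "right_end w \<notin> cyl w'"
proof -
  have z: "take k w' \<in> admissible k" using w' k by (auto simp: admissible_def dest: in_set_takeD)
    (metis append_take_drop_id successively_append_iff)
  have sub: "cyl w' \<subseteq> cyl (take k w')" by (rule cyl_take)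
  have "left_end w \<notin> cyl (take k w') \<and> right_end w \<notin> cyl (take k w')"
  proof (cases "take k w' = w")
    case True
    then show ?thesis using admissible_ends(2)[OF w k(1)] by auto
  next
    case False
    define z where "z = take k w'"
    note zw = z[folded z_def] False[folded z_def]
    show ?thesis unfolding z_def[symmetric]
    proof (intro conjI notI)
      assume "left_end w \<in> cyl z"
      then have "left_end w < min (right_end z) (right_end w)" "left_end z < left_end w"
        using admissible_ends[OF zw(1) k(1)] admissible_ends(1)[OF w k(1)] by auto
      then obtain t where "left_end w < t" "t < min (right_end z) (right_end w)" using dense by blast
      then have "t \<in> cyl w" "t \<in> cyl z" using admissible_ends(2)[OF zw(1) k(1)] admissible_ends(2)[OF w k(1)] \<open>left_end z < left_end w\<close> by auto
      then show False using admissible_unique[OF w zw(1)] zw(2) by blast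
    next
      assume "right_end w \<in> cyl z"
      then have "max (left_end z) (left_end w) < right_end w" "right_end w < right_end z"
        using admissible_ends[OF zw(1) k(1)] admissible_ends(1)[OF w k(1)] by auto
      then obtain t where "max (left_end z) (left_end w) < t" "t < right_end w" using dense by blast
      then have "t \<in> cyl w" "t \<in> cyl z" using admissible_ends(2)[OF zw(1) k(1)] admissible_ends(2)[OF w k(1)] \<open>right_end w < right_end z\<close> by auto
      then show False using admissible_unique[OF w zw(1)] zw(2) by blast
    qed
  qed
  then show "left_end w \<notin> cyl w'" "right_end w \<notin> cyl w'" using sub by auto
qed

lemma cdf_limit_at_end:
  assumes w: "w \<in> admissible k" and k: "0 < k"
  shows "cdf_limit (left_end w) = level_cdf k (left_end w)" "cdf_limit (right_end w) = level_cdf k (right_end w)"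
proof -
  have "cdf_limit t = level_cdf k t" if t: "\<And>n w'. k \<le> n \<Longrightarrow> w' \<in> admissible n \<Longrightarrow> t \<notin> cyl w'" for t
  proof -
    have const: "level_cdf (k + i) t = level_cdf k t" for i
    proof (induction i)
      case (Suc i)
      have "level_cdf (Suc (k + i)) t = level_cdf (k + i) t" 
        using k t[OF le_add1] by (intro level_cdf_Suc_at_end) simp_all
      then show ?case using Suc by simp
    qed simp
    have "(\<lambda>n. level_cdf (Suc n) t) \<longlonglongrightarrow> level_cdf k t"
    proof (rule tendsto_eventually, rule eventually_sequentiallyI)
      fix n assume "k \<le> n"
      then show "level_cdf (Suc n) t = level_cdf k t" using const[of "Suc n - k"] by simp
    qed
    then show ?thesis using level_cdf_tendsto LIMSEQ_unique by blast
  qed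
  then show "cdf_limit (left_end w) = level_cdf k (left_end w)" "cdf_limit (right_end w) = level_cdf k (right_end w)"
    using ends_not_in_cyl[OF w _ k] by blast+
qed

lemma cdf_limit_cyl:
  assumes w: "w \<in> admissible k" and k: "0 < k"
  shows "cdf_limit (right_end w) - cdf_limit (left_end w) = mass w"
proof -
  have "level_cdf k (right_end w) - level_cdf k (left_end w) = (\<Sum>z\<in>admissible k. if z = w then mass z else 0)"
    unfolding level_cdf_alt sum_subtractf[symmetric]
  proof (intro sum.cong refl)
    fix z assume z: "z \<in> admissible k"
    show "(if right_end z \<le> right_end w then mass z else 0) - (if right_end z \<le> left_end w then mass z else 0) =
          (if z = w then mass z else 0)"
      using admissible_ends(1)[OF w k] right_end_unique[OF w z k] by (cases "z = w") force+
  qed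
  also have "\<dots> = mass w" using w finite_admissible by simp
  finally show ?thesis using cdf_limit_at_end[OF w k] by simp
qed

end

section \<open>The Parry measure as the measure of maximal entropy\<close>

context perron_data
begin

lemma admissible_cyl_sets: "w \<in> admissible n \<Longrightarrow> cyl w \<in> sets borel"
  using open_cyl[of w] J_sub by (auto simp: admissible_def)

text \<open>At every level the cylinders carry full measure, so the measure of a half-line is squeezed between
  the mass of the cylinders inside it and that mass plus one more cylinder.\<close>

lemma cdf_of_cylinder_masses:
  assumes lam: "1 < lam" and M: "prob_space M" "space M = {0..1}" "sets M = sets (restrict_space borel {0..1})"
    and cyl: "\<And>n w. 0 < n \<Longrightarrow> w \<in> admissible n \<Longrightarrow> measure M (cyl w) = mass w"
  shows "measure M ({..t} \<inter> {0..1}) = cdf_limit t"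
proof -
  interpret prob_space M by fact
  have MI: "A \<inter> {0..1} \<in> sets M" if "A \<in> sets borel" for A
    using that by (simp add: M(3) sets_restrict_space_iff)
  have MC: "cyl w \<in> sets M" if "w \<in> admissible n" "0 < n" for w n
  proof -
    have "cyl w \<subseteq> {0..1}" using admissible_unit(1)[OF that] by auto
    then show ?thesis using MI[OF admissible_cyl_sets[OF that(1)]] by (simp add: Int_absorb2)
  qed
  obtain C where C: "0 < C" "\<And>n t. 0 < n \<Longrightarrow> cdf_limit t \<le> level_cdf n t + C / lam ^ n"
    "\<And>n w. 0 < n \<Longrightarrow> w \<in> admissible n \<Longrightarrow> mass w \<le> C / lam ^ n" using limit_le_level_cdf[OF lam] by blast
  define A where "A = {..t} \<inter> {0..1}"
  have AM: "A \<in> sets M" unfolding A_def by (rule MI) simp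
  have bounds: "level_cdf n t \<le> measure M A" "measure M A \<le> level_cdf n t + C / lam ^ n"
    if n: "0 < n" for n
  proof -
    have union: "measure M (\<Union>w\<in>V. cyl w) = (\<Sum>w\<in>V. mass w)" if V: "V \<subseteq> admissible n" for V
    proof -
      have "measure M (\<Union>w\<in>V. cyl w) = (\<Sum>w\<in>V. measure M (cyl w))"
        using V MC n admissible_unique finite_admissible
        by (intro finite_measure_finite_Union) (auto simp: disjoint_family_on_def intro: finite_subset, blast)
      also have "\<dots> = (\<Sum>w\<in>V. mass w)" using V cyl n by (intro sum.cong) auto
      finally show ?thesis .
    qed
    have "level_cdf n t = measure M (\<Union>w\<in>{w \<in> admissible n. right_end w \<le> t}. cyl w)"
      unfolding level_cdf_def by (rule union[symmetric]) auto
    also have "\<dots> \<le> measure M A"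
    proof (rule finite_measure_mono)
      show "(\<Union>w\<in>{w \<in> admissible n. right_end w \<le> t}. cyl w) \<subseteq> A"
      proof (rule UN_least)
        fix w assume w: "w \<in> {w \<in> admissible n. right_end w \<le> t}"
        then have "cyl w \<subseteq> {0<..<1}" "cyl w = {left_end w<..<right_end w}"
          using admissible_unit(1)[of w n] admissible_ends(2)[of w n] n by blast+
        then show "cyl w \<subseteq> A" using w unfolding A_def by fastforce
      qed
    qed (rule AM)
    finally show "level_cdf n t \<le> measure M A" .
    define U where "U = (\<Union>w\<in>admissible n. cyl w)"
    have US: "U \<in> sets M" using MC[OF _ n] finite_admissible by (auto simp: U_def)
    have U1: "measure M U = 1" unfolding U_def using union[of "admissible n"] sum_mass_admissible[OF n] by simp
    have "A \<subseteq> space M" by (auto simp: M(2) A_def)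
    then have "measure M (A - U) \<le> measure M (space M - U)"
      using US AM by (intro finite_measure_mono) auto
    also have "\<dots> = 0" using prob_compl[OF US] U1 by simp
    finally have null: "measure M (A - U) = 0" using measure_nonneg[of M "A - U"] by linarith
    have "measure M A \<le> measure M (A - U) + measure M (A \<inter> U)"
      using measure_Un_le[of "A - U" M "A \<inter> U"] US AM
      by (simp add: Un_Diff_Int)
    also have "\<dots> = measure M (A \<inter> U)" using null by simp
    also have "\<dots> \<le> measure M (\<Union>w\<in>{w \<in> admissible n. right_end w \<le> t \<or> t \<in> cyl w}. cyl w)"
    proof (rule finite_measure_mono)
      show "A \<inter> U \<subseteq> (\<Union>w\<in>{w \<in> admissible n. right_end w \<le> t \<or> t \<in> cyl w}. cyl w)"
      proof
        fix s assume "s \<in> A \<inter> U"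
        then obtain w where w: "w \<in> admissible n" "s \<in> cyl w" "s \<le> t" by (auto simp: U_def A_def)
        then have "right_end w \<le> t \<or> t \<in> cyl w" using admissible_ends(2)[OF w(1) n] by auto
        then show "s \<in> (\<Union>w\<in>{w \<in> admissible n. right_end w \<le> t \<or> t \<in> cyl w}. cyl w)" using w by blast
      qed
    qed (use MC[OF _ n] finite_admissible in auto)
    also have "\<dots> = (\<Sum>w\<in>{w \<in> admissible n. right_end w \<le> t \<or> t \<in> cyl w}. mass w)" by (rule union) auto
    also have "\<dots> \<le> (\<Sum>w\<in>{w \<in> admissible n. right_end w \<le> t}. mass w) + (\<Sum>w\<in>{w \<in> admissible n. t \<in> cyl w}. mass w)"
      unfolding sum.inter_filter[OF finite_admissible] sum.distrib[symmetric]
      by (intro sum_mono) (auto simp: mass_nonneg_admissible[OF _ n])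
    also have "\<dots> \<le> level_cdf n t + C / lam ^ n"
      unfolding level_cdf_def[symmetric] using straddle_le[of "C / lam ^ n" n "\<lambda>w. t \<in> cyl w"] C n lam admissible_unique
      by (auto intro!: divide_nonneg_pos)
    finally show "measure M A \<le> level_cdf n t + C / lam ^ n" .
  qed
  have "(\<lambda>n. inverse (lam ^ n)) \<longlonglongrightarrow> 0" by (rule LIMSEQ_inverse_realpow_zero[OF lam])
  then have "(\<lambda>n. C * inverse (lam ^ Suc n)) \<longlonglongrightarrow> C * 0"
    by (intro tendsto_mult tendsto_const LIMSEQ_Suc)
  then have "(\<lambda>n. level_cdf (Suc n) t + C / lam ^ Suc n) \<longlonglongrightarrow> cdf_limit t + 0"
    by (intro tendsto_add level_cdf_tendsto) (simp add: divide_inverse)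
  then have "measure M A \<le> cdf_limit t"
    by (intro LIMSEQ_le_const[where a = "measure M A"]) (use bounds(2)[of "Suc _"] in \<open>auto\<close>)
  moreover have "cdf_limit t \<le> measure M A"
    by (rule LIMSEQ_le_const2[OF level_cdf_tendsto]) (use bounds(1)[of "Suc _"] in auto)
  ultimately show ?thesis by (simp add: A_def)
qed

theorem measure_unique_of_masses:
  assumes lam: "1 < lam"
    and M: "prob_space M" "space M = {0..1}" "sets M = sets (restrict_space borel {0..1})"
      "\<And>n w. 0 < n \<Longrightarrow> w \<in> admissible n \<Longrightarrow> measure M (cyl w) = mass w"
    and N: "prob_space N" "space N = {0..1}" "sets N = sets (restrict_space borel {0..1})"
      "\<And>n w. 0 < n \<Longrightarrow> w \<in> admissible n \<Longrightarrow> measure N (cyl w) = mass w"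
  shows "M = N"
proof -
  have id: "(\<lambda>t. t) \<in> M' \<rightarrow>\<^sub>M borel" if "sets M' = sets (restrict_space borel {0..1::real})" for M'
    using measurable_cong_sets[OF that refl, of borel] measurable_restrict_space1[of "\<lambda>t. t" borel borel "{0..1}"]
    by (metis measurable_ident_sets)
  define D where "D = (\<lambda>M'. distr M' borel (\<lambda>t::real. t))"
  have D: "finite_borel_measure (D M')" "cdf (D M') t = measure M' ({..t} \<inter> {0..1})"
    "\<And>A. A \<in> sets M' \<Longrightarrow> emeasure (D M') A = emeasure M' A"
    if M': "prob_space M'" "space M' = {0..1}" "sets M' = sets (restrict_space borel {0..1::real})" for M' t
  proof -
    interpret prob_space M' by fact
    interpret D: prob_space "D M'" unfolding D_def by (rule prob_space_distr[OF id[OF M'(3)]])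
    show "finite_borel_measure (D M')" by unfold_locales (simp add: D_def)
    show "cdf (D M') t = measure M' ({..t} \<inter> {0..1})"
      unfolding D_def cdf_def by (subst measure_distr[OF id[OF M'(3)]]) (auto simp: M'(2) vimage_def)
    fix A assume "A \<in> sets M'"
    then have "A \<in> sets borel" "A \<subseteq> {0..1}" by (auto simp: M'(3) sets_restrict_space_iff)
    then show "emeasure (D M') A = emeasure M' A"
      unfolding D_def by (subst emeasure_distr[OF id[OF M'(3)]]) (auto simp: M'(2) Int_absorb2)
  qed
  have "cdf (D M) = cdf (D N)"
    using cdf_of_cylinder_masses[OF lam M] cdf_of_cylinder_masses[OF lam N] D(2)[OF M(1-3)] D(2)[OF N(1-3)]
    by (simp add: fun_eq_iff)
  then have "D M = D N" using cdf_unique'[OF D(1)[OF M(1-3)] D(1)[OF N(1-3)]] by simp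
  then show ?thesis
    using D(3)[OF M(1-3)] D(3)[OF N(1-3)] M(3) N(3) by (intro measure_eqI) auto
qed

text \<open>The Stieltjes measure of the limit distribution function has no atoms, so open cylinders get the
  increments over their end points.\<close>

lemma mass_measure_exists:
  assumes lam: "1 < lam"
  shows "\<exists>M. prob_space M \<and> space M = {0..1} \<and> sets M = sets (restrict_space borel {0..1}) \<and>
     (\<forall>n w. 0 < n \<longrightarrow> w \<in> admissible n \<longrightarrow> measure M (cyl w) = mass w)"
proof -
  define N where "N = interval_measure cdf_limit"
  have cont: "continuous_on UNIV cdf_limit"
    using cdf_limit_continuous[OF lam] by (simp add: continuous_at_imp_continuous_on)
  have Icc: "emeasure N {a..b} = cdf_limit b - cdf_limit a" if "a \<le> b" for a b
    unfolding N_def by (rule emeasure_interval_measure_Icc[OF that]) (auto intro: monoD[OF cdf_limit_mono] cont)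
  have lim0: "cdf_limit 0 = 0" "cdf_limit 1 = 1"
    using level_cdf_tendsto[of 0] level_cdf_tendsto[of 1] level_cdf_left level_cdf_right by (simp_all add: LIMSEQ_const_iff)
  define M where "M = restrict_space N {0..1}"
  have sN: "sets N = sets borel" "space N = UNIV" by (simp_all add: N_def)
  have em: "emeasure M A = emeasure N A" if "A \<subseteq> {0..1}" for A
    unfolding M_def using that by (intro emeasure_restrict_space) (auto simp: sN)
  have spM: "space M = {0..1}" by (simp add: M_def space_restrict_space sN)
  have setM: "sets M = sets (restrict_space borel {0..1})"
    unfolding M_def by (simp add: sets_restrict_space sN)
  have "emeasure M (space M) = 1" using em[of "{0..1}"] Icc[of 0 1] by (simp add: spM lim0 one_ereal_def)
  then have pr: "prob_space M" by (rule prob_spaceI)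
  have "measure M (cyl w) = mass w" if w: "0 < n" "w \<in> admissible n" for n w
  proof -
    note ends = admissible_ends[OF w(2,1)]
    have "emeasure N {left_end w..right_end w} = emeasure N (cyl w \<union> {left_end w, right_end w})"
      using ends by (intro arg_cong[where f = "emeasure N"]) auto
    also have "\<dots> = emeasure N (cyl w)"
    proof (rule emeasure_Un_null_set)
      show "cyl w \<in> sets N" using admissible_cyl_sets[OF w(2)] by (simp add: sN)
      have "{a} \<in> null_sets N" for a using Icc[of a a] by (auto simp: null_sets_def sN)
      then have "{left_end w} \<union> {right_end w} \<in> null_sets N" by (intro null_sets.Un)
      then show "{left_end w, right_end w} \<in> null_sets N" by (simp add: insert_commute)
    qed
    finally have "emeasure N (cyl w) = ennreal (mass w)"
      using Icc[of "left_end w" "right_end w"] ends cdf_limit_cyl[OF w(2,1)] by simp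
    then have "emeasure M (cyl w) = ennreal (mass w)" using em[of "cyl w"] admissible_unit(1)[OF w(2,1)] by force
    then show ?thesis using mass_nonneg_admissible[OF w(2,1)] by (simp add: measure_def)
  qed
  then show ?thesis using pr spM setM by blast
qed

lemma admissible_path: "w \<noteq> [] \<Longrightarrow> set w \<subseteq> J \<Longrightarrow> successively nxt w \<Longrightarrow> 0 < length w \<and> w \<in> admissible (length w)"
  by (auto simp: admissible_def)

text \<open>Up to a null set the preimage of a cylinder is the union of the cylinders with one letter
  prepended, and the eigenvalue equation for \<open>u\<close> says that their masses add up. Invariance follows
  because cylinder masses determine a measure.\<close>

theorem parry_measure_exists:
  assumes lam: "1 < lam"
  shows "\<exists>M \<in> invariant_measures {0..1} f IJ. \<forall>n w. 0 < n \<longrightarrow> w \<in> admissible n \<longrightarrow> measure M (cyl w) = mass w"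
proof -
  obtain M where M: "prob_space M" "space M = {0..1}" "sets M = sets (restrict_space borel {0..1})"
     "\<And>n w. 0 < n \<Longrightarrow> w \<in> admissible n \<Longrightarrow> measure M (cyl w) = mass w"
    using mass_measure_exists[OF lam] by blast
  interpret prob_space M by fact
  have fM: "f \<in> M \<rightarrow>\<^sub>M M" using f_measurable measurable_cong_sets[OF M(3) M(3)] by simp
  have MC: "cyl w \<in> sets M" if "w \<in> admissible n" "0 < n" for w n
  proof -
    have "cyl w \<subseteq> {0..1}" using admissible_unit(1)[OF that] by auto
    then show ?thesis using admissible_cyl_sets[OF that(1)] by (simp add: M(3) sets_restrict_space_iff)
  qed
  have W1: "admissible 1 = (\<lambda>i. [i]) ` J" by (auto simp: admissible_def length_Suc_conv)
  define U where "U = (\<Union>i\<in>J. branch i)"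
  have branch_family: "disjoint_family_on branch J"
    unfolding disjoint_family_on_def using branch_disjoint[OF J_less J_less] by blast
  have iW: "[i] \<in> admissible 1" if "i \<in> J" for i using that W1 by auto
  have brM: "branch i \<in> sets M" if "i \<in> J" for i using MC[OF iW[OF that]] by simp
  have UM: "U \<in> sets M" unfolding U_def using brM finite_J by auto
  have "measure M U = (\<Sum>i\<in>J. measure M (branch i))"
    unfolding U_def by (rule finite_measure_finite_Union) (use brM finite_J branch_family in auto)
  also have "\<dots> = (\<Sum>i\<in>J. mass [i])" using M(4)[of 1 "[_]"] iW by (intro sum.cong) auto
  also have "\<dots> = 1" using uv_sum by (simp add: mass_def)
  finally have U1: "measure M U = 1" .
  have IJM: "IJ \<in> sets M"
  proof -
    have "{x i..x (Suc i)} \<subseteq> {0..1}" if "i \<in> J" for i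
      using x_unit[of i] x_unit[of "Suc i"] J_less[OF that] by auto
    then have "IJ \<subseteq> {0..1}" unfolding IJ_def by (rule UN_least)
    moreover have "IJ \<in> sets borel" unfolding IJ_def using finite_J by (intro sets.finite_UN) auto
    ultimately show ?thesis by (simp add: M(3) sets_restrict_space_iff)
  qed
  have "U \<subseteq> IJ" by (auto simp: U_def IJ_def branch_def)
  then have "1 \<le> measure M IJ" using finite_measure_mono[OF _ IJM, of U] U1 by simp
  then have "emeasure M IJ = 1" using prob_le_1[of IJ] by (simp add: emeasure_eq_measure)
  moreover have "distr M M f = M"
  proof (rule measure_unique_of_masses[OF lam _ _ _ _ M])
    show "prob_space (distr M M f)" by (rule prob_space_distr[OF fM])
    show "space (distr M M f) = {0..1}" "sets (distr M M f) = sets (restrict_space borel {0..1})"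
      by (simp_all add: M)
    fix n w assume n: "0 < n" "w \<in> admissible n"
    have "f -` cyl w \<inter> space M \<in> sets M" using fM MC[OF n(2,1)] by auto
    then have "measure M ((f -` cyl w \<inter> space M) - U) \<le> measure M (space M - U)"
      using UM by (intro finite_measure_mono) auto
    also have "\<dots> = 0" using prob_compl[OF UM] U1 by simp
    finally have "measure M ((f -` cyl w \<inter> space M) - U) = 0"
      using measure_nonneg[of M "(f -` cyl w \<inter> space M) - U"] by linarith
    then have pre: "measure M (f -` cyl w \<inter> space M) = measure M ((f -` cyl w \<inter> space M) \<inter> U)"
      using finite_measure_Diff'[OF \<open>f -` cyl w \<inter> space M \<in> sets M\<close> UM] by simp
    define V where "V = {i \<in> J. nxt i (hd w)}"
    have "(f -` cyl w \<inter> space M) \<inter> U = (\<Union>i\<in>V. cyl (i # w))"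
    proof (intro set_eqI iffI)
      fix t assume t: "t \<in> (f -` cyl w \<inter> space M) \<inter> U"
      then obtain i where i: "i \<in> J" "t \<in> branch i" "f t \<in> cyl w" by (auto simp: U_def)
      have w: "w \<noteq> []" "set w \<subseteq> J" using n by (auto simp: admissible_def)
      then have "hd w < m" using J_less hd_in_set[of w] by blast
      then have "nxt i (hd w)"
        using nxt_of_mem[of i "hd w" t] i J_less w(1) cyl_subset_branch[of w] by blast
      then show "t \<in> (\<Union>i\<in>V. cyl (i # w))" using i by (auto simp: V_def)
    next
      fix t assume "t \<in> (\<Union>i\<in>V. cyl (i # w))"
      then obtain i where "i \<in> J" "t \<in> branch i" "f t \<in> cyl w" by (auto simp: V_def)
      then show "t \<in> (f -` cyl w \<inter> space M) \<inter> U"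
        using branch_unit[OF J_less] by (force simp: U_def M(2))
    qed
    moreover have VW: "i # w \<in> admissible (Suc n)" if "i \<in> V" for i
      using that n by (cases w) (auto simp: V_def admissible_def)
    moreover have "measure M (\<Union>i\<in>V. cyl (i # w)) = (\<Sum>i\<in>V. measure M (cyl (i # w)))"
    proof (rule finite_measure_finite_Union)
      show "finite V" using finite_J by (simp add: V_def)
      show "(\<lambda>i. cyl (i # w)) ` V \<subseteq> events" using MC[OF VW] by auto
      have "disjoint_family_on branch V" using branch_family by (auto simp: disjoint_family_on_def V_def)
      then show "disjoint_family_on (\<lambda>i. cyl (i # w)) V" by (fastforce simp: disjoint_family_on_def)
    qed
    moreover have "\<dots> = (\<Sum>i\<in>V. mass (i # w))" using M(4)[OF _ VW] by (intro sum.cong) auto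
    moreover have "\<dots> = mass w" unfolding V_def by (rule mass_Cons[OF n(2,1)])
    ultimately show "measure (distr M M f) (cyl w) = mass w"
      using pre measure_distr[OF fM MC[OF n(2,1)]] by simp
  qed
  ultimately show ?thesis using M fM prob_space_axioms by (auto simp: invariant_measures_def intro!: bexI[of _ M])
qed

lemma perron_measureI: "M \<in> invariant_measures {0..1} f IJ \<Longrightarrow> perron_measure f m x c lo hi J u v lam M"
  by unfold_locales

theorem topological_entropy_le: "topological_entropy {0..1} f IJ \<le> ereal (max 0 (ln lam))"
  unfolding topological_entropy_def
proof (rule SUP_least)
  fix M assume "M \<in> invariant_measures {0..1} f IJ"
  then interpret perron_measure f m x c lo hi J u v lam M by (rule perron_measureI)
  have "weight * ln lam \<le> max 0 (ln lam)"
    using weight_range by (cases "0 \<le> ln lam") (auto simp: mult_left_le_one_le mult_nonneg_nonpos)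
  then show "measure_entropy M f \<le> ereal (max 0 (ln lam))"
    using entropy_rate_lab_le by (simp only: measure_entropy_eq ereal_less_eq)
qed

text \<open>The entropy of every invariant measure is at most \<open>max 0 (ln lam)\<close>; so positive topological entropy
  means \<open>lam > 1\<close>, where the Parry measure attains the bound and is the only measure that does.\<close>

theorem mme_is_parry:
  assumes h: "0 < topological_entropy {0..1} f IJ"
  shows "1 < lam" "topological_entropy {0..1} f IJ = ereal (ln lam)"
    "mme {0..1} f IJ \<in> invariant_measures {0..1} f IJ"
    "\<And>n w. 0 < n \<Longrightarrow> w \<in> admissible n \<Longrightarrow> measure (mme {0..1} f IJ) (cyl w) = mass w"
proof -
  have "0 < ereal (max 0 (ln lam))" using h topological_entropy_le by (rule less_le_trans)
  then have "0 < max 0 (ln lam)" by (simp only: ereal_less)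
  then have "0 < ln lam" by simp
  then show lam: "1 < lam" using lam_pos by simp
  obtain M where M: "M \<in> invariant_measures {0..1} f IJ"
    "\<And>n w. 0 < n \<Longrightarrow> w \<in> admissible n \<Longrightarrow> measure M (cyl w) = mass w" using parry_measure_exists[OF lam] by blast
  have "measure_entropy M f = ereal (ln lam)"
  proof -
    interpret perron_measure f m x c lo hi J u v lam M using M(1) by (rule perron_measureI)
    have "entropy_rate M f lab = ln lam"
      by (rule entropy_rate_of_mass) (use M(2) admissible_path in blast)
    then show ?thesis by (simp add: measure_entropy_eq)
  qed
  moreover have "measure_entropy M f \<le> topological_entropy {0..1} f IJ"
    unfolding topological_entropy_def using M(1) by (rule SUP_upper)
  ultimately show top: "topological_entropy {0..1} f IJ = ereal (ln lam)"
    using topological_entropy_le \<open>0 < ln lam\<close> by (simp add: max_def split: if_splits)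
  then have Mmax: "is_mme {0..1} f IJ M" using M(1) \<open>measure_entropy M f = ereal (ln lam)\<close> by (simp add: is_mme_def)
  moreover have "N = M" if N: "is_mme {0..1} f IJ N" for N
  proof -
    have Ninv: "N \<in> invariant_measures {0..1} f IJ" using N by (simp add: is_mme_def)
    interpret N: perron_measure f m x c lo hi J u v lam N using Ninv by (rule perron_measureI)
    interpret M: perron_measure f m x c lo hi J u v lam M using M(1) by (rule perron_measureI)
    have "ln lam \<le> entropy_rate N f lab" using N top by (simp add: is_mme_def N.measure_entropy_eq)
    then have "measure N (cyl w) = mass w" if "0 < n" "w \<in> admissible n" for n w
      using N.maximal_entropy_cylinders[OF lam, of w] that by (auto simp: admissible_def)
    then show ?thesis
      by (intro measure_unique_of_masses[OF lam N.prob_space_axioms N.space_M N.sets_M _ M.prob_space_axioms M.space_M M.sets_M M(2)])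
  qed
  ultimately have "mme {0..1} f IJ = M" unfolding mme_def by (rule the_equality)
  then show "mme {0..1} f IJ \<in> invariant_measures {0..1} f IJ"
    "\<And>n w. 0 < n \<Longrightarrow> w \<in> admissible n \<Longrightarrow> measure (mme {0..1} f IJ) (cyl w) = mass w" using M by simp_all
qed

end

section \<open>Branch data and transition matrix of the given map\<close>

lemma mono_interval_image:
  fixes g :: "real \<Rightarrow> real"
  assumes ab: "a < b" and cont: "continuous_on {a..b} g" and inj: "inj_on g {a<..<b}"
    and mono: "mono_on {a..b} g"
  shows "g a < g b \<and> g ` {a..b} = {g a..g b} \<and> g ` {a<..<b} = {g a<..<g b}"
proof -
  have strict: "g s < g t" if st: "a \<le> s" "s < t" "t \<le> b" for s t
  proof -
    obtain s' where s': "s < s'" "s' < t" using dense st by blast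
    obtain t' where t': "s' < t'" "t' < t" using dense s' by blast
    have "g s \<le> g s'" "g s' \<le> g t'" "g t' \<le> g t"
      using mono s' t' st by (auto simp: mono_on_def)
    moreover have "s' \<in> {a<..<b}" "t' \<in> {a<..<b}" "s' \<noteq> t'" using s' t' st by auto
    then have "g s' \<noteq> g t'" using inj by (auto simp: inj_on_def)
    ultimately show ?thesis by linarith
  qed
  have ivt: "\<exists>t\<in>{a..b}. g t = y" if "g a \<le> y" "y \<le> g b" for y
    using IVT'[of g a y b] ab cont that by force
  have ends: "a < t \<and> t < b" if "t \<in> {a..b}" "g a < g t" "g t < g b" for t
    using that by (metis atLeastAtMost_iff less_irrefl order_le_less)
  have 1: "g ` {a..b} = {g a..g b}"
  proof (intro set_eqI iffI)
    fix y assume "y \<in> g ` {a..b}"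
    then show "y \<in> {g a..g b}" using mono ab by (auto simp: mono_on_def)
  next
    fix y assume "y \<in> {g a..g b}"
    then show "y \<in> g ` {a..b}" using ivt by force
  qed
  have 2: "g ` {a<..<b} = {g a<..<g b}"
  proof (intro set_eqI iffI)
    fix y assume "y \<in> g ` {a<..<b}"
    then show "y \<in> {g a<..<g b}" using strict by auto
  next
    fix y assume y: "y \<in> {g a<..<g b}"
    then obtain t where "t \<in> {a..b}" "g t = y" using ivt[of y] by auto
    then show "y \<in> g ` {a<..<b}" using ends[of t] y by auto
  qed
  show ?thesis using 1 2 strict[of a b] ab by simp
qed

text \<open>Injectivity inside makes a weakly monotone map strictly monotone, so the end points have extreme
  values that are not attained inside.\<close>

lemma monotone_interval_image:
  fixes g :: "real \<Rightarrow> real"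
  assumes ab: "a < b" and cont: "continuous_on {a..b} g" and inj: "inj_on g {a<..<b}"
    and mono: "mono_on {a..b} g \<or> antimono_on {a..b} g"
  shows "\<exists>A B. A < B \<and> g ` {a..b} = {A..B} \<and> g ` {a<..<b} = {A<..<B} \<and> g a \<in> {A, B} \<and> g b \<in> {A, B}"
  using mono
proof
  assume "mono_on {a..b} g"
  then show ?thesis using mono_interval_image[OF ab cont inj] by blast
next
  assume anti: "antimono_on {a..b} g"
  have "mono_on {a..b} (\<lambda>t. - g t)" using anti by (auto simp: monotone_on_def)
  moreover have "inj_on (\<lambda>t. - g t) {a<..<b}" using inj by (auto simp: inj_on_def)
  ultimately have *: "- g a < - g b \<and> (\<lambda>t. - g t) ` {a..b} = {- g a..- g b} \<and> (\<lambda>t. - g t) ` {a<..<b} = {- g a<..<- g b}"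
    using mono_interval_image[OF ab, of "\<lambda>t. - g t"] cont by (auto intro: continuous_on_minus)
  have neg: "g ` S = uminus ` ((\<lambda>t. - g t) ` S)" for S by (simp add: image_image)
  have "g ` {a..b} = {g b..g a}" "g ` {a<..<b} = {g b<..<g a}"
    unfolding neg using * by simp_all
  then show ?thesis using * by (intro exI[of _ "g b"] exI[of _ "g a"]) auto
qed

lemma inj_on_of_deriv_nonzero:
  fixes f :: "real \<Rightarrow> real"
  assumes "\<And>t. t \<in> {a<..<b} \<Longrightarrow> f differentiable (at t)" "\<And>t. t \<in> {a<..<b} \<Longrightarrow> deriv f t \<noteq> 0"
  shows "inj_on f {a<..<b}"
proof -
  have "f s \<noteq> f t" if st: "s \<in> {a<..<b}" "t \<in> {a<..<b}" "s < t" for s t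
  proof -
    have "(f has_real_derivative deriv f z) (at z)" if "s \<le> z" "z \<le> t" for z
      using assms(1)[of z] st that by (simp add: DERIV_deriv_iff_real_differentiable)
    then obtain z where z: "s < z" "z < t" "f t - f s = (t - s) * deriv f z"
      using MVT2[OF st(3), of f "deriv f"] by auto
    then show ?thesis using assms(2)[of z] st by auto
  qed
  then show ?thesis by (metis inj_onI linorder_neqE_linordered_idom)
qed

text \<open>The image of a closed branch is an interval and a union of partition intervals, so its end points
  are knots. The value at a knot is a one-sided limit, hence an end point of such an image.\<close>

theorem markov_branches_of_map:
  assumes "expanding_markov_map 0 1 f m x"
  shows "\<exists>c lo hi. markov_branches f m x c lo hi"
proof -
  have unit: "f ` {0..1} \<subseteq> {0..1}" and m: "0 < m" and x: "strict_mono_on {..m} x" "x 0 = 0" "x m = 1"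
    and branch: "\<forall>i<m. \<exists>g. continuous_on {x i..x (Suc i)} g \<and>
        (mono_on {x i..x (Suc i)} g \<or> antimono_on {x i..x (Suc i)} g) \<and>
        g ` {x i..x (Suc i)} \<subseteq> {0..1} \<and>
        (\<forall>t\<in>{x i<..<x (Suc i)}. f t = g t) \<and>
        (\<exists>V\<subseteq>{..<m}. g ` {x i..x (Suc i)} = (\<Union>j\<in>V. {x j..x (Suc j)}))"
    and lim: "\<forall>i\<le>m. (i < m \<and> (f \<longlongrightarrow> f (x i)) (at_right (x i))) \<or> (0 < i \<and> (f \<longlongrightarrow> f (x i)) (at_left (x i)))"
    using assms unfolding expanding_markov_map_def by - (elim conjE, assumption)+
  have "\<exists>c>1. \<forall>i<m. f C1_differentiable_on {x i<..<x (Suc i)} \<and> (\<forall>t\<in>{x i<..<x (Suc i)}. \<bar>deriv f t\<bar> \<ge> c)"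
    using assms unfolding expanding_markov_map_def by (elim conjE)
  then obtain c where c: "1 < c" "\<And>i. i < m \<Longrightarrow> f C1_differentiable_on {x i<..<x (Suc i)}"
     "\<And>i t. i < m \<Longrightarrow> t \<in> {x i<..<x (Suc i)} \<Longrightarrow> c \<le> \<bar>deriv f t\<bar>"
    by metis
  have diff: "f differentiable (at t)" if "i < m" "t \<in> {x i<..<x (Suc i)}" for i t
    using c(2)[OF that(1)] that(2) unfolding C1_differentiable_on_eq by blast
  have less: "x i < x k" if "i < k" "k \<le> m" for i k using x(1) that by (auto simp: strict_mono_on_def)
  define Q where "Q i l h \<longleftrightarrow> l < h \<and> h \<le> m \<and> f ` {x i<..<x (Suc i)} = {x l<..<x h} \<and>
       (\<exists>y\<in>{x l, x h}. (f \<longlongrightarrow> y) (at_right (x i))) \<and> (\<exists>y\<in>{x l, x h}. (f \<longlongrightarrow> y) (at_left (x (Suc i))))"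
    for i l h
  have main: "\<exists>l h. Q i l h" if i: "i < m" for i
  proof -
    obtain g V where g: "continuous_on {x i..x (Suc i)} g"
        "mono_on {x i..x (Suc i)} g \<or> antimono_on {x i..x (Suc i)} g"
        "\<forall>t\<in>{x i<..<x (Suc i)}. f t = g t"
        "V \<subseteq> {..<m}" "g ` {x i..x (Suc i)} = (\<Union>j\<in>V. {x j..x (Suc j)})"
      using branch i by blast
    have xi: "x i < x (Suc i)" using less i by simp
    have "inj_on f {x i<..<x (Suc i)}"
      by (rule inj_on_of_deriv_nonzero) (use diff[OF i] c(1) c(3)[OF i] in force)+
    then have inj: "inj_on g {x i<..<x (Suc i)}" using g(3) by (auto simp: inj_on_def)
    obtain A B where AB: "A < B" "g ` {x i..x (Suc i)} = {A..B}" "g ` {x i<..<x (Suc i)} = {A<..<B}"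
       "g (x i) \<in> {A, B}" "g (x (Suc i)) \<in> {A, B}"
      using monotone_interval_image[OF xi g(1) inj g(2)] by blast
    have un: "{A..B} = (\<Union>j\<in>V. {x j..x (Suc j)})" using AB(2) g(5) by simp
    have Vle: "x k \<in> {A..B} \<and> x (Suc k) \<in> {A..B}" if "k \<in> V" for k
      unfolding un using that less[of k "Suc k"] g(4) by (auto intro!: bexI[of _ k] less_imp_le)
    have "A \<in> (\<Union>j\<in>V. {x j..x (Suc j)})" unfolding un[symmetric] using AB(1) by simp
    then obtain l where l: "l \<in> V" "x l \<le> A" by auto
    have A: "A = x l" using Vle[OF l(1)] l(2) by auto
    have "B \<in> (\<Union>j\<in>V. {x j..x (Suc j)})" unfolding un[symmetric] using AB(1) by simp
    then obtain h where h: "h \<in> V" "B \<le> x (Suc h)" by auto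
    have B: "B = x (Suc h)" using Vle[OF h(1)] h(2) by auto
    have hm: "Suc h \<le> m" "l < m" using h l g(4) by auto
    have lh: "l < Suc h"
    proof (rule ccontr)
      assume "\<not> l < Suc h"
      then have "x (Suc h) \<le> x l" using less[of "Suc h" l] hm by (cases "Suc h = l") auto
      then show False using AB(1) A B by simp
    qed
    have "f ` {x i<..<x (Suc i)} = g ` {x i<..<x (Suc i)}" using g(3) by (intro image_cong) auto
    then have im: "f ` {x i<..<x (Suc i)} = {x l<..<x (Suc h)}" using AB(3) A B by simp
    have "(g \<longlongrightarrow> g (x i)) (at (x i) within {x i..x (Suc i)})"
      using g(1) xi by (auto simp: continuous_on_def)
    then have gr: "(g \<longlongrightarrow> g (x i)) (at_right (x i))" using xi at_within_Icc_at_right by metis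
    have fr: "(f \<longlongrightarrow> g (x i)) (at_right (x i))"
      by (rule Lim_transform_eventually[OF gr]) (use g(3) xi in \<open>auto simp: eventually_at_right intro!: exI[of _ "x (Suc i)"]\<close>)
    have "(g \<longlongrightarrow> g (x (Suc i))) (at (x (Suc i)) within {x i..x (Suc i)})"
      using g(1) xi by (auto simp: continuous_on_def)
    then have gl: "(g \<longlongrightarrow> g (x (Suc i))) (at_left (x (Suc i)))" using xi at_within_Icc_at_left by metis
    have fl: "(f \<longlongrightarrow> g (x (Suc i))) (at_left (x (Suc i)))"
      by (rule Lim_transform_eventually[OF gl]) (use g(3) xi in \<open>auto simp: eventually_at_left intro!: exI[of _ "x i"]\<close>)
    have "Q i l (Suc h)"
      unfolding Q_def
    proof (intro conjI)
      show "\<exists>y\<in>{x l, x (Suc h)}. (f \<longlongrightarrow> y) (at_right (x i))"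
        using fr AB(4) A B by (intro bexI[of _ "g (x i)"]) simp_all
      show "\<exists>y\<in>{x l, x (Suc h)}. (f \<longlongrightarrow> y) (at_left (x (Suc i)))"
        using fl AB(5) A B by (intro bexI[of _ "g (x (Suc i))"]) simp_all
    qed (use lh hm(1) im in auto)
    then show ?thesis by blast
  qed
  then obtain lo hi where Q: "\<And>i. i < m \<Longrightarrow> Q i (lo i) (hi i)" by metis
  have lohi: "lo i < hi i" "hi i \<le> m" "f ` {x i<..<x (Suc i)} = {x (lo i)<..<x (hi i)}"
      "\<exists>y\<in>{x (lo i), x (hi i)}. (f \<longlongrightarrow> y) (at_right (x i))"
      "\<exists>y\<in>{x (lo i), x (hi i)}. (f \<longlongrightarrow> y) (at_left (x (Suc i)))" if "i < m" for i
    using Q[OF that] unfolding Q_def by blast+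
  have knot: "\<exists>k\<le>m. f (x i) = x k" if i: "i \<le> m" for i
  proof -
    consider "i < m" "(f \<longlongrightarrow> f (x i)) (at_right (x i))" | "0 < i" "(f \<longlongrightarrow> f (x i)) (at_left (x i))"
      using lim i by blast
    then show ?thesis
    proof cases
      case 1
      then obtain y where y: "y \<in> {x (lo i), x (hi i)}" "(f \<longlongrightarrow> y) (at_right (x i))" using lohi(4) by blast
      have "f (x i) = y" by (rule tendsto_unique[OF _ 1(2) y(2)]) simp
      moreover have "lo i \<le> m" "hi i \<le> m" using lohi(1,2)[OF 1(1)] by linarith+
      ultimately show ?thesis using y(1) by blast
    next
      case 2
      then obtain k where k: "i = Suc k" by (cases i) auto
      then have km: "k < m" using i by simp
      then obtain y where y: "y \<in> {x (lo k), x (hi k)}" "(f \<longlongrightarrow> y) (at_left (x i))" using lohi(5)[OF km] k by blast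
      have "f (x i) = y" by (rule tendsto_unique[OF _ 2(2) y(2)]) simp
      moreover have "lo k \<le> m" "hi k \<le> m" using lohi(1,2)[OF km] by linarith+
      ultimately show ?thesis using y(1) by blast
    qed
  qed
  have "markov_branches f m x c lo hi"
  proof
    show "f t \<in> {0..1}" if "t \<in> {0..1}" for t using unit that by blast
  qed (use m x knot lohi(1-3) c(1,3) diff in auto)
  then show ?thesis by blast
qed

context markov_branches
begin

definition edges :: "(nat \<times> nat) set" where "edges = {(i, l). i < m \<and> nxt i l}"

lemma knot_pow: "i \<le> m \<Longrightarrow> \<exists>k\<le>m. (f ^^ n) (x i) = x k"
proof (induction n)
  case (Suc n)
  then obtain k where "k \<le> m" "(f ^^ n) (x i) = x k" by blast
  then show ?case using f_knot[of k] by simp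
qed auto

lemma path_of_orbit:
  assumes "i < m" "l < m" "t \<in> branch i" "(f ^^ Suc k) t \<in> branch l"
  shows "(i, l) \<in> edges\<^sup>+"
  using assms
proof (induction k arbitrary: i t)
  case 0
  then show ?case using nxt_of_mem[of i l t] by (auto simp: edges_def)
next
  case (Suc k)
  have t: "t \<in> {0..1}" using branch_unit[OF Suc.prems(1)] Suc.prems(3) by auto
  have ft: "(f ^^ Suc k) (f t) \<in> branch l" using Suc.prems(4) by (simp add: funpow_swap1)
  from f_unit[OF t] show ?case
  proof (rule unit_cases)
    fix i' assume i': "i' < m" "f t \<in> branch i'"
    then have "(i', l) \<in> edges\<^sup>+" using Suc.IH[OF i'(1) Suc.prems(2) i'(2) ft] by blast
    moreover have "(i, i') \<in> edges" using nxt_of_mem[OF Suc.prems(1) i'(1) Suc.prems(3) i'(2)] Suc.prems(1) by (simp add: edges_def)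
    ultimately show ?thesis by (rule trancl_into_trancl2[rotated])
  next
    fix k' assume "k' \<le> m" "f t = x k'"
    then obtain k'' where "k'' \<le> m" "(f ^^ Suc k) (f t) = x k''" using knot_pow by metis
    then show ?thesis using ft branch_not_knot[OF Suc.prems(2)] by metis
  qed
qed

lemma orbit_of_path: "(i, l) \<in> edges\<^sup>+ \<Longrightarrow> \<exists>k. \<exists>t\<in>branch i. (f ^^ Suc k) t \<in> branch l"
proof (induction rule: converse_trancl_induct)
  case (base i)
  then have i: "i < m" "nxt i l" by (auto simp: edges_def)
  obtain y where "y \<in> branch l" using branch_nonempty[OF nxt_less[OF i]] by blast
  then obtain t where "t \<in> branch i" "f t = y" using nxt_subset[OF i] by auto
  then have "(f ^^ Suc 0) t \<in> branch l" using \<open>y \<in> branch l\<close> by simp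
  then show ?case using \<open>t \<in> branch i\<close> by blast
next
  case (step i z)
  then obtain k y where y: "y \<in> branch z" "(f ^^ Suc k) y \<in> branch l" by blast
  have "i < m" "nxt i z" using step(1) by (auto simp: edges_def)
  then obtain t where "t \<in> branch i" "f t = y" using nxt_subset y(1) by blast
  then have "(f ^^ Suc (Suc k)) t \<in> branch l" using y(2) by (simp add: funpow_swap1)
  then show ?case using \<open>t \<in> branch i\<close> by blast
qed

text \<open>Knots are mapped to knots, so an orbit that ends in an open branch has avoided all knots, and its
  labels form a path.\<close>

lemma leads_to_iff:
  assumes "i < m" "l < m" shows "leads_to f x i l \<longleftrightarrow> (i, l) \<in> edges\<^sup>+"
proof
  assume "leads_to f x i l"
  then obtain k t where k: "1 \<le> k" "t \<in> {x i..x (Suc i)}" "(f ^^ k) t \<in> branch l"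
    unfolding leads_to_def branch_def by blast
  obtain k' where k': "k = Suc k'" using k(1) by (cases k) auto
  have "t \<noteq> x i'" if "i' \<le> m" for i'
  proof
    assume "t = x i'"
    then obtain k'' where "k'' \<le> m" "(f ^^ k) t = x k''" using knot_pow[OF \<open>i' \<le> m\<close>] by blast
    then show False using k(3) branch_not_knot[OF assms(2)] by simp
  qed
  from this[of i] this[of "Suc i"] have "t \<in> branch i" using k(2) assms(1) by (auto simp: branch_def)
  then show "(i, l) \<in> edges\<^sup>+" using path_of_orbit[OF assms] k(3) k' by blast
next
  assume "(i, l) \<in> edges\<^sup>+"
  then obtain k t where "t \<in> branch i" "(f ^^ Suc k) t \<in> branch l" using orbit_of_path by blast
  then show "leads_to f x i l" unfolding leads_to_def branch_def
    by (intro exI[of _ "Suc k"] conjI) (auto simp del: funpow.simps)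
qed

text \<open>A path between two members of the communicating class stays inside the class, so the transition
  matrix restricted to the class is irreducible.\<close>

lemma perron_data_exists:
  assumes j: "j < m" "(j, j) \<in> edges\<^sup>+"
  defines "J \<equiv> {i. i < m \<and> leads_to f x j i \<and> leads_to f x i j}"
  shows "\<exists>u v lam. perron_data f m x c lo hi J u v lam"
proof -
  have J: "i \<in> J \<longleftrightarrow> i < m \<and> (j, i) \<in> edges\<^sup>+ \<and> (i, j) \<in> edges\<^sup>+" for i
    using leads_to_iff j(1) by (auto simp: J_def)
  have jJ: "j \<in> J" using j J by blast
  have graph: "mat_graph J adj = edges \<inter> J \<times> J"
    using J by (auto simp: mat_graph_def edges_def adj_def split: if_splits)
  have inJ: "l \<in> J \<Longrightarrow> i \<in> J \<Longrightarrow> (i, l) \<in> (mat_graph J adj)\<^sup>+" if "(i, l) \<in> edges\<^sup>+" for i l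
    using that
  proof (induction rule: converse_trancl_induct)
    case (base i)
    then show ?case by (auto simp: graph)
  next
    case (step i z)
    have "z < m" using step(1) nxt_less by (auto simp: edges_def)
    moreover have "(j, z) \<in> edges\<^sup>+" using step J by (meson trancl_into_trancl)
    moreover have "(z, j) \<in> edges\<^sup>+" using step J by (meson trancl_trans)
    ultimately have "z \<in> J" using J by blast
    then have "(z, l) \<in> (mat_graph J adj)\<^sup>+" "(i, z) \<in> mat_graph J adj" using step by (auto simp: graph)
    then show ?case by (rule trancl_into_trancl2[rotated])
  qed
  have irr: "\<forall>i\<in>J. \<forall>l\<in>J. (i, l) \<in> (mat_graph J adj)\<^sup>+"
    using inJ J by (meson trancl_trans)
  have fin: "finite J" "J \<noteq> {}" using jJ by (auto simp: J_def)
  have A: "\<forall>i\<in>J. \<forall>l\<in>J. 0 \<le> adj i l" by (simp add: adj_def)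
  have irr': "\<forall>i\<in>J. \<forall>l\<in>J. (i, l) \<in> (mat_graph J adj)\<^sup>*" using irr by (auto dest: trancl_into_rtrancl)
  obtain u v t where uv: "\<forall>i\<in>J. 0 < u i" "\<forall>i\<in>J. 0 < v i" "0 \<le> t" "(\<Sum>i\<in>J. u i * v i) = 1"
    "\<forall>i\<in>J. (\<Sum>k\<in>J. adj i k * v k) = t * v i" "\<forall>k\<in>J. (\<Sum>i\<in>J. u i * adj i k) = t * u k"
    by (rule perron_frobenius_pair[OF fin A irr'])
  have "0 < t"
  proof -
    obtain l where l: "(j, l) \<in> mat_graph J adj" using irr jJ by (meson tranclD)
    then have "0 < adj j l * v l" "l \<in> J" using uv(2) by (auto simp: mat_graph_def)
    then have "0 < (\<Sum>k\<in>J. adj j k * v k)"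
      using A jJ uv(2) fin by (intro sum_pos2[of J l]) (auto intro: mult_nonneg_nonneg less_imp_le)
    then have "0 < t * v j" using uv(5) jJ by simp
    moreover have "0 < v j" using uv(2) jJ by blast
    ultimately show ?thesis by (simp add: zero_less_mult_iff)
  qed
  have "J \<subseteq> {..<m}" by (auto simp: J_def)
  then have "perron_data f m x c lo hi J u v t"
    unfolding perron_data_def perron_data_axioms_def
    using markov_branches_axioms fin irr' uv \<open>0 < t\<close> by blast
  then show ?thesis by blast
qed

end

section \<open>One-sided points and itineraries\<close>

context markov_branches
begin

text \<open>The one-sided points at knots are coded by an interval and a side: \<open>(i, Plus)\<close> is the left end of
  interval \<open>i\<close> approached from inside, and \<open>(i, Minus)\<close> is its right end.\<close>

fun end_point :: "nat \<times> side \<Rightarrow> real" where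
  "end_point (i, Plus) = x i"
| "end_point (i, Minus) = x (Suc i)"

fun germ :: "nat \<times> side \<Rightarrow> real \<Rightarrow> real set" where
  "germ (i, Plus) d = {x i<..<x i + d}"
| "germ (i, Minus) d = {x (Suc i) - d<..<x (Suc i)}"

fun opposite :: "side \<Rightarrow> side" where
  "opposite Plus = Minus"
| "opposite Minus = Plus"

definition incr :: "nat \<Rightarrow> bool" where "incr i \<longleftrightarrow> (\<forall>s\<in>branch i. \<forall>t\<in>branch i. s < t \<longrightarrow> f s < f t)"
definition decr :: "nat \<Rightarrow> bool" where "decr i \<longleftrightarrow> (\<forall>s\<in>branch i. \<forall>t\<in>branch i. s < t \<longrightarrow> f t < f s)"

text \<open>The direction of \<open>f\<close> on a pair of points agrees with the direction on any larger pair, by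
  betweenness.\<close>

lemma pair_order:
  assumes i: "i < m" and "a \<in> branch i" "b \<in> branch i" "a \<le> s" "s < t" "t \<le> b"
  shows "f s < f t \<longleftrightarrow> f a < f b"
proof -
  have st: "s \<in> branch i" "t \<in> branch i" using assms by (auto simp: branch_def)
  have 1: "f s < f t \<longleftrightarrow> f a < f t"
    using f_between[OF i assms(2) st(2), of s] assms by (cases "a = s") auto
  have 2: "f a < f t \<longleftrightarrow> f a < f b"
    using f_between[OF i assms(2,3), of t] assms by (cases "t = b") auto
  show ?thesis using 1 2 by blast
qed

lemma incr_or_decr:
  assumes i: "i < m" shows "incr i \<or> decr i"
proof (rule ccontr)
  assume "\<not> (incr i \<or> decr i)"
  then obtain s t s' t' where st: "s \<in> branch i" "t \<in> branch i" "s < t" "\<not> f s < f t"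
    "s' \<in> branch i" "t' \<in> branch i" "s' < t'" "\<not> f t' < f s'"
    unfolding incr_def decr_def by blast
  have "f s' \<noteq> f t'" using inj_onD[OF inj_branch[OF i], of s' t'] st by auto
  then have "f s' < f t'" using st by linarith
  have ab: "min s s' \<in> branch i" "max t t' \<in> branch i" using st by (auto simp: min_def max_def)
  show False
    using pair_order[OF i ab, of s t] pair_order[OF i ab, of s' t'] st \<open>f s' < f t'\<close> by simp
qed

text \<open>On this side of the branch \<open>f\<close> approaches the lower end of its image.\<close>

lemma lower_germ:
  assumes i: "i < m" and dir: "incr i \<and> s = Plus \<or> decr i \<and> s = Minus" and e: "0 < e"
  shows "\<exists>d>0. \<forall>t\<in>germ (i, s) d. t \<in> branch i \<and> f t \<in> {x (lo i)<..<x (lo i) + e}"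
proof -
  have "x (lo i) < min (x (lo i) + e) (x (hi i))" using e x_less lo_hi[OF i] by simp
  then obtain y where y: "x (lo i) < y" "y < min (x (lo i) + e) (x (hi i))" using dense by blast
  then have "y \<in> f ` branch i" using f_branch[OF i] by (simp add: branch_def)
  then obtain t0 where t0: "t0 \<in> branch i" "f t0 = y" by blast
  have im: "x (lo i) < f t" if "t \<in> branch i" for t using f_branch[OF i] that by (auto simp: branch_def)
  show ?thesis
  proof (cases s)
    case Plus
    then have "incr i" using dir by auto
    have "t \<in> branch i \<and> f t < f t0" if "t \<in> germ (i, s) (t0 - x i)" for t
    proof -
      have "x i < t" "t < t0" using that Plus by auto
      then have "t \<in> branch i" using t0 by (auto simp: branch_def)
      then show ?thesis using \<open>incr i\<close> t0(1) \<open>t < t0\<close> by (simp add: incr_def)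
    qed
    then show ?thesis using t0 y im by (intro exI[of _ "t0 - x i"]) (force simp: branch_def)
  next
    case Minus
    then have "decr i" using dir by auto
    have "t \<in> branch i \<and> f t < f t0" if "t \<in> germ (i, s) (x (Suc i) - t0)" for t
    proof -
      have "t0 < t" "t < x (Suc i)" using that Minus by auto
      then have "t \<in> branch i" using t0 by (auto simp: branch_def)
      then show ?thesis using \<open>decr i\<close> t0(1) \<open>t0 < t\<close> by (simp add: decr_def)
    qed
    then show ?thesis using t0 y im by (intro exI[of _ "x (Suc i) - t0"]) (force simp: branch_def)
  qed
qed

lemma upper_germ:
  assumes i: "i < m" and dir: "incr i \<and> s = Minus \<or> decr i \<and> s = Plus" and e: "0 < e"
  shows "\<exists>d>0. \<forall>t\<in>germ (i, s) d. t \<in> branch i \<and> f t \<in> {x (hi i) - e<..<x (hi i)}"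
proof -
  have "max (x (hi i) - e) (x (lo i)) < x (hi i)" using e x_less lo_hi[OF i] by simp
  then obtain y where y: "max (x (hi i) - e) (x (lo i)) < y" "y < x (hi i)" using dense by blast
  then have "y \<in> f ` branch i" using f_branch[OF i] by (simp add: branch_def)
  then obtain t0 where t0: "t0 \<in> branch i" "f t0 = y" by blast
  have im: "f t < x (hi i)" if "t \<in> branch i" for t using f_branch[OF i] that by (auto simp: branch_def)
  show ?thesis
  proof (cases s)
    case Plus
    then have "decr i" using dir by auto
    have "t \<in> branch i \<and> f t0 < f t" if "t \<in> germ (i, s) (t0 - x i)" for t
    proof -
      have "x i < t" "t < t0" using that Plus by auto
      then have "t \<in> branch i" using t0 by (auto simp: branch_def)
      then show ?thesis using \<open>decr i\<close> t0(1) \<open>t < t0\<close> by (simp add: decr_def)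
    qed
    then show ?thesis using t0 y im by (intro exI[of _ "t0 - x i"]) (force simp: branch_def)
  next
    case Minus
    then have "incr i" using dir by auto
    have "t \<in> branch i \<and> f t0 < f t" if "t \<in> germ (i, s) (x (Suc i) - t0)" for t
    proof -
      have "t0 < t" "t < x (Suc i)" using that Minus by auto
      then have "t \<in> branch i" using t0 by (auto simp: branch_def)
      then show ?thesis using \<open>incr i\<close> t0(1) \<open>t0 < t\<close> by (simp add: incr_def)
    qed
    then show ?thesis using t0 y im by (intro exI[of _ "x (Suc i) - t0"]) (force simp: branch_def)
  qed
qed

lemma f_tilde_point:
  assumes "\<And>e. 0 < e \<Longrightarrow> \<exists>d>0. \<forall>t\<in>germ (i, s) d. \<bar>f t - L\<bar> < e"
  shows "fst (f_tilde f (end_point (i, s), s)) = L"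
proof (cases s)
  case Plus
  have "(f \<longlongrightarrow> L) (at_right (x i))"
  proof (rule tendstoI)
    fix e :: real assume "0 < e"
    then obtain d where d: "0 < d" "\<forall>t\<in>germ (i, s) d. \<bar>f t - L\<bar> < e" using assms by blast
    show "\<forall>\<^sub>F t in at_right (x i). dist (f t) L < e"
      unfolding eventually_at_right[of "x i" "x i + 1", simplified] 
      using d Plus by (intro exI[of _ "x i + d"]) (auto simp: dist_real_def)
  qed
  then show ?thesis using Plus by (simp add: tendsto_Lim)
next
  case Minus
  have "(f \<longlongrightarrow> L) (at_left (x (Suc i)))"
  proof (rule tendstoI)
    fix e :: real assume "0 < e"
    then obtain d where d: "0 < d" "\<forall>t\<in>germ (i, s) d. \<bar>f t - L\<bar> < e" using assms by blast
    show "\<forall>\<^sub>F t in at_left (x (Suc i)). dist (f t) L < e"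
      unfolding eventually_at_left[of "x (Suc i) - 1" "x (Suc i)", simplified] 
      using d Minus by (intro exI[of _ "x (Suc i) - d"]) (auto simp: dist_real_def)
  qed
  then show ?thesis using Minus by (simp add: tendsto_Lim)
qed

lemma germ_two_points:
  assumes i: "i < m" and e: "0 < e"
  shows "\<exists>s t. s < t \<and> s \<in> branch i \<and> t \<in> branch i \<and> s \<in> germ (i, d) e \<and> t \<in> germ (i, d) e"
proof -
  have xi: "x i < x (Suc i)" using x_less i by simp
  define r where "r = min e (x (Suc i) - x i)"
  have r: "0 < r" "r \<le> e" "r \<le> x (Suc i) - x i" using e xi by (auto simp: r_def)
  show ?thesis
  proof (cases d)
    case Plus
    then show ?thesis using r by (intro exI[of _ "x i + r / 3"] exI[of _ "x i + r / 2"]) (auto simp: branch_def)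
  next
    case Minus
    then show ?thesis using r by (intro exI[of _ "x (Suc i) - r / 2"] exI[of _ "x (Suc i) - r / 3"]) (auto simp: branch_def)
  qed
qed

lemma f_tilde_side:
  assumes i: "i < m"
  shows "incr i \<Longrightarrow> snd (f_tilde f (end_point (i, s), s)) = s"
    and "decr i \<Longrightarrow> snd (f_tilde f (end_point (i, s), s)) = opposite s"
proof -
  have xi: "x i < x (Suc i)" using x_less i by simp
  { assume inc: "incr i"
    have "strict_mono_on (branch i) f" using inc by (auto simp: incr_def strict_mono_on_def)
    then have "strict_mono_on {x i<..<x i + (x (Suc i) - x i)} f" "strict_mono_on {x (Suc i) - (x (Suc i) - x i)<..<x (Suc i)} f"
      by (simp_all add: branch_def)
    then show "snd (f_tilde f (end_point (i, s), s)) = s"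
      using xi by (cases s) (auto intro: exI[of _ "x (Suc i) - x i"]) }
  { assume dec: "decr i"
    have no: "\<not> strict_mono_on (germ (i, s) e) f" if "0 < e" for e
    proof
      assume sm: "strict_mono_on (germ (i, s) e) f"
      obtain a b where "a < b" "a \<in> branch i" "b \<in> branch i" "a \<in> germ (i, s) e" "b \<in> germ (i, s) e"
        using germ_two_points[OF i \<open>0 < e\<close>] by blast
      then have "f a < f b" "f b < f a" using sm dec by (auto simp: decr_def strict_mono_on_def)
      then show False by simp
    qed
    show "snd (f_tilde f (end_point (i, s), s)) = opposite s"
      using no by (cases s) auto }
qed

text \<open>One application of the map on one-sided points moves germs into germs and follows an edge of the
  transition graph.\<close>

lemma germ_step:
  assumes i: "fst z < m"
  shows "\<exists>z'. nxt (fst z) (fst z') \<and> f_tilde f (end_point z, snd z) = (end_point z', snd z') \<and>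
     (\<forall>e>0. \<exists>d>0. \<forall>t\<in>germ z d. t \<in> branch (fst z) \<and> f t \<in> germ z' e)"
proof -
  obtain k s where z: "z = (k, s)" by (cases z)
  then have k: "k < m" using i by simp
  note lh = lo_hi[OF k]
  show ?thesis
  proof (cases "incr k \<and> s = Plus \<or> decr k \<and> s = Minus")
    case True
    note low = lower_germ[OF k True]
    have "fst (f_tilde f (end_point (k, s), s)) = x (lo k)"
    proof (rule f_tilde_point)
      fix e :: real assume "0 < e"
      from low[OF this] show "\<exists>d>0. \<forall>t\<in>germ (k, s) d. \<bar>f t - x (lo k)\<bar> < e" by fastforce
    qed
    moreover have "snd (f_tilde f (end_point (k, s), s)) = Plus"
      using f_tilde_side[OF k, of s] True by auto
    ultimately have "f_tilde f (end_point z, snd z) = (end_point (lo k, Plus), snd (lo k, Plus))"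
      unfolding z by (simp add: prod_eq_iff)
    moreover have "nxt (fst z) (fst (lo k, Plus))" using lh z by (simp add: nxt_def)
    moreover have "\<forall>e>0. \<exists>d>0. \<forall>t\<in>germ z d. t \<in> branch (fst z) \<and> f t \<in> germ (lo k, Plus) e"
      using low z by simp
    ultimately show ?thesis by blast
  next
    case False
    then have dir: "incr k \<and> s = Minus \<or> decr k \<and> s = Plus"
      using incr_or_decr[OF k] by (cases s) auto
    note up = upper_germ[OF k dir]
    have hk: "Suc (hi k - 1) = hi k" using lh by simp
    have "fst (f_tilde f (end_point (k, s), s)) = x (hi k)"
    proof (rule f_tilde_point)
      fix e :: real assume "0 < e"
      from up[OF this] show "\<exists>d>0. \<forall>t\<in>germ (k, s) d. \<bar>f t - x (hi k)\<bar> < e" by fastforce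
    qed
    moreover have "snd (f_tilde f (end_point (k, s), s)) = Minus"
      using f_tilde_side[OF k, of s] dir by auto
    ultimately have "f_tilde f (end_point z, snd z) = (end_point (hi k - 1, Minus), snd (hi k - 1, Minus))"
      unfolding z using hk by (simp add: prod_eq_iff del: One_nat_def)
    moreover have "nxt (fst z) (fst (hi k - 1, Minus))" using lh z by (auto simp: nxt_def)
    moreover have "\<forall>e>0. \<exists>d>0. \<forall>t\<in>germ z d. t \<in> branch (fst z) \<and> f t \<in> germ (hi k - 1, Minus) e"
      using up z hk by simp
    ultimately show ?thesis by blast
  qed
qed

text \<open>Iterating \<open>germ_step\<close> from \<open>(j, Plus)\<close> gives the labels of the orbit of the one-sided point. After
  \<open>n\<close> steps the same code recurs, so the label sequence is periodic, and each of its cylinders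
  contains a right neighbourhood of the point.\<close>

theorem periodic_itinerary:
  assumes j: "j < m" and per: "has_period (f_tilde f) (x j, Plus) n"
  obtains w where "w 0 = j" "\<And>k. w k < m" "\<And>k. nxt (w k) (w (Suc k))" "\<And>k. w (k + n) = w k"
    "\<And>K. \<exists>d>0. {x j<..<x j + d} \<subseteq> cyl (map w [0..<K])"
proof -
  define G where "G = (\<lambda>z. SOME z'. nxt (fst z) (fst z') \<and> f_tilde f (end_point z, snd z) = (end_point z', snd z') \<and>
     (\<forall>e>0. \<exists>d>0. \<forall>t\<in>germ z d. t \<in> branch (fst z) \<and> f t \<in> germ z' e))"
  have G: "nxt (fst z) (fst (G z))" "f_tilde f (end_point z, snd z) = (end_point (G z), snd (G z))"
     "\<forall>e>0. \<exists>d>0. \<forall>t\<in>germ z d. t \<in> branch (fst z) \<and> f t \<in> germ (G z) e" if "fst z < m" for z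
    using someI_ex[OF germ_step[OF that]] unfolding G_def by blast+
  have Gm: "fst (G z) < m" if "fst z < m" for z using nxt_less[OF that G(1)[OF that]] .
  have Gkm: "fst ((G ^^ k) z) < m" if "fst z < m" for z k
    by (induction k) (use that Gm in auto)
  define st where "st = (\<lambda>k. (G ^^ k) (j, Plus))"
  have st: "(f_tilde f ^^ k) (x j, Plus) = (end_point (st k), snd (st k))" for k
  proof (induction k)
    case (Suc k)
    then show ?case using G(2)[of "st k"] Gkm[of "(j, Plus)" k] j by (simp add: st_def)
  qed (simp add: st_def)
  have stm: "fst (st k) < m" for k using Gkm[of "(j, Plus)" k] j by (simp add: st_def)
  have "(x j, Plus) = (end_point (st n), snd (st n))" using per st[of n] by (simp add: has_period_def)
  then have "st n = (j, Plus)"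
    using stm[of n] j x_inj[of j "fst (st n)"] by (cases "st n") auto
  then have "(G ^^ (k + n)) (j, Plus) = (G ^^ k) (j, Plus)" for k by (simp add: funpow_add st_def)
  then have periodic: "st (k + n) = st k" for k by (simp add: st_def)
  have cyl: "fst z < m \<Longrightarrow> \<exists>d>0. germ z d \<subseteq> cyl (map (\<lambda>k. fst ((G ^^ k) z)) [0..<K])" for z K
  proof (induction K arbitrary: z)
    case 0
    then show ?case by (auto intro: exI[of _ 1])
  next
    case (Suc K)
    have eq: "map (\<lambda>k. fst ((G ^^ k) z)) [0..<Suc K] = fst z # map (\<lambda>k. fst ((G ^^ k) (G z))) [0..<K]"
      by (simp only: upt_conv_Cons[OF zero_less_Suc] list.map map_Suc_upt[symmetric] map_map)
         (simp add: funpow_swap1 comp_def)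
    obtain e where e: "0 < e" "germ (G z) e \<subseteq> cyl (map (\<lambda>k. fst ((G ^^ k) (G z))) [0..<K])"
      using Suc.IH[OF Gm[OF Suc.prems]] by blast
    obtain d where "0 < d" "\<forall>t\<in>germ z d. t \<in> branch (fst z) \<and> f t \<in> germ (G z) e" using G(3)[OF Suc.prems] e(1) by blast
    then show ?case unfolding eq using e(2) by (intro exI[of _ d]) auto
  qed
  show thesis
  proof (rule that[of "\<lambda>k. fst (st k)"])
    show "fst (st 0) = j" by (simp add: st_def)
    show "nxt (fst (st k)) (fst (st (Suc k)))" for k using G(1)[OF stm[of k]] by (simp add: st_def)
    show "\<exists>d>0. {x j<..<x j + d} \<subseteq> cyl (map (\<lambda>k. fst (st k)) [0..<K])" for K
      using cyl[of "(j, Plus)" K] j by (simp add: st_def)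
  qed (use stm periodic in auto)
qed

end

section \<open>Cylinders shrinking to the periodic point\<close>

context markov_branches
begin

lemma cyl_surj:
  "set w \<subseteq> {..<m} \<Longrightarrow> successively nxt (w @ [i]) \<Longrightarrow> y \<in> branch i \<Longrightarrow> \<exists>t\<in>cyl w. (f ^^ length w) t = y"
proof (induction w)
  case (Cons k w)
  then obtain t where t: "t \<in> cyl w" "(f ^^ length w) t = y" by (auto simp: successively_Cons)
  have k: "k < m" using Cons.prems by simp
  have "t \<in> branch (hd (w @ [i]))"
    using t Cons.prems(3) cyl_subset_branch[of w] by (cases "w = []") auto
  moreover have "nxt k (hd (w @ [i]))" using Cons.prems(2) by (simp add: successively_Cons)
  ultimately obtain s where "s \<in> branch k" "f s = t" using nxt_subset[OF k] by blast
  then show ?case using t by (intro bexI[of _ s]) (auto simp: funpow_swap1)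
qed simp

lemma cyl_deriv:
  assumes "set w \<subseteq> {..<m}" "t \<in> cyl w"
  shows "\<exists>D. (f ^^ length w has_real_derivative D) (at t) \<and> c ^ length w \<le> \<bar>D\<bar>"
  using assms
proof (induction w arbitrary: t)
  case Nil
  show ?case by (intro exI[of _ 1]) (simp add: id_def)
next
  case (Cons i w)
  then obtain D where D: "(f ^^ length w has_real_derivative D) (at (f t))" "c ^ length w \<le> \<bar>D\<bar>" by auto
  have i: "i < m" "t \<in> branch i" using Cons.prems by auto
  have "(f ^^ length w \<circ> f has_real_derivative D * deriv f t) (at t)"
    by (rule DERIV_chain[OF D(1) f_has_deriv[OF i]])
  moreover have "f ^^ length w \<circ> f = f ^^ length (i # w)" by (simp add: funpow_Suc_right del: funpow.simps)
  moreover have "c * c ^ length w \<le> \<bar>deriv f t\<bar> * \<bar>D\<bar>"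
    using D(2) slope[OF i(1)] i(2) c1 by (intro mult_mono) (auto simp: branch_def)
  ultimately have "(f ^^ length (i # w) has_real_derivative D * deriv f t) (at t)"
      "c ^ length (i # w) \<le> \<bar>D * deriv f t\<bar>"
    by (simp_all only: abs_mult mult.commute length_Cons power_Suc)
  then show ?case by blast
qed

lemma cyl_has_deriv:
  assumes "set w \<subseteq> {..<m}" "t \<in> cyl w" "length w = n"
  shows "(f ^^ n has_real_derivative deriv (f ^^ n) t) (at t)" "c ^ n \<le> \<bar>deriv (f ^^ n) t\<bar>"
proof -
  obtain D where D: "(f ^^ n has_real_derivative D) (at t)" "c ^ n \<le> \<bar>D\<bar>" using cyl_deriv[OF assms(1,2)] assms(3) by auto
  then have "deriv (f ^^ n) t = D" by (simp add: DERIV_imp_deriv)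
  then show "(f ^^ n has_real_derivative deriv (f ^^ n) t) (at t)" "c ^ n \<le> \<bar>deriv (f ^^ n) t\<bar>" using D by auto
qed

text \<open>The cylinders along the itinerary are intervals that start at \<open>p\<close>. The return map \<open>f ^^ n\<close> is
  injective on \<open>C 1\<close> and sends \<open>C (Suc k)\<close> onto \<open>C k\<close>; since these shrink to \<open>p\<close>, it must be increasing.\<close>

theorem cylinder_tower:
  assumes n: "1 \<le> n" and w: "\<And>k. w k < m" "\<And>k. nxt (w k) (w (Suc k))" "\<And>k. w (k + n) = w k"
    and germ: "\<And>K. \<exists>d>0. {x (w 0)<..<x (w 0) + d} \<subseteq> cyl (map w [0..<K])"
  defines "C \<equiv> \<lambda>k. cyl (map w [0..<Suc (k * n)])" and "p \<equiv> x (w 0)"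
  obtains e where "\<And>k. 0 < e k" "\<And>k. C k = {p<..<p + e k}" "\<And>k. e k \<le> 1"
    "e \<longlonglongrightarrow> 0" "\<And>k. (f ^^ n) ` C (Suc k) = C k"
    "\<And>t. t \<in> C 1 \<Longrightarrow> (f ^^ n has_real_derivative deriv (f ^^ n) t) (at t)"
    "\<And>t. t \<in> C 1 \<Longrightarrow> c ^ n \<le> deriv (f ^^ n) t"
proof -
  have letters: "set (map w [0..<K]) \<subseteq> {..<m}" for K using w(1) by auto
  have path: "successively nxt (map w [0..<K])" for K
    using w(2) by (auto simp: successively_conv_nth)
  have "\<exists>e. 0 < e \<and> C k = {p<..<p + e}" for k
  proof -
    obtain l r where lr: "l < r" "C k = {l<..<r}"
      using cyl_interval[OF _ letters path, of "Suc (k * n)"] unfolding C_def by auto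
    obtain d where d: "0 < d" "{p<..<p + d} \<subseteq> C k" using germ[of "Suc (k * n)"] unfolding C_def p_def by blast
    have "hd (map w [0..<Suc (k * n)]) = w 0" by (simp add: hd_map del: upt_Suc)
    then have "C k \<subseteq> branch (w 0)"
      using cyl_subset_branch[of "map w [0..<Suc (k * n)]"] unfolding C_def by simp
    then have "{l<..<r} \<subseteq> {p<..<x (Suc (w 0))}" using lr by (simp add: branch_def p_def)
    then have "p \<le> l" using lr(1) by (simp add: greaterThanLessThan_subseteq_greaterThanLessThan)
    moreover have "{p<..<p + d} \<subseteq> {l<..<r}" using d(2) lr by simp
    then have "l \<le> p" using d(1) by (simp add: greaterThanLessThan_subseteq_greaterThanLessThan)
    ultimately show ?thesis using lr by (intro exI[of _ "r - p"]) auto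
  qed
  then obtain e where e: "\<And>k. 0 < e k" "\<And>k. C k = {p<..<p + e k}" by metis
  have shift: "map w [0..<Suc (Suc k * n)] = map w [0..<n] @ map w [0..<Suc (k * n)]" for k
  proof -
    have "[0..<Suc (Suc k * n)] = [0..<n] @ map (\<lambda>i. i + n) [0..<Suc (k * n)]"
      using upt_add_eq_append[of 0 n "Suc (k * n)"] map_add_upt[of n "Suc (k * n)"] by (simp add: add.commute del: upt_Suc)
    then show ?thesis using w(3) by (simp only: map_append map_map comp_def)
  qed
  have C_unit: "C k \<subseteq> {0<..<1}" for k
    unfolding C_def by (rule cyl_unit[OF _ letters]) simp
  have e1: "e k \<le> 1" for k
    using C_unit[of k] e(1)[of k] unfolding e(2) by (simp add: greaterThanLessThan_subseteq_greaterThanLessThan)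
  have bound: "e k \<le> 3 * inverse (c ^ Suc k)" for k
  proof -
    have "p + e k / 3 \<in> C k" "p + 2 * e k / 3 \<in> C k" using e(1)[of k] by (auto simp: e(2))
    then have "c ^ length (map w [0..<Suc (k * n)]) * \<bar>(p + e k / 3) - (p + 2 * e k / 3)\<bar> \<le> 1"
      unfolding C_def by (intro cyl_diameter[OF letters]) simp_all
    moreover have "\<bar>(p + e k / 3) - (p + 2 * e k / 3)\<bar> = e k / 3" using e(1)[of k] by simp
    ultimately have 1: "c ^ Suc (k * n) * (e k / 3) \<le> 1" by (simp del: upt_Suc power_Suc)
    have "c ^ Suc k \<le> c ^ Suc (k * n)" using c1 n by (intro power_increasing) auto
    then have "c ^ Suc k * (e k / 3) \<le> c ^ Suc (k * n) * (e k / 3)"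
      using e(1)[of k] by (intro mult_right_mono) auto
    then have "c ^ Suc k * (e k / 3) \<le> 1" using 1 by linarith
    then show ?thesis using c1 by (simp add: field_simps)
  qed
  have "(\<lambda>k. 3 * inverse (c ^ Suc k)) \<longlonglongrightarrow> 3 * 0"
    by (intro tendsto_mult tendsto_const LIMSEQ_Suc LIMSEQ_inverse_realpow_zero c1)
  then have lim: "(\<lambda>k. 3 * inverse (c ^ Suc k)) \<longlonglongrightarrow> 0" by (simp only: mult_zero_right)
  have e0: "e \<longlonglongrightarrow> 0"
  proof (rule tendsto_sandwich[OF _ _ tendsto_const lim])
    show "\<forall>\<^sub>F k in sequentially. 0 \<le> e k" by (intro always_eventually allI less_imp_le e(1))
    show "\<forall>\<^sub>F k in sequentially. e k \<le> 3 * inverse (c ^ Suc k)" by (intro always_eventually allI bound)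
  qed
  have memS: "t \<in> C (Suc k) \<longleftrightarrow> t \<in> cyl (map w [0..<n]) \<and> (f ^^ n) t \<in> C k" for t k
    unfolding C_def shift cyl_append by simp
  have onto: "(f ^^ n) ` C (Suc k) = C k" for k
  proof
    show "(f ^^ n) ` C (Suc k) \<subseteq> C k" using memS by auto
    show "C k \<subseteq> (f ^^ n) ` C (Suc k)"
    proof
      fix y assume y: "y \<in> C k"
      have "hd (map w [0..<Suc (k * n)]) = w 0" by (simp add: hd_map del: upt_Suc)
      then have "y \<in> branch (w 0)" using y cyl_subset_branch[of "map w [0..<Suc (k * n)]"] unfolding C_def by auto
      moreover have "map w [0..<n] @ [w 0] = map w [0..<Suc n]" using w(3)[of 0] by simp
      then have "successively nxt (map w [0..<n] @ [w 0])" using path by metis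
      ultimately obtain t where "t \<in> cyl (map w [0..<n])" "(f ^^ n) t = y"
        using cyl_surj[OF letters] by (metis length_map length_upt diff_zero)
      then show "y \<in> (f ^^ n) ` C (Suc k)" using memS y by blast
    qed
  qed
  have inCn: "t \<in> cyl (map w [0..<n])" if "t \<in> C 1" for t using memS[of t 0] that by simp
  have der: "(f ^^ n has_real_derivative deriv (f ^^ n) t) (at t)" "c ^ n \<le> \<bar>deriv (f ^^ n) t\<bar>" if "t \<in> C 1" for t
    using cyl_has_deriv[OF letters inCn[OF that]] by simp_all
  have cont: "continuous_on (C 1) (f ^^ n)"
    by (intro continuous_at_imp_continuous_on ballI DERIV_isCont[OF der(1)])
  have inj: "inj_on (f ^^ n) (C 1)"
  proof (rule inj_onI)
    fix s t assume "s \<in> C 1" "t \<in> C 1" "(f ^^ n) s = (f ^^ n) t"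
    then have "c ^ n * \<bar>s - t\<bar> \<le> 0" using cyl_expand[OF letters inCn inCn, of s t] by simp
    moreover have "0 < c ^ n" using c1 by simp
    ultimately show "s = t" by (simp add: mult_le_0_iff)
  qed
  have inc: "(f ^^ n) s < (f ^^ n) t" if st: "s \<in> C 1" "t \<in> C 1" "s < t" for s t
  proof (rule ccontr)
    assume "\<not> (f ^^ n) s < (f ^^ n) t"
    then have gt: "(f ^^ n) t < (f ^^ n) s" using inj_onD[OF inj _ st(1,2)] st(3) by fastforce
    have big: "(f ^^ n) s < (f ^^ n) r" if r: "r \<in> C 1" "r < s" for r
    proof -
      have "{r..t} \<subseteq> C 1" using r st by (auto simp: e(2))
      then show ?thesis
        using continuous_inj_imp_mono[of r s t "f ^^ n"] continuous_on_subset[OF cont] inj_on_subset[OF inj] r(2) st(3) gt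
        by force
    qed
    have "(f ^^ n) s \<in> C 0" using onto[of 0] st(1) by auto
    then have "p < (f ^^ n) s" by (simp add: e(2))
    then have "\<forall>\<^sub>F k in sequentially. e k < (f ^^ n) s - p" using order_tendstoD(2)[OF e0] by simp
    then obtain k where k: "e k < (f ^^ n) s - p" by (auto simp: eventually_sequentially)
    have "p < min s (p + e (Suc k))" using st(1) e(1)[of "Suc k"] by (simp add: e(2))
    then obtain r where r: "p < r" "r < min s (p + e (Suc k))" using dense by blast
    then have "r \<in> C (Suc k)" by (simp add: e(2))
    then have "(f ^^ n) r \<in> C k" using onto by blast
    then have "(f ^^ n) r < (f ^^ n) s" using k by (simp add: e(2))
    moreover have "r \<in> C 1" using r st by (auto simp: e(2))
    ultimately show False using big r by force
  qed
  have pos: "c ^ n \<le> deriv (f ^^ n) t" if t: "t \<in> C 1" for t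
  proof (rule ccontr)
    assume "\<not> ?thesis"
    then have neg: "deriv (f ^^ n) t < 0" using der(2)[OF t] by linarith
    obtain d where d: "0 < d" "\<And>h. 0 < h \<Longrightarrow> h < d \<Longrightarrow> (f ^^ n) (t + h) < (f ^^ n) t"
      using DERIV_neg_dec_right[OF der(1)[OF t] neg] by blast
    define h where "h = min (d / 2) ((p + e 1 - t) / 2)"
    have "0 < p + e 1 - t" using t by (simp add: e(2))
    then have h: "0 < h" "h < d" "t + h \<in> C 1" using d(1) t by (auto simp: h_def e(2) min_def field_simps)
    then show False using d(2)[OF h(1,2)] inc[OF t h(3)] by simp
  qed
  show thesis
    by (rule that[OF e e1 e0 onto der(1) pos])
qed

end

text \<open>Integrate \<open>G' \<le> (t - p) powr (- \<beta>)\<close>: right side minus left side of the conclusion is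
  increasing in \<open>s\<close>, and close to \<open>p\<close> it exceeds every negative number.\<close>

lemma slope_upper_bound:
  fixes G D :: "real \<Rightarrow> real"
  assumes \<beta>: "0 < \<beta>" "\<beta> < 1"
    and der: "\<And>t. p < t \<Longrightarrow> t < p + r \<Longrightarrow> (G has_real_derivative D t) (at t)"
    and le: "\<And>t. p < t \<Longrightarrow> t < p + r \<Longrightarrow> D t \<le> (t - p) powr (- \<beta>)"
    and lim: "\<And>\<epsilon> s. 0 < \<epsilon> \<Longrightarrow> p < s \<Longrightarrow> \<exists>t. p < t \<and> t < s \<and> G t < p + \<epsilon>"
    and s: "p < s" "s < p + r"
  shows "G s - p \<le> (s - p) powr (1 - \<beta>) / (1 - \<beta>)"
proof (rule field_le_epsilon)
  fix \<epsilon> :: real assume "0 < \<epsilon>"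
  then obtain t where t: "p < t" "t < s" "G t < p + \<epsilon>" using lim s by blast
  define \<Phi> where "\<Phi> = (\<lambda>t. (t - p) powr (1 - \<beta>) / (1 - \<beta>) - G t)"
  have mono: "\<exists>y. (\<Phi> has_real_derivative y) (at z) \<and> 0 \<le> y" if z: "t \<le> z" "z \<le> s" for z
  proof -
    have zr: "p < z" "z < p + r" using z t s by auto
    have "((\<lambda>t. (t - p) powr (1 - \<beta>)) has_real_derivative (1 - \<beta>) * (z - p) powr (1 - \<beta> - 1)) (at z)"
      using zr by (auto intro!: derivative_eq_intros)
    then have "(\<Phi> has_real_derivative (1 - \<beta>) * (z - p) powr (1 - \<beta> - 1) / (1 - \<beta>) - D z) (at z)"
      unfolding \<Phi>_def by (intro DERIV_diff DERIV_cdivide der zr)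
    moreover have "(1 - \<beta>) * (z - p) powr (1 - \<beta> - 1) / (1 - \<beta>) - D z = (z - p) powr (- \<beta>) - D z" using \<beta> by simp
    ultimately show ?thesis using le[OF zr] by auto
  qed
  have "\<Phi> t \<le> \<Phi> s" by (rule DERIV_nonneg_imp_nondecreasing[OF less_imp_le[OF t(2)] mono])
  moreover have "0 \<le> (t - p) powr (1 - \<beta>) / (1 - \<beta>)" using \<beta> by simp
  ultimately show "G s - p \<le> (s - p) powr (1 - \<beta>) / (1 - \<beta>) + \<epsilon>" using t(3) by (simp add: \<Phi>_def)
qed

lemma slope_lower_bound:
  fixes G D :: "real \<Rightarrow> real"
  assumes \<beta>: "0 < \<beta>" "\<beta> < 1"
    and der: "\<And>t. p < t \<Longrightarrow> t < p + r \<Longrightarrow> (G has_real_derivative D t) (at t)"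
    and ge: "\<And>t. p < t \<Longrightarrow> t < p + r \<Longrightarrow> (t - p) powr (- \<beta>) \<le> D t"
    and pos: "\<And>t. p < t \<Longrightarrow> t < p + r \<Longrightarrow> p < G t"
    and s: "p < s" "s < p + r"
  shows "(s - p) powr (1 - \<beta>) \<le> G s - p"
proof -
  have main: "(s - p) powr (1 - \<beta>) / (1 - \<beta>) \<le> G s - p"
  proof (rule field_le_epsilon)
    fix \<epsilon> :: real assume \<epsilon>: "0 < \<epsilon>"
    define d where "d = min ((s - p) / 2) (((1 - \<beta>) * \<epsilon>) powr (1 / (1 - \<beta>)))"
    define t where "t = p + d"
    have "d \<le> (s - p) / 2" unfolding d_def by (rule min.cobounded1)
    then have d: "0 < d" "d < s - p" "d \<le> ((1 - \<beta>) * \<epsilon>) powr (1 / (1 - \<beta>))"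
      using s \<beta> \<epsilon> by (linarith | simp add: d_def)+
    then have t: "p < t" "t < s" by (auto simp: t_def)
    have "d powr (1 - \<beta>) \<le> (((1 - \<beta>) * \<epsilon>) powr (1 / (1 - \<beta>))) powr (1 - \<beta>)"
      using d \<beta> by (intro powr_mono2) auto
    also have "\<dots> = (1 - \<beta>) * \<epsilon>" using \<beta> \<epsilon> by (simp add: powr_powr)
    finally have small: "(t - p) powr (1 - \<beta>) / (1 - \<beta>) \<le> \<epsilon>" using \<beta> by (simp add: t_def field_simps)
    define \<Phi> where "\<Phi> = (\<lambda>t. G t - (t - p) powr (1 - \<beta>) / (1 - \<beta>))"
    have mono: "\<exists>y. (\<Phi> has_real_derivative y) (at z) \<and> 0 \<le> y" if z: "t \<le> z" "z \<le> s" for z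
    proof -
      have zr: "p < z" "z < p + r" using z t s by auto
      have "((\<lambda>t. (t - p) powr (1 - \<beta>)) has_real_derivative (1 - \<beta>) * (z - p) powr (1 - \<beta> - 1)) (at z)"
        using zr by (auto intro!: derivative_eq_intros)
      then have "(\<Phi> has_real_derivative D z - (1 - \<beta>) * (z - p) powr (1 - \<beta> - 1) / (1 - \<beta>)) (at z)"
        unfolding \<Phi>_def by (intro DERIV_diff DERIV_cdivide der zr)
      moreover have "D z - (1 - \<beta>) * (z - p) powr (1 - \<beta> - 1) / (1 - \<beta>) = D z - (z - p) powr (- \<beta>)" using \<beta> by simp
      ultimately show ?thesis using ge[OF zr] by auto
    qed
    have "\<Phi> t \<le> \<Phi> s" by (rule DERIV_nonneg_imp_nondecreasing[OF less_imp_le[OF t(2)] mono])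
    then show "(s - p) powr (1 - \<beta>) / (1 - \<beta>) \<le> G s - p + \<epsilon>" using small pos[of t] t s by (simp add: \<Phi>_def)
  qed
  have "(s - p) powr (1 - \<beta>) * (1 - \<beta>) \<le> (s - p) powr (1 - \<beta>)" using \<beta> by (intro mult_left_le) auto
  then have "(s - p) powr (1 - \<beta>) \<le> (s - p) powr (1 - \<beta>) / (1 - \<beta>)" using \<beta> by (simp add: field_simps)
  then show ?thesis using main by simp
qed

lemma growth_upper:
  fixes a :: "nat \<Rightarrow> real"
  assumes \<theta>: "1 < \<theta>" and rec: "\<And>k. k0 \<le> k \<Longrightarrow> a (Suc k) \<le> \<theta> * (a k + b)" and b: "0 \<le> b"
  shows "\<exists>D\<ge>0. \<forall>k\<ge>k0. a k \<le> D * \<theta> ^ k"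
proof -
  \<comment> \<open>Adding \<open>\<kappa>\<close> to \<open>a\<close> turns the affine recursion into a linear one.\<close>
  define \<kappa> where "\<kappa> = \<theta> * b / (\<theta> - 1)"
  have \<kappa>: "0 \<le> \<kappa>" "\<theta> * b + \<kappa> = \<theta> * \<kappa>" using \<theta> b by (auto simp: \<kappa>_def field_simps)
  define D where "D = \<bar>a k0\<bar> + \<kappa>"
  have "a k + \<kappa> \<le> D * \<theta> ^ k" if "k0 \<le> k" for k
    using that
  proof (induction rule: dec_induct)
    case base
    have "a k0 + \<kappa> \<le> D * 1" by (simp add: D_def)
    also have "\<dots> \<le> D * \<theta> ^ k0" using \<theta> \<kappa> by (intro mult_left_mono) (auto simp: D_def)
    finally show ?case .
  next
    case (step k)
    have "a (Suc k) + \<kappa> \<le> \<theta> * (a k + \<kappa>)" using rec[OF step(1)] \<kappa>(2) by (simp add: algebra_simps)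
    also have "\<dots> \<le> \<theta> * (D * \<theta> ^ k)" using step \<theta> by (intro mult_left_mono) auto
    finally show ?case by (simp add: mult_ac)
  qed
  then show ?thesis using \<kappa>(1) by (intro exI[of _ D]) (force simp: D_def)
qed

text \<open>Used with \<open>a k = - ln (e k)\<close>, which grows geometrically when the lengths \<open>e k\<close> shrink
  superexponentially.\<close>

lemma growth_lower:
  fixes a :: "nat \<Rightarrow> real"
  assumes \<theta>: "0 < \<theta>" and rec: "\<And>k. k0 \<le> k \<Longrightarrow> \<theta> * a k \<le> a (Suc k)" and a: "0 < a k0"
  shows "\<exists>D>0. \<forall>k\<ge>k0. D * \<theta> ^ k \<le> a k"
proof -
  define D where "D = a k0 / \<theta> ^ k0"
  have "D * \<theta> ^ k \<le> a k" if "k0 \<le> k" for k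
    using that
  proof (induction rule: dec_induct)
    case base
    then show ?case using \<theta> by (simp add: D_def)
  next
    case (step k)
    have "\<theta> * (D * \<theta> ^ k) \<le> \<theta> * a k" using step \<theta> by (intro mult_left_mono) auto
    then show ?case using rec[OF step(1)] by (simp add: mult_ac)
  qed
  then show ?thesis using a \<theta> by (intro exI[of _ D]) (auto simp: D_def)
qed

text \<open>On the shell between two consecutive intervals the integrand is at most the logarithm at the
  inner end, so the integral is dominated by a geometric series with ratio \<open>\<theta> / q\<close>.\<close>

lemma adapted_of_decay:
  fixes M :: "real measure" and e :: "nat \<Rightarrow> real"
  assumes M: "prob_space M" "space M = {0..1}" and p: "0 \<le> p" "emeasure M {p} = 0"
    and e: "\<And>k. 0 < e k" "\<And>k. e k \<le> 1" "e \<longlonglongrightarrow> 0"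
    and C: "\<And>k. {p<..<p + e k} \<in> sets M" "\<And>k. measure M {p<..<p + e k} \<le> A / q ^ k"
    and growth: "\<And>k. k0 \<le> k \<Longrightarrow> - ln (e k) \<le> D * \<theta> ^ k" "0 \<le> D" "0 < \<theta>" "\<theta> < q" "0 \<le> A"
  shows "adapted p M"
proof -
  interpret prob_space M by fact
  have q: "0 < q" using growth by linarith
  define C where "C = (\<lambda>k. {p<..<p + e k})"
  \<comment> \<open>Outside the interval of index \<open>k0\<close> the integrand is bounded; inside, one term of the series dominates it.\<close>
  define H where "H = (\<lambda>t. ennreal (- ln (e k0)) + (\<Sum>k. ennreal (D * \<theta> ^ Suc (k + k0)) * indicator (C (k + k0)) t))"
  have pointwise: "ennreal \<bar>ln (t - p)\<bar> * indicator {t \<in> space M. p < t} t \<le> H t" for t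
  proof (cases "t \<in> space M \<and> p < t")
    case True
    then have t: "p < t" "t \<le> 1" by (auto simp: M(2))
    then have abs: "\<bar>ln (t - p)\<bar> = - ln (t - p)" using p by simp
    show ?thesis
    proof (cases "t - p < e k0")
      case False
      then have "ln (e k0) \<le> ln (t - p)" using e(1)[of k0] by simp
      then have "ennreal \<bar>ln (t - p)\<bar> \<le> ennreal (- ln (e k0))" unfolding abs by (intro ennreal_leI) simp
      also have "\<dots> \<le> H t" by (simp add: H_def)
      finally show ?thesis using True by simp
    next
      case True
      have "\<forall>\<^sub>F k in sequentially. e k < t - p" using order_tendstoD(2)[OF e(3)] t by simp
      then obtain K where K: "\<forall>k\<ge>K. e k < t - p" by (auto simp: eventually_sequentially)
      have ex: "\<exists>k. k0 \<le> k \<and> e k \<le> t - p" using K by (intro exI[of _ "max K k0"]) (auto intro: less_imp_le)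
      define k where "k = (LEAST k. k0 \<le> k \<and> e k \<le> t - p)"
      have k: "k0 \<le> k" "e k \<le> t - p" using LeastI_ex[OF ex] by (auto simp: k_def)
      then have "k \<noteq> k0" using True by auto
      then obtain i where i: "k = Suc (i + k0)" using k(1) by (metis add.commute le_neq_implies_less less_imp_Suc_add)
      have "\<not> (k0 \<le> i + k0 \<and> e (i + k0) \<le> t - p)" using not_less_Least[of "i + k0" "\<lambda>k. k0 \<le> k \<and> e k \<le> t - p"] i by (auto simp: k_def)
      then have tC: "t \<in> C (i + k0)" using t by (simp add: C_def)
      have "\<bar>ln (t - p)\<bar> \<le> - ln (e k)" unfolding abs using k(2) e(1)[of k] by simp
      also have "\<dots> \<le> D * \<theta> ^ Suc (i + k0)" using growth(1)[OF k(1)] i by simp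
      finally have "ennreal \<bar>ln (t - p)\<bar> \<le> ennreal (D * \<theta> ^ Suc (i + k0)) * indicator (C (i + k0)) t"
        using tC by (simp add: ennreal_leI)
      also have "\<dots> = (\<Sum>k\<in>{i}. ennreal (D * \<theta> ^ Suc (k + k0)) * indicator (C (k + k0)) t)"
        by (simp only: sum.insert[OF finite.emptyI] empty_iff not_False_eq_True sum.empty add_0_right)
      also have "\<dots> \<le> (\<Sum>k. ennreal (D * \<theta> ^ Suc (k + k0)) * indicator (C (k + k0)) t)"
        by (rule sum_le_suminf) (auto intro: summableI)
      also have "\<dots> \<le> H t" by (simp add: H_def)
      finally show ?thesis using \<open>t \<in> space M \<and> p < t\<close> by simp
    qed
  qed simp
  have CM: "C k \<in> sets M" for k using C(1) by (simp add: C_def)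
  define r where "r = (\<lambda>k. (D * \<theta> ^ Suc k0 * (A / q ^ k0)) * (\<theta> / q) ^ k)"
  have r: "summable r" unfolding r_def using growth q by (intro summable_mult summable_geometric) auto
  have r0: "0 \<le> r k" for k using growth q by (simp add: r_def)
  have "(\<integral>\<^sup>+t. H t \<partial>M) = ennreal (- ln (e k0)) + (\<Sum>k. ennreal (D * \<theta> ^ Suc (k + k0)) * emeasure M (C (k + k0)))"
    unfolding H_def using CM
    by (subst nn_integral_add) (auto simp: emeasure_space_1 nn_integral_suminf nn_integral_cmult_indicator)
  also have "\<dots> \<le> ennreal (- ln (e k0)) + (\<Sum>k. ennreal (r k))"
  proof (intro add_left_mono suminf_le summableI)
    fix k
    have "ennreal (D * \<theta> ^ Suc (k + k0)) * emeasure M (C (k + k0)) = ennreal (D * \<theta> ^ Suc (k + k0) * measure M (C (k + k0)))"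
      using growth by (simp add: emeasure_eq_measure ennreal_mult')
    also have "\<dots> \<le> ennreal (D * \<theta> ^ Suc (k + k0) * (A / q ^ (k + k0)))"
      using C(2)[of "k + k0"] growth by (intro ennreal_leI mult_left_mono) (auto simp: C_def)
    also have "D * \<theta> ^ Suc (k + k0) * (A / q ^ (k + k0)) = r k"
      by (simp add: r_def power_add power_divide mult_ac)
    finally show "ennreal (D * \<theta> ^ Suc (k + k0)) * emeasure M (C (k + k0)) \<le> ennreal (r k)" .
  qed
  also have "\<dots> < \<infinity>" using suminf_ennreal2[OF r0 r] by simp
  finally have "(\<integral>\<^sup>+t. H t \<partial>M) < \<infinity>" .
  have "(\<integral>\<^sup>+t\<in>{t \<in> space M. p < t}. ennreal \<bar>ln (t - p)\<bar> \<partial>M) \<le> (\<integral>\<^sup>+t. H t \<partial>M)"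
    by (intro nn_integral_mono pointwise)
  also note \<open>(\<integral>\<^sup>+t. H t \<partial>M) < \<infinity>\<close>
  finally show ?thesis using p(2) unfolding adapted_def by blast
qed

text \<open>On the \<open>k\<close>-th interval the integrand is at least \<open>D * \<theta> ^ k\<close> while the measure is at least
  \<open>A / q ^ k\<close>, and the product is unbounded in \<open>k\<close>.\<close>

lemma nonadapted_of_decay:
  fixes M :: "real measure" and e :: "nat \<Rightarrow> real"
  assumes M: "prob_space M" "space M = {0..1}"
    and e: "\<And>k. 0 < e k" "\<And>k. e k \<le> 1"
    and C: "\<And>k. {p<..<p + e k} \<in> sets M" "\<And>k. A / q ^ k \<le> measure M {p<..<p + e k}"
    and growth: "\<And>k. k0 \<le> k \<Longrightarrow> D * \<theta> ^ k \<le> - ln (e k)" "0 < D" "0 < q" "q < \<theta>" "0 < A"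
  shows "nonadapted p M"
proof
  assume "adapted p M"
  interpret prob_space M by fact
  define I where "I = (\<integral>\<^sup>+t\<in>{t \<in> space M. p < t}. ennreal \<bar>ln (t - p)\<bar> \<partial>M)"
  have "I < \<infinity>" using \<open>adapted p M\<close> by (simp add: adapted_def I_def)
  then obtain B where B: "I = ennreal B" "0 \<le> B" by (cases I) auto
  have low: "D * A * (\<theta> / q) ^ k \<le> B" if k: "k0 \<le> k" for k
  proof -
    define C' where "C' = {p<..<p + e k}"
    have C'M: "C' \<in> sets M" using C(1) by (simp add: C'_def)
    have a0: "0 \<le> D * \<theta> ^ k" using growth by simp
    have "ennreal (D * \<theta> ^ k) * indicator C' t \<le> ennreal \<bar>ln (t - p)\<bar> * indicator {t \<in> space M. p < t} t" for t
    proof (cases "t \<in> C'")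
      case True
      then have t: "p < t" "t - p < e k" "t \<in> space M" using sets.sets_into_space[OF C'M] by (auto simp: C'_def)
      then have "ln (t - p) \<le> ln (e k)" by simp
      then have "D * \<theta> ^ k \<le> \<bar>ln (t - p)\<bar>" using growth(1)[OF k] by linarith
      then show ?thesis using t True by (simp add: ennreal_leI)
    qed simp
    then have "(\<integral>\<^sup>+t. ennreal (D * \<theta> ^ k) * indicator C' t \<partial>M) \<le> I"
      unfolding I_def by (intro nn_integral_mono)
    then have "ennreal (D * \<theta> ^ k * measure M C') \<le> ennreal B"
      using C'M a0 B by (simp add: nn_integral_cmult_indicator emeasure_eq_measure ennreal_mult')
    then have 1: "D * \<theta> ^ k * measure M C' \<le> B" using B by simp
    have "D * \<theta> ^ k * (A / q ^ k) \<le> D * \<theta> ^ k * measure M C'"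
      using C(2)[of k] a0 by (intro mult_left_mono) (auto simp: C'_def)
    then show ?thesis using 1 by (simp add: power_divide mult_ac)
  qed
  have "1 < \<theta> / q" using growth by simp
  then obtain k where k: "B / (D * A) < (\<theta> / q) ^ k" using real_arch_pow by blast
  have "(\<theta> / q) ^ k \<le> (\<theta> / q) ^ (max k k0)" using \<open>1 < \<theta> / q\<close> by (intro power_increasing) auto
  then have "B / (D * A) < (\<theta> / q) ^ (max k k0)" using k by linarith
  then have "B < D * A * (\<theta> / q) ^ (max k k0)" using growth by (simp add: field_simps)
  then show False using low[of "max k k0"] by simp
qed

section \<open>Adaptedness\<close>

lemma ereal_Limsup_nonneg:
  fixes L :: "'a \<Rightarrow> real"
  assumes "\<forall>\<^sub>F t in G. 0 \<le> L t" "G \<noteq> bot"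
  shows "0 \<le> Limsup G (\<lambda>t. ereal (L t))" "0 \<le> Liminf G (\<lambda>t. ereal (L t))"
proof -
  have ev: "\<forall>\<^sub>F t in G. 0 \<le> ereal (L t)" using assms(1) by simp
  show 1: "0 \<le> Liminf G (\<lambda>t. ereal (L t))" by (rule Liminf_bounded[OF ev])
  also have "\<dots> \<le> Limsup G (\<lambda>t. ereal (L t))" by (rule Liminf_le_Limsup[OF assms(2)])
  finally show "0 \<le> Limsup G (\<lambda>t. ereal (L t))" .
qed

context perron_data
begin

text \<open>The open branches of \<open>J\<close> already carry the whole mass \<open>\<Sum> u v = 1\<close>.\<close>

lemma knot_null:
  assumes M: "M \<in> invariant_measures {0..1} f IJ"
    and mass: "\<And>n w. 0 < n \<Longrightarrow> w \<in> admissible n \<Longrightarrow> measure M (cyl w) = mass w" and i: "i \<le> m"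
  shows "emeasure M {x i} = 0"
proof -
  interpret perron_measure f m x c lo hi J u v lam M using M by (rule perron_measureI)
  define U where "U = (\<Union>k\<in>J. branch k)"
  have W1: "[k] \<in> admissible 1" if "k \<in> J" for k using that by (auto simp: admissible_def)
  have brM: "branch k \<in> sets M" if "k \<in> J" for k
    using branch_unit[OF J_less[OF that]] by (intro borel_sub_M branch_borel) auto
  have UM: "U \<in> sets M" unfolding U_def using brM finite_J by auto
  have xM: "{x i} \<in> sets M" using x_unit[OF i] by (intro borel_sub_M) auto
  have "disjoint_family_on branch J"
    unfolding disjoint_family_on_def using branch_disjoint[OF J_less J_less] by blast
  then have "measure M U = (\<Sum>k\<in>J. measure M (branch k))"
    unfolding U_def by (intro finite_measure_finite_Union finite_J) (use brM in auto)
  also have "\<dots> = (\<Sum>k\<in>J. u k * v k)"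
    using mass[OF zero_less_one W1] by (intro sum.cong) (auto simp: mass_def)
  finally have "measure M U = 1" using uv_sum by simp
  moreover have "measure M ({x i} \<union> U) = measure M {x i} + measure M U"
    using branch_not_knot[OF J_less i] by (intro finite_measure_Union xM UM) (auto simp: U_def)
  ultimately have "measure M {x i} = 0" using prob_le_1[of "{x i} \<union> U"] measure_nonneg[of M "{x i}"] by linarith
  then show ?thesis by (simp add: emeasure_eq_measure)
qed

end

text \<open>The geometry of the return map at the periodic one-sided point, together with the eigenvector
  data of its component.\<close>

locale periodic_point = perron_data +
  fixes n :: nat and w :: "nat \<Rightarrow> nat" and e :: "nat \<Rightarrow> real" and p :: real
  assumes n: "1 \<le> n" and w_J: "w k \<in> J" and w_path: "nxt (w k) (w (Suc k))" and w_per: "w (k + n) = w k"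
    and p: "p = x (w 0)"
    and e_pos: "0 < e k" and e_le: "e k \<le> 1" and e_lim: "e \<longlonglongrightarrow> 0"
    and tower: "cyl (map w [0..<Suc (k * n)]) = {p<..<p + e k}"
    and return_onto: "(f ^^ n) ` {p<..<p + e (Suc k)} = {p<..<p + e k}"
    and return_deriv: "t \<in> {p<..<p + e 1} \<Longrightarrow> (f ^^ n has_real_derivative deriv (f ^^ n) t) (at t)"
    and return_slope: "t \<in> {p<..<p + e 1} \<Longrightarrow> c ^ n \<le> deriv (f ^^ n) t"
begin

definition L :: "real \<Rightarrow> real" where "L t = ln (deriv (f ^^ n) t) / (- ln (t - p))"

lemma p_unit: "0 \<le> p" "p < 1"
proof -
  have "w 0 < m" using w_J J_less by blast
  then show "0 \<le> p" "p < 1" using x_unit[of "w 0"] x_less[of "w 0" m] xm p by auto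
qed

lemma L_nonneg: "\<forall>\<^sub>F t in at_right p. 0 \<le> L t"
  unfolding eventually_at_right_field
proof (intro exI[of _ "p + e 1"] conjI allI impI)
  fix t assume t: "p < t" "t < p + e 1"
  have "1 \<le> c ^ n" using c1 by simp
  then have "0 \<le> ln (deriv (f ^^ n) t)" using return_slope[of t] t by simp
  moreover have "ln (t - p) \<le> 0" using t e_le[of 1] by simp
  ultimately show "0 \<le> L t" by (simp add: L_def divide_nonneg_nonpos)
qed (use e_pos in simp)

lemma small_k:
  assumes "0 < r" obtains k0 where "\<And>k. k0 \<le> k \<Longrightarrow> e k < r" 
proof -
  have "\<forall>\<^sub>F k in sequentially. e k < r" using order_tendstoD(2)[OF e_lim assms] .
  then show thesis using that by (auto simp: eventually_sequentially)
qed

lemma w_multiple: "w (k * n) = w 0"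
proof (induction k)
  case (Suc k)
  then show ?case using w_per[of "k * n"] by (simp add: add.commute)
qed simp

lemma tower_word: "map w [0..<Suc (k * n)] \<in> admissible (Suc (k * n))"
  using w_J w_path by (auto simp: admissible_def successively_conv_nth simp del: upt_Suc)

lemma tower_mass: "mass (map w [0..<Suc (k * n)]) = u (w 0) * v (w 0) / (lam ^ n) ^ k"
proof -
  have "hd (map w [0..<Suc (k * n)]) = w 0" by (simp add: hd_map del: upt_Suc)
  moreover have "last (map w [0..<Suc (k * n)]) = w 0" using w_multiple by simp
  moreover have "lam ^ (length (map w [0..<Suc (k * n)]) - 1) = (lam ^ n) ^ k"
    by (simp add: power_mult[symmetric] mult.commute)
  ultimately show ?thesis unfolding mass_def by (simp only:)
qed

text \<open>Integrating the bound on the derivative gives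
  \<open>e k \<le> e (Suc k) powr (1 - \<beta>) / (1 - \<beta>)\<close>, here in logarithmic form.\<close>

lemma step_upper:
  assumes \<beta>: "0 < \<beta>" "\<beta> < 1" and L: "\<forall>\<^sub>F t in at_right p. L t < \<beta>"
  obtains k0 where "\<And>k. k0 \<le> k \<Longrightarrow> - ln (e (Suc k)) \<le> 1 / (1 - \<beta>) * (- ln (e k) + - ln (1 - \<beta>))"
proof -
  obtain b where b: "p < b" "\<And>t. p < t \<Longrightarrow> t < b \<Longrightarrow> L t < \<beta>"
    using L unfolding eventually_at_right_field by blast
  define r where "r = min (b - p) (e 1)"
  have r: "0 < r" "p + r \<le> b" "r \<le> e 1" using b e_pos by (auto simp: r_def)
  obtain k0 where k0: "\<And>k. k0 \<le> k \<Longrightarrow> e k < r" using small_k[OF r(1)] by blast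
  have le: "(f ^^ n) s - p \<le> (s - p) powr (1 - \<beta>) / (1 - \<beta>)" if s: "p < s" "s < p + r" for s
  proof (rule slope_upper_bound[OF \<beta>, of p r "f ^^ n" "deriv (f ^^ n)"])
    fix t assume t: "p < t" "t < p + r"
    then have tC: "t \<in> {p<..<p + e 1}" using r by auto
    show "(f ^^ n has_real_derivative deriv (f ^^ n) t) (at t)" by (rule return_deriv[OF tC])
    have lt: "ln (t - p) < 0" using tC e_le[of 1] by simp
    have "L t < \<beta>" using b(2)[of t] t r by simp
    then have "ln (deriv (f ^^ n) t) < - \<beta> * ln (t - p)" using lt by (simp add: L_def field_simps)
    moreover have "1 \<le> c ^ n" using c1 by simp
    then have "0 < deriv (f ^^ n) t" using return_slope[OF tC] by linarith
    ultimately have "deriv (f ^^ n) t < exp (- \<beta> * ln (t - p))" by (metis exp_less_mono exp_ln)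
    then show "deriv (f ^^ n) t \<le> (t - p) powr (- \<beta>)" using t by (simp add: powr_def)
  next
    fix \<epsilon> s :: real assume \<epsilon>: "0 < \<epsilon>" "p < s"
    obtain k where k: "e k < \<epsilon>" using small_k[OF \<epsilon>(1)] by blast
    have "p < min s (p + e (Suc k))" using \<epsilon>(2) e_pos by simp
    then obtain t where t: "p < t" "t < min s (p + e (Suc k))" using dense by blast
    then have "(f ^^ n) t \<in> {p<..<p + e k}" using return_onto[of k] by auto
    then show "\<exists>t. p < t \<and> t < s \<and> (f ^^ n) t < p + \<epsilon>" using t k by (intro exI[of _ t]) auto
  qed (use s in auto)
  have "- ln (e (Suc k)) \<le> 1 / (1 - \<beta>) * (- ln (e k) + - ln (1 - \<beta>))" if k: "k0 \<le> k" for k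
  proof -
    have "e k \<le> e (Suc k) powr (1 - \<beta>) / (1 - \<beta>)"
    proof (rule dense_le_bounded[OF e_pos[of k]])
      fix y assume y: "0 < y" "y < e k"
      then have "p + y \<in> (f ^^ n) ` {p<..<p + e (Suc k)}" unfolding return_onto by simp
      then obtain s where s: "p < s" "s < p + e (Suc k)" "(f ^^ n) s = p + y" by auto
      then have "y \<le> (s - p) powr (1 - \<beta>) / (1 - \<beta>)" using le[of s] k0[of "Suc k"] k by simp
      also have "\<dots> \<le> e (Suc k) powr (1 - \<beta>) / (1 - \<beta>)"
        using s \<beta> by (intro divide_right_mono powr_mono2) auto
      finally show "y \<le> e (Suc k) powr (1 - \<beta>) / (1 - \<beta>)" .
    qed
    then have "ln (e k) \<le> ln (e (Suc k) powr (1 - \<beta>) / (1 - \<beta>))" using e_pos[of k] by simp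
    also have "\<dots> = (1 - \<beta>) * ln (e (Suc k)) - ln (1 - \<beta>)"
      using e_pos[of "Suc k"] \<beta> by (simp add: ln_div ln_powr)
    finally have "(1 - \<beta>) * (- ln (e (Suc k))) \<le> - ln (e k) + - ln (1 - \<beta>)" by (simp add: algebra_simps)
    then have "(- ln (e (Suc k))) \<le> (- ln (e k) + - ln (1 - \<beta>)) / (1 - \<beta>)"
      using \<beta> by (simp add: pos_le_divide_eq mult.commute)
    then show ?thesis by simp
  qed
  then show thesis using that by blast
qed

text \<open>Integrating the bound on the derivative gives \<open>e (Suc k) powr (1 - \<beta>) \<le> e k\<close>, here in logarithmic
  form.\<close>

lemma step_lower:
  assumes \<beta>: "0 < \<beta>" "\<beta> < 1" and L: "\<forall>\<^sub>F t in at_right p. \<beta> < L t"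
  obtains k0 where "\<And>k. k0 \<le> k \<Longrightarrow> 1 / (1 - \<beta>) * (- ln (e k)) \<le> - ln (e (Suc k))" "e k0 < 1"
proof -
  obtain b where b: "p < b" "\<And>t. p < t \<Longrightarrow> t < b \<Longrightarrow> \<beta> < L t"
    using L unfolding eventually_at_right_field by blast
  define r where "r = min (b - p) (e 1)"
  have r: "0 < r" "p + r \<le> b" "r \<le> e 1" using b e_pos by (auto simp: r_def)
  obtain k0 where k0: "\<And>k. k0 \<le> k \<Longrightarrow> e k < r" using small_k[OF r(1)] by blast
  have ge: "(s - p) powr (1 - \<beta>) \<le> (f ^^ n) s - p" if s: "p < s" "s < p + r" for s
  proof (rule slope_lower_bound[OF \<beta>, of p r "f ^^ n" "deriv (f ^^ n)"])
    fix t assume t: "p < t" "t < p + r"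
    then have tC: "t \<in> {p<..<p + e 1}" using r by auto
    show "(f ^^ n has_real_derivative deriv (f ^^ n) t) (at t)" by (rule return_deriv[OF tC])
    have lt: "ln (t - p) < 0" using tC e_le[of 1] by simp
    have "\<beta> < L t" using b(2)[of t] t r by simp
    then have "- \<beta> * ln (t - p) < ln (deriv (f ^^ n) t)" using lt by (simp add: L_def field_simps)
    moreover have "1 \<le> c ^ n" using c1 by simp
    then have "0 < deriv (f ^^ n) t" using return_slope[OF tC] by linarith
    ultimately have "exp (- \<beta> * ln (t - p)) < deriv (f ^^ n) t" by (metis exp_less_mono exp_ln)
    then show "(t - p) powr (- \<beta>) \<le> deriv (f ^^ n) t" using t by (simp add: powr_def)
    have "(f ^^ n) t \<in> {p<..<p + e 0}" using return_onto[of 0] tC by auto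
    then show "p < (f ^^ n) t" by simp
  qed (use s in auto)
  have "1 / (1 - \<beta>) * (- ln (e k)) \<le> - ln (e (Suc k))" if k: "k0 \<le> k" for k
  proof -
    have "e (Suc k) \<le> exp (ln (e k) / (1 - \<beta>))"
    proof (rule dense_le_bounded[OF e_pos[of "Suc k"]])
      fix y assume y: "0 < y" "y < e (Suc k)"
      then have "p + y \<in> {p<..<p + e (Suc k)}" by simp
      then have "(f ^^ n) (p + y) \<in> {p<..<p + e k}" using return_onto[of k] by blast
      moreover have "y powr (1 - \<beta>) \<le> (f ^^ n) (p + y) - p" using ge[of "p + y"] y k0[of "Suc k"] k by simp
      ultimately have "y powr (1 - \<beta>) \<le> e k" by simp
      then have "ln (y powr (1 - \<beta>)) \<le> ln (e k)"
        using y e_pos[of k] by (subst ln_le_cancel_iff) auto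
      then have "ln y \<le> ln (e k) / (1 - \<beta>)" using y \<beta> by (simp add: ln_powr pos_le_divide_eq mult.commute)
      then show "y \<le> exp (ln (e k) / (1 - \<beta>))" using y by (metis exp_le_cancel_iff exp_ln)
    qed
    then have "ln (e (Suc k)) \<le> ln (e k) / (1 - \<beta>)" using e_pos[of "Suc k"] by (metis exp_gt_zero ln_exp ln_le_cancel_iff)
    then show ?thesis by simp
  qed
  moreover have "e k0 < 1" using k0[of k0] r(3) e_le[of 1] by simp
  ultimately show thesis using that by blast
qed

context
  assumes h: "0 < topological_entropy {0..1} f IJ"
begin

lemma mme_facts:
  shows "prob_space (mme {0..1} f IJ)" "space (mme {0..1} f IJ) = {0..1}"
    "{p<..<p + e k} \<in> sets (mme {0..1} f IJ)"
    "measure (mme {0..1} f IJ) {p<..<p + e k} = u (w 0) * v (w 0) / (lam ^ n) ^ k"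
    "emeasure (mme {0..1} f IJ) {p} = 0"
proof -
  note parry = mme_is_parry[OF h]
  interpret P: perron_measure f m x c lo hi J u v lam "mme {0..1} f IJ"
    using parry(3) by (rule perron_measureI)
  show "prob_space (mme {0..1} f IJ)" by (rule P.prob_space_axioms)
  show "space (mme {0..1} f IJ) = {0..1}" by (rule P.space_M)
  have "{p<..<p + e k} \<subseteq> {0<..<1}" using admissible_unit(1)[OF tower_word] by (simp add: tower del: upt_Suc)
  then show "{p<..<p + e k} \<in> sets (mme {0..1} f IJ)" by (intro P.borel_sub_M) auto
  show "measure (mme {0..1} f IJ) {p<..<p + e k} = u (w 0) * v (w 0) / (lam ^ n) ^ k"
    using parry(4)[OF _ tower_word[of k]] by (simp only: tower tower_mass zero_less_Suc simp_thms)
  have "w 0 \<le> m" using w_J J_less less_imp_le by blast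
  then show "emeasure (mme {0..1} f IJ) {p} = 0"
    unfolding p by (intro knot_null[OF parry(3)] parry(4))
qed

lemma uv_pos: "0 < u (w 0) * v (w 0)"
  using u_pos v_pos w_J by simp

theorem adapted_case:
  assumes \<beta>: "0 < \<beta>" "\<beta> < 1" and L: "\<forall>\<^sub>F t in at_right p. L t < \<beta>" and gap: "1 / (1 - \<beta>) < lam ^ n"
  shows "adapted p (mme {0..1} f IJ)"
proof -
  obtain k0 where k0: "\<And>k. k0 \<le> k \<Longrightarrow> - ln (e (Suc k)) \<le> 1 / (1 - \<beta>) * (- ln (e k) + - ln (1 - \<beta>))"
    using step_upper[OF \<beta> L] by blast
  have \<theta>: "1 < 1 / (1 - \<beta>)" using \<beta> by simp
  have "0 \<le> - ln (1 - \<beta>)" using \<beta> by simp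
  then obtain D where D: "0 \<le> D" "\<forall>k\<ge>k0. - ln (e k) \<le> D * (1 / (1 - \<beta>)) ^ k"
    using growth_upper[where a = "\<lambda>k. - ln (e k)", OF \<theta> k0] by blast
  show ?thesis
    by (rule adapted_of_decay[OF mme_facts(1,2) p_unit(1) mme_facts(5) e_pos e_le e_lim mme_facts(3) eq_refl[OF mme_facts(4)]])
       (use D gap \<beta> uv_pos in auto)
qed

theorem nonadapted_case:
  assumes \<beta>: "0 < \<beta>" "\<beta> < 1" and L: "\<forall>\<^sub>F t in at_right p. \<beta> < L t" and gap: "lam ^ n < 1 / (1 - \<beta>)"
  shows "nonadapted p (mme {0..1} f IJ)"
proof -
  obtain k0 where k0: "\<And>k. k0 \<le> k \<Longrightarrow> 1 / (1 - \<beta>) * (- ln (e k)) \<le> - ln (e (Suc k))" "e k0 < 1"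
    using step_lower[OF \<beta> L] by blast
  have \<theta>: "0 < 1 / (1 - \<beta>)" using \<beta> by simp
  have "0 < - ln (e k0)" using e_pos[of k0] k0(2) by simp
  then obtain D where D: "0 < D" "\<forall>k\<ge>k0. D * (1 / (1 - \<beta>)) ^ k \<le> - ln (e k)"
    using growth_lower[where a = "\<lambda>k. - ln (e k)", OF \<theta> k0(1)] by blast
  show ?thesis
    by (rule nonadapted_of_decay[OF mme_facts(1,2) e_pos e_le mme_facts(3) eq_refl[OF mme_facts(4)[symmetric]]])
       (use D gap lam_pos uv_pos in auto)
qed

end

text \<open>One-sided continuity identifies the orbit of \<open>p\<close> with the limits of the orbits of nearby points of
  the tower, whose labels stay in \<open>J\<close> and whose return images shrink to \<open>p\<close>.\<close>

lemma orbit_in_IJ: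
  assumes cont: "\<And>k. ((f ^^ k) \<longlongrightarrow> (f ^^ k) p) (at_right p)"
  shows "(f ^^ k) p \<in> IJ" "(f ^^ n) p = p"
proof -
  have near: "\<forall>\<^sub>F t in at_right p. t \<in> {p<..<p + e k}" for k
    unfolding eventually_at_right_field by (intro exI[of _ "p + e k"]) (use e_pos in auto)
  have "\<forall>\<^sub>F t in at_right p. (f ^^ k) t \<in> {x (w k)..x (Suc (w k))}"
    using near[of k]
  proof eventually_elim
    case (elim t)
    define K where "K = Suc (k * n)"
    have kK: "k < K" using n by (simp add: K_def less_Suc_eq_le)
    have "t \<in> cyl (map w [0..<K])" using elim tower[of k] unfolding K_def by blast
    then have "(f ^^ k) t \<in> branch (w k)" using kK by (simp add: mem_cyl)
    then show ?case by (auto simp: branch_def)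
  qed
  then have "(f ^^ k) p \<in> {x (w k)..x (Suc (w k))}"
    by (intro Lim_in_closed_set[OF closed_atLeastAtMost _ _ cont[of k]]) auto
  then show "(f ^^ k) p \<in> IJ" unfolding IJ_def using w_J by blast
  have "(f ^^ n) p \<in> {p..p + e k}" for k
  proof (rule Lim_in_closed_set[OF closed_atLeastAtMost _ _ cont[of n]])
    show "\<forall>\<^sub>F t in at_right p. (f ^^ n) t \<in> {p..p + e k}"
      using near[of "Suc k"]
    proof eventually_elim
      case (elim t)
      then have "(f ^^ n) t \<in> {p<..<p + e k}" using return_onto[of k] by blast
      then show ?case by auto
    qed
  qed simp
  then have "p \<le> (f ^^ n) p" "\<And>k. (f ^^ n) p - p \<le> e k" by (auto simp: algebra_simps)
  moreover have "(f ^^ n) p - p \<le> 0" by (rule LIMSEQ_le_const[OF e_lim]) (use calculation(2) in blast)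
  ultimately show "(f ^^ n) p = p" by simp
qed

text \<open>Entropies are nonnegative, so here the uniform measure on the orbit of \<open>p\<close> has maximal entropy, and
  it has an atom at \<open>p\<close>.\<close>

theorem zero_entropy_case:
  assumes h: "\<not> 0 < topological_entropy {0..1} f IJ" and unique: "\<exists>!\<mu>. is_mme {0..1} f IJ \<mu>"
    and cont: "\<And>k. ((f ^^ k) \<longlongrightarrow> (f ^^ k) p) (at_right p)"
  shows "nonadapted p (mme {0..1} f IJ)"
proof -
  note orb = orbit_in_IJ[OF cont]
  define R where "R = restrict_space borel {0..1::real}"
  define N where "N = uniform_count_measure {..<n}"
  define g where "g = (\<lambda>k. (f ^^ k) p)"
  define M where "M = distr N R g"
  have gn: "g n = g 0" using orb(2) by (simp add: g_def)
  have pu: "p \<in> {0..1}" using p_unit by simp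
  have gu: "g k \<in> {0..1}" for k unfolding g_def by (rule f_pow_unit[OF pu])
  have "0 \<in> {..<n}" using n by simp
  then have "{..<n} \<noteq> {}" by blast
  then interpret N: prob_space N unfolding N_def by (intro prob_space_uniform_count_measure) simp_all
  have gm: "g' \<in> N \<rightarrow>\<^sub>M R" if "\<And>k. g' k \<in> {0..1}" for g'
    using that by (auto simp: N_def R_def space_restrict_space measurable_def space_uniform_count_measure sets_uniform_count_measure)
  note gN = gm[of g, OF gu]
  interpret M: prob_space M unfolding M_def by (rule N.prob_space_distr[OF gN])
  have em: "emeasure (distr N R g') A = ennreal ((\<Sum>k<n. if g' k \<in> A then 1 else 0) / real n)"
    if "A \<in> sets R" "\<And>k. g' k \<in> {0..1}" for g' A
  proof -
    have "emeasure (distr N R g') A = emeasure N (g' -` A \<inter> {..<n})"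
      using that gm[of g'] by (subst emeasure_distr) (auto simp: N_def space_uniform_count_measure)
    also have "\<dots> = ennreal (real (card (g' -` A \<inter> {..<n})) / real n)"
      unfolding N_def by (subst emeasure_uniform_count_measure) auto
    also have "real (card (g' -` A \<inter> {..<n})) = (\<Sum>k<n. if g' k \<in> A then 1 else 0)"
      by (simp add: sum.If_cases vimage_def Int_def conj_commute)
    finally show ?thesis .
  qed
  have fR: "f \<in> R \<rightarrow>\<^sub>M R" unfolding R_def by (rule f_measurable)
  have fg: "f \<circ> g = (\<lambda>k. g (Suc k))" by (auto simp: g_def)
  have "distr M M f = distr M R f" by (rule distr_cong) (simp_all add: M_def)
  also have "\<dots> = distr N R (f \<circ> g)" unfolding M_def by (rule distr_distr[OF fR gN])
  also have "\<dots> = M" unfolding fg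
  proof (rule measure_eqI)
    fix A assume "A \<in> sets (distr N R (\<lambda>k. g (Suc k)))"
    then have A: "A \<in> sets R" by simp
    have "(\<Sum>k<Suc n. if g k \<in> A then 1 else 0 :: real) = (if g 0 \<in> A then 1 else 0) + (\<Sum>k<n. if g (Suc k) \<in> A then 1 else 0)"
      by (rule sum.lessThan_Suc_shift)
    then have "(\<Sum>k<n. if g (Suc k) \<in> A then 1 else 0 :: real) = (\<Sum>k<n. if g k \<in> A then 1 else 0)"
      using gn by simp
    then show "emeasure (distr N R (\<lambda>k. g (Suc k))) A = emeasure M A"
      unfolding M_def using em[OF A, of g] em[OF A, of "\<lambda>k. g (Suc k)"] gu by simp
  qed (simp add: M_def)
  finally have inv: "distr M M f = M" .
  have IJR: "IJ \<in> sets R"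
  proof -
    have "{x i..x (Suc i)} \<subseteq> {0..1}" if "i \<in> J" for i
      using x_unit[of i] x_unit[of "Suc i"] J_less[OF that] by auto
    then have "IJ \<subseteq> {0..1}" unfolding IJ_def by (rule UN_least)
    moreover have "IJ \<in> sets borel" unfolding IJ_def using finite_J by (intro sets.finite_UN) auto
    ultimately show ?thesis by (simp add: R_def sets_restrict_space_iff)
  qed
  have "emeasure M IJ = 1"
    unfolding M_def using em[OF IJR, of g] gu orb(1) n by (simp add: g_def)
  then have Minv: "M \<in> invariant_measures {0..1} f IJ"
    using M.prob_space_axioms inv fR by (simp add: invariant_measures_def M_def R_def[symmetric])
  interpret invariant_prob M f
    using Minv unfolding invariant_prob_def invariant_prob_axioms_def invariant_measures_def by blast
  have "measure_entropy M f \<le> topological_entropy {0..1} f IJ"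
    unfolding topological_entropy_def using Minv by (rule SUP_upper)
  then have "measure_entropy M f = topological_entropy {0..1} f IJ"
    using measure_entropy_nonneg h by (simp add: order_antisym not_less) 
  then have "is_mme {0..1} f IJ M" using Minv by (simp add: is_mme_def)
  then have mme: "mme {0..1} f IJ = M" unfolding mme_def by (rule the1_equality[OF unique])
  have "{p} \<in> sets R" using pu by (simp add: R_def sets_restrict_space_iff)
  moreover have "0 < (\<Sum>k<n. if g k \<in> {p} then 1 else 0 :: real)"
    using n by (intro sum_pos2[of _ 0]) (auto simp: g_def)
  ultimately have "emeasure M {p} \<noteq> 0"
    unfolding M_def using em[of "{p}" g] gu n by (simp add: divide_le_0_iff not_le)
  then show ?thesis by (simp add: adapted_def mme)
qed

end

theorem theorem3p2:
  fixes f L :: "real \<Rightarrow> real" and x :: "nat \<Rightarrow> real" and m n j :: nat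
    and p :: real and \<beta>u \<beta>l h :: ereal and I\<^sub>J :: "real set"
  assumes markov: "expanding_markov_map 0 1 f m x"
    and only_singularity: "singularities f m x = {(p, Plus)}"
    and periodic: "has_period (f_tilde f) (p, Plus) n"
    and L: "L = (\<lambda>t. ln (deriv (f ^^ n) t) / (- ln (t - p)))"
    and \<beta>u: "\<beta>u = Limsup (at_right p) (\<lambda>t. ereal (L t))"
    and \<beta>l: "\<beta>l = Liminf (at_right p) (\<lambda>t. ereal (L t))"
    and j: "j < m" "p = x j"
    and I\<^sub>J: "I\<^sub>J = transitive_component f m x j"
    and h: "h = topological_entropy {0..1} f I\<^sub>J"
  shows "(\<beta>u < 1 \<and> h > ereal (- (1 / real n) * ln (1 - real_of_ereal \<beta>u)) \<longrightarrow>
            adapted p (mme {0..1} f I\<^sub>J)) \<and>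
         (0 < h \<or> ((\<exists>!\<mu>. is_mme {0..1} f I\<^sub>J \<mu>) \<and> (\<forall>k. continuous (at_right p) (f ^^ k))) \<longrightarrow>
            (\<beta>l < 1 \<and> h < ereal (- (1 / real n) * ln (1 - real_of_ereal \<beta>l)) \<longrightarrow>
               nonadapted p (mme {0..1} f I\<^sub>J)) \<and>
            (\<beta>l = 1 \<longrightarrow> nonadapted p (mme {0..1} f I\<^sub>J)))"
proof -
  obtain c lo hi where "markov_branches f m x c lo hi" using markov_branches_of_map[OF markov] by blast
  then interpret markov_branches f m x c lo hi .
  have n: "1 \<le> n" using periodic by (simp add: has_period_def)
  have per: "has_period (f_tilde f) (x j, Plus) n" using periodic j(2) by simp
  obtain w where w: "w 0 = j" "\<And>k. w k < m" "\<And>k. nxt (w k) (w (Suc k))" "\<And>k. w (k + n) = w k"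
    "\<And>K. \<exists>d>0. {x j<..<x j + d} \<subseteq> cyl (map w [0..<K])"
    using periodic_itinerary[OF j(1) per] by blast
  have step: "(w i, w (i + Suc k)) \<in> edges\<^sup>+" for i k
  proof (induction k)
    case (Suc k)
    have "(w (i + Suc k), w (i + Suc (Suc k))) \<in> edges" using w(2,3) by (simp add: edges_def)
    with Suc show ?case by (rule trancl_into_trancl)
  qed (use w(2,3) in \<open>auto simp: edges_def\<close>)
  have wmult: "w (k * n) = j" for k
  proof (induction k)
    case (Suc k)
    then show ?case using w(4)[of "k * n"] by (simp add: add.commute)
  qed (simp add: w(1))
  have jj: "(j, j) \<in> edges\<^sup>+"
    using step[of 0 "n - 1"] wmult[of 1] w(1) n by simp
  define J where "J = {i. i < m \<and> leads_to f x j i \<and> leads_to f x i j}"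
  obtain u v lam where pd: "perron_data f m x c lo hi J u v lam"
    using perron_data_exists[OF j(1) jj] unfolding J_def by blast
  interpret perron_data f m x c lo hi J u v lam by (rule pd)
  have IJ: "IJ = I\<^sub>J" unfolding IJ_def unfolding I\<^sub>J transitive_component_def J_def ..
  have wJ: "w k \<in> J" for k
  proof -
    have "(j, w k) \<in> edges\<^sup>+"
      using step[of 0 "k - 1"] w(1) jj by (cases "k = 0") auto
    moreover have "(w k, j) \<in> edges\<^sup>+"
    proof -
      have "k < Suc k * n" using n by (cases n) auto
      then have "k + Suc (Suc k * n - Suc k) = Suc k * n" by simp
      then show ?thesis using step[of k "Suc k * n - Suc k"] wmult[of "Suc k"] by metis
    qed
    ultimately show ?thesis using leads_to_iff j(1) w(2) by (simp add: J_def)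
  qed
  have germ: "\<And>K. \<exists>d>0. {x (w 0)<..<x (w 0) + d} \<subseteq> cyl (map w [0..<K])" using w(1,5) by simp
  obtain e where e: "\<And>k. 0 < e k" "\<And>k. cyl (map w [0..<Suc (k * n)]) = {x (w 0)<..<x (w 0) + e k}"
    "\<And>k. e k \<le> 1" "e \<longlonglongrightarrow> 0"
    "\<And>k. (f ^^ n) ` cyl (map w [0..<Suc (Suc k * n)]) = cyl (map w [0..<Suc (k * n)])"
    "\<And>t. t \<in> cyl (map w [0..<Suc (1 * n)]) \<Longrightarrow> (f ^^ n has_real_derivative deriv (f ^^ n) t) (at t)"
    "\<And>t. t \<in> cyl (map w [0..<Suc (1 * n)]) \<Longrightarrow> c ^ n \<le> deriv (f ^^ n) t"
    using cylinder_tower[OF n w(2,3,4) germ] by blast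
  have px: "p = x (w 0)" using j(2) w(1) by simp
  interpret P: periodic_point f m x c lo hi J u v lam n w e p
  proof
    show "(f ^^ n) ` {p<..<p + e (Suc k)} = {p<..<p + e k}" for k using e(5)[of k] unfolding e(2) px .
    show "(f ^^ n has_real_derivative deriv (f ^^ n) t) (at t)" if "t \<in> {p<..<p + e 1}" for t
      using e(6)[of t] that unfolding e(2) px .
    show "c ^ n \<le> deriv (f ^^ n) t" if "t \<in> {p<..<p + e 1}" for t
      using e(7)[of t] that unfolding e(2) px .
    show "cyl (map w [0..<Suc (k * n)]) = {p<..<p + e k}" for k unfolding px by (rule e(2))
  qed (use n wJ w(3,4) px e(1,3,4) in auto)
  have LP: "L = P.L" by (simp add: L P.L_def[abs_def])
  have bot: "at_right p \<noteq> bot" by simp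
  have nonneg: "0 \<le> \<beta>u" "0 \<le> \<beta>l"
    unfolding \<beta>u \<beta>l LP using ereal_Limsup_nonneg[OF P.L_nonneg bot] by auto
  have adapted: "adapted p (mme {0..1} f I\<^sub>J)"
    if b: "\<beta>u < 1" "h > ereal (- (1 / real n) * ln (1 - real_of_ereal \<beta>u))"
  proof -
    obtain bu where bu: "\<beta>u = ereal bu" "0 \<le> bu" "bu < 1" using nonneg(1) b(1) by (cases \<beta>u) auto
    have "0 \<le> - (1 / real n) * ln (1 - bu)" using bu by (simp add: divide_nonpos_nonneg)
    then have "0 \<le> ereal (- (1 / real n) * ln (1 - bu))" by (simp only: ereal_less_eq)
    also have "\<dots> < h" using b(2) bu by simp
    finally have h0: "0 < topological_entropy {0..1} f IJ" using h IJ by simp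
    note parry = mme_is_parry[OF h0]
    have "- (1 / real n) * ln (1 - bu) < ln lam" using b(2) bu parry(2) h IJ by simp
    then have "- ln (1 - bu) < real n * ln lam" using n by (simp add: field_simps)
    also have "real n * ln lam = ln (lam ^ n)" using parry(1) by (simp add: ln_realpow)
    finally have "ln (1 / (1 - bu)) < ln (lam ^ n)" using bu by (simp add: ln_div)
    then have lt: "1 / (1 - bu) < lam ^ n" using bu parry(1) by simp
    then have "bu < 1 - 1 / lam ^ n" using bu parry(1) by (simp add: field_simps)
    then obtain \<beta> where \<beta>: "bu < \<beta>" "\<beta> < 1 - 1 / lam ^ n" using dense by blast
    have "0 < 1 / lam ^ n" using parry(1) by simp
    then have \<beta>1: "0 < \<beta>" "\<beta> < 1" using \<beta> bu(2) by linarith+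
    have gap: "1 / (1 - \<beta>) < lam ^ n" using \<beta> \<beta>1 parry(1) by (simp add: field_simps)
    have "Limsup (at_right p) (\<lambda>t. ereal (P.L t)) < ereal \<beta>" using \<beta>(1) bu(1) \<beta>u LP by simp
    then have "\<forall>\<^sub>F t in at_right p. P.L t < \<beta>" using Limsup_lessD by fastforce
    then show ?thesis using P.adapted_case[OF h0 \<beta>1 _ gap] IJ by simp
  qed
  have large: "nonadapted p (mme {0..1} f I\<^sub>J)"
    if h0: "0 < h" and b: "0 < \<beta>" "\<beta> < 1" "ereal \<beta> < \<beta>l" "h < ereal (- (1 / real n) * ln (1 - \<beta>))" for \<beta>
  proof -
    have h0': "0 < topological_entropy {0..1} f IJ" using h0 h IJ by simp
    note parry = mme_is_parry[OF h0']
    have "ln lam < - (1 / real n) * ln (1 - \<beta>)" using b(4) parry(2) h IJ by simp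
    then have "real n * ln lam < - ln (1 - \<beta>)" using n by (simp add: field_simps)
    moreover have "real n * ln lam = ln (lam ^ n)" using parry(1) by (simp add: ln_realpow)
    ultimately have "ln (lam ^ n) < ln (1 / (1 - \<beta>))" using b by (simp add: ln_div)
    then have gap: "lam ^ n < 1 / (1 - \<beta>)" using b parry(1) by simp
    have "ereal \<beta> < Liminf (at_right p) (\<lambda>t. ereal (P.L t))" using b(3) \<beta>l LP by simp
    then have "\<forall>\<^sub>F t in at_right p. \<beta> < P.L t" using less_LiminfD by fastforce
    then show ?thesis using P.nonadapted_case[OF h0' b(1,2) _ gap] IJ by simp
  qed
  have zero: "nonadapted p (mme {0..1} f I\<^sub>J)"
    if "\<not> 0 < h" "\<exists>!\<mu>. is_mme {0..1} f I\<^sub>J \<mu>" "\<forall>k. continuous (at_right p) (f ^^ k)"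
    using P.zero_entropy_case that h IJ by (simp add: continuous_within)
  have case2: "nonadapted p (mme {0..1} f I\<^sub>J)"
    if h0: "0 < h" and b: "\<beta>l < 1" "h < ereal (- (1 / real n) * ln (1 - real_of_ereal \<beta>l))"
  proof -
    obtain bl where bl: "\<beta>l = ereal bl" "0 \<le> bl" "bl < 1" using nonneg(2) b(1) by (cases \<beta>l) auto
    obtain r where r: "h = ereal r" "0 < r" using h0 b(2) by (cases h) auto
    have "r < - (1 / real n) * ln (1 - bl)" using b(2) bl r by simp
    then have "real n * r < - ln (1 - bl)" using n by (simp add: field_simps)
    then have "exp (ln (1 - bl)) < exp (- (real n * r))" by (intro exp_less_mono) simp
    then have "1 - exp (- (real n * r)) < bl" using bl by simp
    \<comment> \<open>The lower end point is where \<open>1 / (1 - \<beta>)\<close> equals \<open>exp (n * r)\<close>.\<close>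
    then obtain \<beta> where \<beta>: "1 - exp (- (real n * r)) < \<beta>" "\<beta> < bl" using dense by blast
    have "exp (- (real n * r)) < exp 0" using r n by (intro exp_less_mono) simp
    then have "exp (- (real n * r)) < 1" by (simp only: exp_zero)
    then have \<beta>1: "0 < \<beta>" "\<beta> < 1" using \<beta> bl by linarith+
    have "ln (1 - \<beta>) < ln (exp (- (real n * r)))" using \<beta> \<beta>1 by (subst ln_less_cancel_iff) auto
    then have "real n * r < - ln (1 - \<beta>)" by simp
    then have "r < - (1 / real n) * ln (1 - \<beta>)" using n by (simp add: field_simps)
    then show ?thesis using large[OF h0 \<beta>1] \<beta>(2) bl(1) r(1) by simp
  qed
  have case3: "nonadapted p (mme {0..1} f I\<^sub>J)" if h0: "0 < h" and b: "\<beta>l = 1"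
  proof -
    have "h = ereal (ln lam)" using mme_is_parry(2) h0 h IJ by simp
    then obtain r where r: "h = ereal r" "0 < r" using h0 by (cases h) auto
    \<comment> \<open>Every \<open>\<beta> < 1\<close> with \<open>1 / (1 - \<beta>) > exp (n * r)\<close> will do; this one overshoots by the factor \<open>2\<close>.\<close>
    define \<beta> where "\<beta> = 1 - exp (- (real n * r)) / 2"
    have "exp (- (real n * r)) < exp 0" using r n by (intro exp_less_mono) simp
    then have e1: "exp (- (real n * r)) < 1" by (simp only: exp_zero)
    then have \<beta>1: "0 < \<beta>" "\<beta> < 1" using exp_gt_zero[of "- (real n * r)"] unfolding \<beta>_def by linarith+
    have "ln (1 - \<beta>) < ln (exp (- (real n * r)))"
      unfolding \<beta>_def by (subst ln_less_cancel_iff) auto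
    then have "real n * r < - ln (1 - \<beta>)" by simp
    then have "r < - (1 / real n) * ln (1 - \<beta>)" using n by (simp add: field_simps)
    then show ?thesis using large[OF h0 \<beta>1] \<beta>1(2) b r(1) by simp
  qed
  show ?thesis using adapted zero case2 case3 by blast
qed

end
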